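(* Let $X$ be an even real hereditarily indecomposable (HI) Banach space. Then $\mathrm{GL}(X)$ has exactly two connected components, listed below: - $\mathrm{GL}_0(X) := \{T \in \mathrm{GL}(X) \mid \mathrm{Par}(T) = 0\}$, containing $\mathrm{Id}_X$ and $-\mathrm{Id}_X$; - $\mathrm{GL}_1(X) := \{T \in \mathrm{GL}(X) \mid \mathrm{Par}(T) = 1\}$, containing all reflections and all antireflections of $X$.
   Context: Banach spaces are infinite-dimensional. A subspace of a Banach space means an infinite-dimensional closed subspace; operators are bounded and linear; hyperplanes are closed subspaces of codimension $1$ (they are all mutually isomorphic). A Banach space is hereditarily indecomposable (HI) if it contains no topological direct sum of two subspaces, i.e. there are no infinite-dimensional closed subspaces $Y,Z$ with $Y\cap Z=\{0\}$ and $Y+Z$ closed. $\mathcal{L}(X)$ is the algebra of operators on $X$ and $\mathrm{GL}(X)$ its group of invertible elements, both with the operator norm topology. An operator on $X$ is strictly singular if it induces no isomorphism between two subspaces of $X$; the set $\mathcal{S}(X)$ of these is a closed two-sided ideal of $\mathcal{L}(X)$, and $\pi_X\colon\mathcal{L}(X)\to\mathcal{L}(X)/\mathcal{S}(X)$ is the projection. The subalgebra of $\mathcal{L}(X)/\mathcal{S}(X)$ generated by the image of the identity is identified with $\mathbb{R}$. By a theorem of Ferenczi, for a real HI space $X$, the quotient $\mathcal{L}(X)/\mathcal{S}(X)$ is isomorphic, as a unital Banach algebra, to $\mathbb{R}$, $\mathbb{C}$ or the quaternion algebra $\mathbb{H}$; $X$ has type $\mathbb{R}$, $\mathbb{C}$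 or $\mathbb{H}$ accordingly. A complex structure on a real Banach space $Y$ is an operator $J\in\mathcal{L}(Y)$ with $J^2=-\mathrm{Id}_Y$. A real Banach space $X$ is even if it admits a complex structure and its hyperplanes do not; it is odd if it does not admit a complex structure and its hyperplanes do. Even or odd real HI spaces have type $\mathbb{C}$ or $\mathbb{H}$. The spectrum $\sigma(T)\subseteq\mathbb{C}$ of $T\in\mathcal{L}(X)$, its eigenvalues and their multiplicities, are those of the complexification $T^{\mathbb{C}}(x+iy)=T(x)+iT(y)$ acting on the complexification $X^{\mathbb{C}}$ of $X$ (formal sums $x+iy$, $x,y\in X$, with norm $\|x+iy\|=\sup_{\theta\in\mathbb{R}}\|\cos\theta\cdot x+\sin\theta\cdot y\|$); multiplicity means algebraic multiplicity. For an open interval $I$ of $\mathbb{R}$, with boundary $\partial I$ in $\mathbb{R}$, $\mathrm{NS}^I(X)$ is the set of $T\in\mathcal{L}(X)$ with $\pi_X(T)\notin I$ and $\sigma(T)\cap\partial I=\varnothing$. For $T\in\mathrm{NS}^I(X)$, $\sigma(T)\cap I$ consists of finitely many isolated eigenvalues with finite multiplicities, and $p^I(T)\in\mathbb{Z}/2\mathbb{Z}$ denotes the parity of the sum of the multiplicities of the eigenvalues of $T$ contained in $I$. For $X$ a real HI space of type $\mathbb{C}$ or $\mathbb{H}$, $p^{\mathbb{R}}$ is constant on the nonempty set $\mathrm{NS}^{\mathbb{R}}(X)$, and $\mathrm{Par}(X)\in\mathbb{Z}/2\mathbb{Z}$ denotes its unique value. The map $\mathrm{Par}\colon\mathrm{GL}(X)\to\mathbb{Z}/2\mathbb{Z}$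 is (well-)defined by $\mathrm{Par}(T):=p^{(-\infty,0)}(T)$ for $T\in\mathrm{GL}(X)\cap\mathrm{NS}^{(-\infty,0)}(X)$ and $\mathrm{Par}(T):=\mathrm{Par}(X)-p^{(0,+\infty)}(T)$ for $T\in\mathrm{GL}(X)\cap\mathrm{NS}^{(0,+\infty)}(X)$; these two sets cover $\mathrm{GL}(X)$. A reflection of $X$ is an operator $R\in\mathcal{L}(X)$ for which there exist a hyperplane $H\subseteq X$ and $x_0\in X\setminus\{0\}$ with $R(x)=x$ for all $x\in H$ and $R(x_0)=-x_0$. An antireflection is an operator of the form $-R$ with $R$ a reflection. *)

theory Defs
  imports "HOL-Analysis.Analysis" "HOL-Library.Z2"
begin

definition infinite_dimensional :: "'a::real_vector set \<Rightarrow> bool" where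
  "infinite_dimensional Y \<longleftrightarrow> \<not> (\<exists>B. finite B \<and> Y \<subseteq> span B)"

definition banach_subspace :: "'a::real_normed_vector set \<Rightarrow> bool" where
  "banach_subspace Y \<longleftrightarrow> subspace Y \<and> closed Y \<and> infinite_dimensional Y"

definition hereditarily_indecomposable :: "'a::real_normed_vector itself \<Rightarrow> bool" where
  "hereditarily_indecomposable (_ :: 'a itself) \<longleftrightarrow>
     \<not> (\<exists>Y Z :: 'a set. banach_subspace Y \<and> banach_subspace Z \<and> Y \<inter> Z = {0} \<and>
          closed {y + z | y z. y \<in> Y \<and> z \<in> Z})"

definition hyperplane :: "'a::real_normed_vector set \<Rightarrow> bool" where
  "hyperplane H \<longleftrightarrow> subspace H \<and> closed H \<and> (\<exists>v. v \<notin> H \<and> span (insert v H) = UNIV)"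

text \<open>A complex structure on a closed subspace \<open>Y\<close>, viewed as a Banach space in its own right.
  Only the values of \<open>J\<close> on \<open>Y\<close> matter.\<close>

definition bounded_operator_on :: "'a::real_normed_vector set \<Rightarrow> ('a \<Rightarrow> 'a) \<Rightarrow> bool" where
  "bounded_operator_on Y J \<longleftrightarrow>
     (\<forall>x\<in>Y. J x \<in> Y) \<and>
     (\<forall>x\<in>Y. \<forall>y\<in>Y. J (x + y) = J x + J y) \<and>
     (\<forall>c. \<forall>x\<in>Y. J (c *\<^sub>R x) = c *\<^sub>R J x) \<and>
     (\<exists>K. \<forall>x\<in>Y. norm (J x) \<le> K * norm x)"

definition complex_structure_on :: "'a::real_normed_vector set \<Rightarrow> ('a \<Rightarrow> 'a) \<Rightarrow> bool" where
  "complex_structure_on Y J \<longleftrightarrow> bounded_operator_on Y J \<and> (\<forall>x\<in>Y. J (J x) = - x)"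

definition even_space :: "'a::real_normed_vector itself \<Rightarrow> bool" where
  "even_space (_ :: 'a itself) \<longleftrightarrow>
     (\<exists>J. complex_structure_on (UNIV :: 'a set) J) \<and>
     (\<forall>H :: 'a set. hyperplane H \<longrightarrow> \<not> (\<exists>J. complex_structure_on H J))"

definition GL :: "('a::real_normed_vector \<Rightarrow>\<^sub>L 'a) set" where
  "GL = {T. \<exists>S. T o\<^sub>L S = id_blinfun \<and> S o\<^sub>L T = id_blinfun}"

definition strictly_singular :: "('a::real_normed_vector \<Rightarrow>\<^sub>L 'a) \<Rightarrow> bool" where
  "strictly_singular T \<longleftrightarrow>
     \<not> (\<exists>Y Z. banach_subspace Y \<and> banach_subspace Z \<and>
          (\<exists>g. homeomorphism Y Z (blinfun_apply T) g))"

text \<open>The projection onto the quotient by the strictly singular operators; elements of the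
  quotient are represented by cosets.\<close>

definition ss_proj :: "('a::real_normed_vector \<Rightarrow>\<^sub>L 'a) \<Rightarrow> ('a \<Rightarrow>\<^sub>L 'a) set" where
  "ss_proj T = {T + S | S. strictly_singular S}"

datatype 'a complexification = Cx (re_part: 'a) (im_part: 'a)

instantiation complexification :: (real_normed_vector) real_normed_vector
begin

definition zero_complexification :: "'a complexification" where
  "zero_complexification = Cx 0 0"
definition plus_complexification ::
    "'a complexification \<Rightarrow> 'a complexification \<Rightarrow> 'a complexification" where
  "plus_complexification z w = Cx (re_part z + re_part w) (im_part z + im_part w)"
definition minus_complexification ::
    "'a complexification \<Rightarrow> 'a complexification \<Rightarrow> 'a complexification" where
  "minus_complexification z w = Cx (re_part z - re_part w) (im_part z - im_part w)"
definition uminus_complexification :: "'a complexification \<Rightarrow> 'a complexification" where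
  "uminus_complexification z = Cx (- re_part z) (- im_part z)"
definition scaleR_complexification ::
    "real \<Rightarrow> 'a complexification \<Rightarrow> 'a complexification" where
  "scaleR_complexification c z = Cx (c *\<^sub>R re_part z) (c *\<^sub>R im_part z)"
definition norm_complexification :: "'a complexification \<Rightarrow> real" where
  "norm_complexification z =
     (SUP \<theta>::real. norm (cos \<theta> *\<^sub>R re_part z + sin \<theta> *\<^sub>R im_part z))"
definition dist_complexification ::
    "'a complexification \<Rightarrow> 'a complexification \<Rightarrow> real" where
  "dist_complexification z w = norm (z - w)"
definition sgn_complexification :: "'a complexification \<Rightarrow> 'a complexification" where
  "sgn_complexification z = inverse (norm z) *\<^sub>R z"
definition uniformity_complexification ::
    "('a complexification \<times> 'a complexification) filter" where
  "uniformity_complexification =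
     (INF e\<in>{0 <..}. principal {(z, w). dist z w < e})"
definition open_complexification :: "'a complexification set \<Rightarrow> bool" where
  "open_complexification U \<longleftrightarrow>
     (\<forall>z\<in>U. eventually (\<lambda>(z', w). z' = z \<longrightarrow> w \<in> U) uniformity)"

instance
proof
  fix a b c :: "'a complexification" and r s :: real and U :: "'a complexification set"
  note ops = zero_complexification_def plus_complexification_def minus_complexification_def
    uminus_complexification_def scaleR_complexification_def
  show "a + b + c = a + (b + c)" "a + b = b + a" "0 + a = a" "- a + a = 0" "a - b = a + - b"
    by (simp_all add: ops algebra_simps complexification.expand)
  show "r *\<^sub>R (a + b) = r *\<^sub>R a + r *\<^sub>R b" "(r + s) *\<^sub>R a = r *\<^sub>R a + s *\<^sub>R a"
    "r *\<^sub>R s *\<^sub>R a = (r * s) *\<^sub>R a" "1 *\<^sub>R a = a"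
    by (simp_all add: ops algebra_simps complexification.expand)
  show "dist a b = norm (a - b)" by (rule dist_complexification_def)
  show "sgn a = inverse (norm a) *\<^sub>R a" by (rule sgn_complexification_def)
  show "(uniformity :: ('a complexification \<times> 'a complexification) filter) =
      (INF e\<in>{0 <..}. principal {(z, w). dist z w < e})"
    by (rule uniformity_complexification_def)
  show "open U \<longleftrightarrow> (\<forall>z\<in>U. eventually (\<lambda>(z', w). z' = z \<longrightarrow> w \<in> U) uniformity)"
    by (rule open_complexification_def)
  define f where
    "f z \<theta> = norm (cos \<theta> *\<^sub>R re_part z + sin \<theta> *\<^sub>R im_part z)"
    for z :: "'a complexification" and \<theta> :: real
  have nrm: "norm z = (SUP \<theta>. f z \<theta>)" for z :: "'a complexification"
    by (simp add: norm_complexification_def f_def)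
  have "f z \<theta> \<le> norm (re_part z) + norm (im_part z)" for z \<theta>
  proof -
    have "f z \<theta> \<le> \<bar>cos \<theta>\<bar> * norm (re_part z) + \<bar>sin \<theta>\<bar> * norm (im_part z)"
      unfolding f_def by (metis norm_scaleR norm_triangle_ineq)
    also have "\<dots> \<le> 1 * norm (re_part z) + 1 * norm (im_part z)"
      by (intro add_mono mult_right_mono) auto
    finally show ?thesis by simp
  qed
  then have bdd: "bdd_above (range (f z))" for z
    by (intro bdd_aboveI) auto
  have le: "f z \<theta> \<le> norm z" for z \<theta>
    unfolding nrm by (intro cSUP_upper bdd UNIV_I)
  have zero: "norm (0 :: 'a complexification) = 0"
    by (simp add: nrm f_def zero_complexification_def)
  show "norm a = 0 \<longleftrightarrow> a = 0"
  proof
    assume "norm a = 0"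
    then have "re_part a = 0" "im_part a = 0"
      using le[of a 0] le[of a "pi / 2"] by (simp_all add: f_def)
    then show "a = 0" by (simp add: zero_complexification_def complexification.expand)
  qed (simp add: zero)
  show "norm (a + b) \<le> norm a + norm b"
    unfolding nrm[of "a + b"]
  proof (rule cSUP_least)
    fix \<theta> :: real
    have "f (a + b) \<theta> = norm ((cos \<theta> *\<^sub>R re_part a + sin \<theta> *\<^sub>R im_part a) +
        (cos \<theta> *\<^sub>R re_part b + sin \<theta> *\<^sub>R im_part b))"
      by (simp add: f_def plus_complexification_def algebra_simps)
    also have "\<dots> \<le> f a \<theta> + f b \<theta>" unfolding f_def by (rule norm_triangle_ineq)
    also have "\<dots> \<le> norm a + norm b" by (intro add_mono le)
    finally show "f (a + b) \<theta> \<le> norm a + norm b" .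
  qed simp
  have scale: "f (r *\<^sub>R z) \<theta> = \<bar>r\<bar> * f z \<theta>" for r z \<theta>
  proof -
    have "f (r *\<^sub>R z) \<theta> =
        norm (r *\<^sub>R (cos \<theta> *\<^sub>R re_part z + sin \<theta> *\<^sub>R im_part z))"
      by (simp add: f_def scaleR_complexification_def algebra_simps)
    then show ?thesis by (simp add: f_def)
  qed
  have scale_le: "norm (r *\<^sub>R z) \<le> \<bar>r\<bar> * norm z" for r and z :: "'a complexification"
    unfolding nrm[of "r *\<^sub>R z"] by (rule cSUP_least) (auto simp: scale intro: mult_left_mono le)
  show "norm (r *\<^sub>R a) = \<bar>r\<bar> * norm a"
  proof (cases "r = 0")
    case True
    then have "r *\<^sub>R a = 0" by (simp add: ops)
    then show ?thesis using True zero by simp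
  next
    case False
    have "inverse r *\<^sub>R r *\<^sub>R a = a"
      using False by (simp add: ops)
    then have "norm a \<le> \<bar>inverse r\<bar> * norm (r *\<^sub>R a)"
      using scale_le[of "inverse r" "r *\<^sub>R a"] by simp
    then have "\<bar>r\<bar> * norm a \<le> norm (r *\<^sub>R a)"
      using False by (simp add: field_simps)
    then show ?thesis using scale_le[of r a] by simp
  qed
qed

end

definition scaleC ::
    "complex \<Rightarrow> 'a::real_normed_vector complexification \<Rightarrow> 'a complexification" where
  "scaleC c z = Cx (Re c *\<^sub>R re_part z - Im c *\<^sub>R im_part z)
                   (Re c *\<^sub>R im_part z + Im c *\<^sub>R re_part z)"

lemma vector_space_scaleC:
  "vector_space (scaleC :: complex \<Rightarrow> 'a::real_normed_vector complexification \<Rightarrow> _)"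
  by unfold_locales
    (simp_all add: scaleC_def plus_complexification_def algebra_simps complexification.expand)

definition complexify ::
    "('a::real_normed_vector \<Rightarrow>\<^sub>L 'a) \<Rightarrow> 'a complexification \<Rightarrow> 'a complexification" where
  "complexify T z = Cx (blinfun_apply T (re_part z)) (blinfun_apply T (im_part z))"

definition op_spectrum :: "('a::real_normed_vector \<Rightarrow>\<^sub>L 'a) \<Rightarrow> complex set" where
  "op_spectrum T =
     {c. \<not> (\<exists>S. bounded_linear S \<and> (\<forall>a z. S (scaleC a z) = scaleC a (S z)) \<and>
               (\<forall>z. S (complexify T z - scaleC c z) = z) \<and>
               (\<forall>z. complexify T (S z) - scaleC c (S z) = z))}"

definition op_eigenvalue :: "('a::real_normed_vector \<Rightarrow>\<^sub>L 'a) \<Rightarrow> complex \<Rightarrow> bool" where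
  "op_eigenvalue T c \<longleftrightarrow> (\<exists>z. z \<noteq> 0 \<and> complexify T z = scaleC c z)"

text \<open>Algebraic multiplicity: the complex dimension of the generalized eigenspace. The library
  function \<open>dim\<close> returns \<open>0\<close> on infinite-dimensional spaces, so this is only
  meaningful where the generalized eigenspace is finite-dimensional.\<close>

definition alg_multiplicity :: "('a::real_normed_vector \<Rightarrow>\<^sub>L 'a) \<Rightarrow> complex \<Rightarrow> nat" where
  "alg_multiplicity T c =
     vector_space.dim scaleC {z. \<exists>n. ((\<lambda>w. complexify T w - scaleC c w) ^^ n) z = 0}"

text \<open>The sets \<open>NS I\<close> and the parity \<open>parity_on I\<close> are used for open intervals
  \<open>I\<close> only. The second condition uses that the real multiples of the identity
  class are identified with the real numbers.\<close>

definition NS :: "real set \<Rightarrow> ('a::real_normed_vector \<Rightarrow>\<^sub>L 'a) set" where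
  "NS I = {T. op_spectrum T \<inter> complex_of_real ` frontier I = {} \<and>
              ss_proj T \<notin> (\<lambda>t. ss_proj (t *\<^sub>R id_blinfun)) ` I}"

definition parity_on :: "real set \<Rightarrow> ('a::real_normed_vector \<Rightarrow>\<^sub>L 'a) \<Rightarrow> bit" where
  "parity_on I T =
     of_nat (\<Sum>t | t \<in> I \<and> op_eigenvalue T (complex_of_real t).
               alg_multiplicity T (complex_of_real t))"

definition space_Par :: "'a::real_normed_vector itself \<Rightarrow> bit" where
  "space_Par (_ :: 'a itself) =
     (THE p. \<forall>T \<in> (NS UNIV :: ('a \<Rightarrow>\<^sub>L 'a) set). parity_on UNIV T = p)"

text \<open>The two clauses agree where both apply, and for invertible \<open>T\<close> at least one
  applies, if the space is real hereditarily indecomposable and its quotient algebra modulo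
  strictly singular operators is complex or quaternionic.\<close>

definition Par :: "('a::real_normed_vector \<Rightarrow>\<^sub>L 'a) \<Rightarrow> bit" where
  "Par T = (THE p. (T \<in> NS {..<0} \<longrightarrow> p = parity_on {..<0} T) \<and>
                   (T \<in> NS {0<..} \<longrightarrow> p = space_Par TYPE('a) - parity_on {0<..} T))"

definition GL0 :: "('a::real_normed_vector \<Rightarrow>\<^sub>L 'a) set" where
  "GL0 = {T \<in> GL. Par T = 0}"

definition GL1 :: "('a::real_normed_vector \<Rightarrow>\<^sub>L 'a) set" where
  "GL1 = {T \<in> GL. Par T = 1}"

definition reflection :: "('a::real_normed_vector \<Rightarrow>\<^sub>L 'a) \<Rightarrow> bool" where
  "reflection R \<longleftrightarrow>
     (\<exists>H x0. hyperplane H \<and> x0 \<noteq> 0 \<and>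
        (\<forall>x\<in>H. blinfun_apply R x = x) \<and> blinfun_apply R x0 = - x0)"

definition antireflection :: "('a::real_normed_vector \<Rightarrow>\<^sub>L 'a) \<Rightarrow> bool" where
  "antireflection T \<longleftrightarrow> (\<exists>R. reflection R \<and> T = - R)"

end

theory Submission
  imports Defs "Jordan_Normal_Form.Determinant" "HOL-Complex_Analysis.Conformal_Mappings"
begin

text \<open>
  On a hereditarily indecomposable space an operator is either strictly singular or the sum of an
  invertible operator and one of finite rank. Hence, if \<open>T\<close> is invertible and no \<open>T - t\<close> with
  \<open>t < 0\<close> is strictly singular, the negative spectrum of \<open>T\<close> consists of finitely many eigenvalues
  of finite total multiplicity \<open>m\<close>. Splitting them off with spectral projections gives
  \<open>T = G E\<close>, where \<open>E\<close> has no negative spectrum and is joined to the identity by a segment, and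
  \<open>G\<close> is a finite-rank perturbation of the identity joined to a product of \<open>m\<close> reflections.
  If \<open>E\<close> has no spectrum in \<open>{..0}\<close> and \<open>T - E\<close> has finite rank, then \<open>det (T E\<inverse>)\<close> has sign
  \<open>(-1) ^ m\<close>; since one such difference \<open>T - E\<close> serves for all operators near \<open>T\<close>, the parity of
  \<open>m\<close> is locally constant.

  A complex structure \<open>J\<close> joins \<open>T\<close> to \<open>- T\<close> through \<open>(cos \<theta> + J sin \<theta>) T\<close>. If no \<open>T - t\<close> with
  \<open>t\<close> real is strictly singular, one of the segments from \<open>T\<close> to \<open>J\<close> and to \<open>- J\<close> stays among such
  operators, so the total multiplicity of the real eigenvalues is even. Therefore the two
  definitions of the parity agree, the parity is locally constant on the general linear group, and
  it separates the identity from a reflection; every invertible operator is joined to one of the two.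
\<close>


subsection \<open>Determinants of finite square arrays\<close>

text \<open>Under a small perturbation two negative eigenvalues may collide and leave the real line
  as a conjugate pair, so only the parity of the multiplicity can persist; the sign of a real
  determinant carries it. Such determinants exist only for finite-rank perturbations of the
  identity, which dictates the factorization through \<open>E\<close>, and since \<open>E\<close> is
  not canonical the sign must be shown independent of it.

  The dichotomy rests on a comparison of subspaces: an operator bounded below on one
  infinite-dimensional subspace, but on none of finite codimension, would be nearly zero on another
  infinite-dimensional subspace, and the two would form a closed direct sum. Index zero then follows
  by deforming the operator into a multiple of the identity among operators bounded below on
  subspaces of finite codimension.

  Spectral projections are built algebraically instead of by contour integrals. They need the
  generalized kernels to stabilize, which follows from a bound of finite order on the inverse of
  \<open>T - t\<close> near a singular point; the order is that of a zero of a holomorphic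
  determinant.\<close>

definition ndet :: "nat \<Rightarrow> (nat \<Rightarrow> nat \<Rightarrow> 'a::comm_ring_1) \<Rightarrow> 'a" where
  "ndet n M = Determinant.det (Matrix.mat n n (\<lambda>(i, j). M i j))"

lemma ndet_leibniz:
  "ndet n M = (\<Sum>p | p permutes {0..<n}. signof p * (\<Prod>i = 0..<n. M i (p i)))"
proof -
  have "(\<Prod>i = 0..<n. Matrix.mat n n (\<lambda>(i, j). M i j) $$ (i, p i)) = (\<Prod>i = 0..<n. M i (p i))"
    if "p permutes {0..<n}" for p
    by (intro prod.cong) (use permutes_in_image[OF that] in auto)
  then show ?thesis
    unfolding ndet_def by (subst det_def'[of _ n]) (auto intro!: sum.cong)
qed

lemma ndet_cong:
  assumes "\<And>i j. i < n \<Longrightarrow> j < n \<Longrightarrow> M i j = N i j"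
  shows "ndet n M = ndet n N"
  unfolding ndet_def by (rule arg_cong[of _ _ Determinant.det]) (auto simp: assms)

lemma ndet_mult:
  "ndet n (\<lambda>i j. \<Sum>k<n. A i k * B k j) = ndet n A * ndet n B"
proof -
  have "Matrix.mat n n (\<lambda>(i, j). \<Sum>k<n. A i k * B k j) =
      Matrix.mat n n (\<lambda>(i, j). A i j) * Matrix.mat n n (\<lambda>(i, j). B i j)"
    by (rule eq_matI) (auto simp: scalar_prod_def atLeast0LessThan)
  then show ?thesis
    unfolding ndet_def by (simp add: det_mult[of _ n])
qed

lemma ndet_scalar: "ndet n (\<lambda>i j. if i = j then c else 0) = c ^ n"
proof -
  have "Matrix.mat n n (\<lambda>(i, j). if i = j then c else 0) = c \<cdot>\<^sub>m 1\<^sub>m n"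
    by (rule eq_matI) auto
  then show ?thesis
    unfolding ndet_def by simp
qed

text \<open>Both sides are the determinant of the block array with rows \<open>1, - A\<close> and
  \<open>B, 1\<close>, factored into triangular blocks in two ways. The sizes \<open>n\<close> and
  \<open>m\<close> are independent, which allows passing from the number of summands of a
  finite-rank operator to the dimension of a space containing its range.\<close>

lemma ndet_sylvester:
  fixes A B :: "nat \<Rightarrow> nat \<Rightarrow> 'a::idom"
  shows "ndet n (\<lambda>i j. (if i = j then 1 else 0) + (\<Sum>k<m. A i k * B k j)) =
         ndet m (\<lambda>i j. (if i = j then 1 else 0) + (\<Sum>k<n. B i k * A k j))"
proof -
  define a where "a = Matrix.mat n m (\<lambda>(i, j). A i j)"
  define b where "b = Matrix.mat m n (\<lambda>(i, j). B i j)"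
  have [simp]: "a \<in> carrier_mat n m" "b \<in> carrier_mat m n" by (auto simp: a_def b_def)
  have ab: "a * b \<in> carrier_mat n n" and ba: "b * a \<in> carrier_mat m m" by (auto simp: a_def b_def)
  define L where "L = four_block_mat (1\<^sub>m n) (0\<^sub>m n m) b (1\<^sub>m m)"
  define R where "R = four_block_mat (1\<^sub>m n) (- a) (0\<^sub>m m n) (1\<^sub>m m + b * a)"
  define R' where "R' = four_block_mat (1\<^sub>m n + a * b) (- a) (0\<^sub>m m n) (1\<^sub>m m)"
  have cL: "L \<in> carrier_mat (n + m) (n + m)" and cR: "R \<in> carrier_mat (n + m) (n + m)"
    and cR': "R' \<in> carrier_mat (n + m) (n + m)"
    unfolding L_def R_def R'_def using ab ba by (auto intro!: four_block_carrier_mat)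
  have na: "- a \<in> carrier_mat n m" and bc: "b \<in> carrier_mat m n" by (auto simp: a_def b_def)
  have e1: "L * R = four_block_mat (1\<^sub>m n) (- a) b (1\<^sub>m m)"
  proof -
    have "b * (- a) + (1\<^sub>m m + b * a) = 1\<^sub>m m"
      by (rule eq_matI) (auto simp: a_def b_def scalar_prod_def sum_negf)
    moreover have c1: "1\<^sub>m m + b * a \<in> carrier_mat m m" using ba by simp
    moreover have "1\<^sub>m n * (- a) + 0\<^sub>m n m * (1\<^sub>m m + b * a) = - a" 
      by (simp only: left_mult_one_mat[OF na] left_mult_zero_mat[OF c1] right_add_zero_mat[OF na])
    moreover have "1\<^sub>m m * (1\<^sub>m m + b * a) = 1\<^sub>m m + b * a" "b * 1\<^sub>m n + 1\<^sub>m m * 0\<^sub>m m n = b"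
      by (simp_all only: left_mult_one_mat[OF c1] right_mult_one_mat[OF bc] left_mult_zero_mat
        left_mult_one_mat[OF zero_carrier_mat] right_add_zero_mat[OF bc])
    ultimately show ?thesis
      unfolding L_def R_def
      using ba na by (subst mult_four_block_mat[of _ n n _ m _ m _ _ n _ m]) auto
  qed
  have e2: "R' * L = four_block_mat (1\<^sub>m n) (- a) b (1\<^sub>m m)"
  proof -
    have "(1\<^sub>m n + a * b) + (- a) * b = 1\<^sub>m n"
      by (rule eq_matI) (auto simp: a_def b_def scalar_prod_def sum_negf)
    moreover have "(1\<^sub>m n + a * b) * 0\<^sub>m n m + - a * 1\<^sub>m m = - a"
      by (rule eq_matI) (auto simp: a_def b_def)
    moreover have c2: "1\<^sub>m n + a * b \<in> carrier_mat n n" using ab by simp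
    moreover have "(1\<^sub>m n + a * b) * 1\<^sub>m n = 1\<^sub>m n + a * b" "0\<^sub>m m n + 1\<^sub>m m * b = b"
      by (simp_all only: right_mult_one_mat[OF c2] left_mult_one_mat[OF bc] left_add_zero_mat[OF bc])
    ultimately show ?thesis
      unfolding L_def R'_def
      using ab na by (subst mult_four_block_mat[of _ n n _ m _ m _ _ n _ m]) auto
  qed
  have dL: "Determinant.det L = 1"
    unfolding L_def by (subst det_four_block_mat_upper_right_zero[of _ n _ m]) auto
  have dR: "Determinant.det R = Determinant.det (1\<^sub>m m + b * a)"
    unfolding R_def using ba by (subst det_four_block_mat_lower_left_zero[of _ n _ m]) auto
  have dR': "Determinant.det R' = Determinant.det (1\<^sub>m n + a * b)"
    unfolding R'_def using ab by (subst det_four_block_mat_lower_left_zero[of _ n _ m]) auto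
  have "Determinant.det L * Determinant.det R = Determinant.det R' * Determinant.det L"
    using det_mult[OF cL cR] det_mult[OF cR' cL] e1 e2 by simp
  then have *: "Determinant.det (1\<^sub>m n + a * b) = Determinant.det (1\<^sub>m m + b * a)"
    by (simp add: dL dR dR')
  have 1: "Matrix.mat n n (\<lambda>(i, j). (if i = j then 1 else 0) + (\<Sum>k<m. A i k * B k j)) = 1\<^sub>m n + a * b"
    by (rule eq_matI) (auto simp: a_def b_def scalar_prod_def atLeast0LessThan)
  have 2: "Matrix.mat m m (\<lambda>(i, j). (if i = j then 1 else 0) + (\<Sum>k<n. B i k * A k j)) = 1\<^sub>m m + b * a"
    by (rule eq_matI) (auto simp: a_def b_def scalar_prod_def atLeast0LessThan)
  show ?thesis unfolding ndet_def 1 2 by (rule *)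
qed

lemma ndet_zero_kernel:
  fixes M :: "nat \<Rightarrow> nat \<Rightarrow> 'a::field"
  assumes "ndet n M = 0"
  obtains a where "\<exists>i<n. a i \<noteq> 0" "\<And>i. i < n \<Longrightarrow> (\<Sum>j<n. M i j * a j) = 0"
proof -
  let ?A = "Matrix.mat n n (\<lambda>(i, j). M i j)"
  obtain v where v: "v \<in> carrier_vec n" "v \<noteq> 0\<^sub>v n" "?A *\<^sub>v v = 0\<^sub>v n"
    using assms det_0_iff_vec_prod_zero_field[of ?A n] unfolding ndet_def by auto
  show thesis
  proof (rule that[of "\<lambda>i. vec_index v i"])
    show "\<exists>i<n. vec_index v i \<noteq> 0" using v(1,2) by (metis eq_vecI carrier_vecD index_zero_vec)
    fix i assume "i < n"
    then have "vec_index (?A *\<^sub>v v) i = 0" by (simp add: v(3))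
    then show "(\<Sum>j<n. M i j * vec_index v j) = 0"
      using \<open>i < n\<close> v(1) by (simp add: scalar_prod_def atLeast0LessThan)
  qed
qed

text \<open>The entries of the adjugate are minors up to sign; the sign stays anonymous because the
  minors only enter estimates of absolute values.\<close>

lemma ndet_adjugate:
  fixes M :: "nat \<Rightarrow> nat \<Rightarrow> 'a::comm_ring_1"
  obtains N where
    "\<And>i j. i < n \<Longrightarrow> j < n \<Longrightarrow> (\<Sum>k<n. M i k * N k j) = (if i = j then ndet n M else 0)"
    "\<And>i j. i < n \<Longrightarrow> j < n \<Longrightarrow> (\<Sum>k<n. N i k * M k j) = (if i = j then ndet n M else 0)"
    "\<And>i j. i < n \<Longrightarrow> j < n \<Longrightarrow> \<exists>s\<in>{1, -1}. 
       N i j = s * ndet (n - 1) (\<lambda>k l. M (if k < j then k else Suc k) (if l < i then l else Suc l))"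
proof -
  let ?A = "Matrix.mat n n (\<lambda>(i, j). M i j)"
  have c: "?A \<in> carrier_mat n n" by simp
  have d: "Determinant.det ?A = ndet n M" by (simp add: ndet_def)
  define N where "N i j = adj_mat ?A $$ (i, j)" for i j
  have cN: "adj_mat ?A \<in> carrier_mat n n" by (rule adj_mat(1)[OF c])
  have "(\<Sum>k<n. M i k * N k j) = (if i = j then ndet n M else 0)" if "i < n" "j < n" for i j
  proof -
    have "(?A * adj_mat ?A) $$ (i, j) = (\<Sum>k<n. M i k * N k j)"
      using that cN by (simp add: scalar_prod_def atLeast0LessThan N_def)
    then show ?thesis using that by (cases "i = j") (simp_all add: adj_mat(2)[OF c] d)
  qed
  moreover have "(\<Sum>k<n. N i k * M k j) = (if i = j then ndet n M else 0)" if "i < n" "j < n" for i j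
  proof -
    have "(adj_mat ?A * ?A) $$ (i, j) = (\<Sum>k<n. N i k * M k j)"
      using that cN by (simp add: scalar_prod_def atLeast0LessThan N_def)
    then show ?thesis using that by (cases "i = j") (simp_all add: adj_mat(3)[OF c] d)
  qed
  moreover have "\<exists>s\<in>{1, -1}. N i j = s * ndet (n - 1) (\<lambda>k l. M (if k < j then k else Suc k) (if l < i then l else Suc l))"
    if "i < n" "j < n" for i j
  proof -
    have "mat_delete ?A j i = Matrix.mat (n - 1) (n - 1) (\<lambda>(k, l). M (if k < j then k else Suc k) (if l < i then l else Suc l))"
      by (rule eq_matI) (use that in \<open>auto simp: mat_delete_def\<close>)
    then have "N i j = (-1) ^ (j + i) * ndet (n - 1) (\<lambda>k l. M (if k < j then k else Suc k) (if l < i then l else Suc l))"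
      using that by (simp add: N_def adj_mat_def cofactor_def ndet_def)
    then show ?thesis by (cases "even (j + i)") auto
  qed
  ultimately show thesis by (rule that)
qed

lemma ndet_solvable:
  fixes M :: "nat \<Rightarrow> nat \<Rightarrow> 'a::field"
  assumes "ndet n M \<noteq> 0"
  obtains a where "\<And>i. i < n \<Longrightarrow> (\<Sum>j<n. M i j * a j) = b i"
proof -
  obtain N where N: "\<And>i j. i < n \<Longrightarrow> j < n \<Longrightarrow> (\<Sum>k<n. M i k * N k j) = (if i = j then ndet n M else 0)"
    by (rule ndet_adjugate[of n M]) blast
  define a where "a j = (\<Sum>l<n. N j l * b l) / ndet n M" for j
  have "(\<Sum>j<n. M i j * a j) = b i" if "i < n" for i
  proof -
    have "(\<Sum>j<n. M i j * a j) = (\<Sum>j<n. \<Sum>l<n. M i j * N j l * b l) / ndet n M"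
      by (simp add: a_def sum_divide_distrib sum_distrib_left mult.assoc)
    also have "(\<Sum>j<n. \<Sum>l<n. M i j * N j l * b l) = (\<Sum>l<n. (\<Sum>j<n. M i j * N j l) * b l)"
      by (subst sum.swap) (simp add: sum_distrib_right)
    also have "\<dots> = (\<Sum>l<n. if i = l then ndet n M * b l else 0)"
      by (intro sum.cong) (auto simp: N that)
    finally show ?thesis using that assms by simp
  qed
  then show thesis by (rule that)
qed

lemma abs_ndet_le:
  fixes M :: "nat \<Rightarrow> nat \<Rightarrow> real"
  assumes "\<And>i j. i < n \<Longrightarrow> j < n \<Longrightarrow> \<bar>M i j\<bar> \<le> B"
  shows "\<bar>ndet n M\<bar> \<le> fact n * B ^ n"
proof -
  have sg: "\<bar>signof p :: real\<bar> = 1" for p :: "nat \<Rightarrow> nat" by (simp add: sign_def)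
  have "\<bar>ndet n M\<bar> \<le> (\<Sum>p | p permutes {0..<n}. \<bar>signof p * (\<Prod>i = 0..<n. M i (p i))\<bar>)"
    unfolding ndet_leibniz by (rule sum_abs)
  also have "\<dots> \<le> (\<Sum>p | p permutes {0..<n}. B ^ n)"
  proof (rule sum_mono)
    fix p assume "p \<in> {p. p permutes {0..<n}}"
    then have "\<bar>M i (p i)\<bar> \<le> B" if "i \<in> {0..<n}" for i
      using that permutes_in_image[of p "{0..<n}" i] by (auto intro!: assms)
    then have "(\<Prod>i = 0..<n. \<bar>M i (p i)\<bar>) \<le> (\<Prod>i = 0..<n. B)" by (intro prod_mono) auto
    then show "\<bar>signof p * (\<Prod>i = 0..<n. M i (p i))\<bar> \<le> B ^ n" by (simp add: abs_mult sg abs_prod)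
  qed
  also have "\<dots> = fact n * B ^ n" by (simp add: card_permutations)
  finally show ?thesis .
qed

text \<open>Cramer's rule without division: each unknown times the determinant is a combination of
  the right-hand side with \<open>n\<close> cofactors, each of size at most
  \<open>fact (n - 1) * B ^ (n - 1)\<close>. Undivided, the estimate stays useful for arrays whose
  determinant tends to zero.\<close>

lemma abs_ndet_solution_le:
  fixes M :: "nat \<Rightarrow> nat \<Rightarrow> real"
  assumes B: "\<And>i j. i < n \<Longrightarrow> j < n \<Longrightarrow> \<bar>M i j\<bar> \<le> B"
    and eq: "\<And>i. i < n \<Longrightarrow> (\<Sum>j<n. M i j * a j) = b i"
    and b: "\<And>i. i < n \<Longrightarrow> \<bar>b i\<bar> \<le> \<beta>"
    and j: "j < n"
  shows "\<bar>ndet n M\<bar> * \<bar>a j\<bar> \<le> n * (fact (n - 1) * B ^ (n - 1)) * \<beta>"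
proof -
  obtain N where N: "\<And>i j. i < n \<Longrightarrow> j < n \<Longrightarrow> (\<Sum>k<n. N i k * M k j) = (if i = j then ndet n M else 0)"
    and N': "\<And>i j. i < n \<Longrightarrow> j < n \<Longrightarrow> \<exists>s\<in>{1, -1}. 
       N i j = s * ndet (n - 1) (\<lambda>k l. M (if k < j then k else Suc k) (if l < i then l else Suc l))"
    by (rule ndet_adjugate[of n M]) blast
  have NB: "\<bar>N i k\<bar> \<le> fact (n - 1) * B ^ (n - 1)" if ik: "i < n" "k < n" for i k
  proof -
    obtain s where s: "s \<in> {1, -1}" 
      "N i k = s * ndet (n - 1) (\<lambda>k' l. M (if k' < k then k' else Suc k') (if l < i then l else Suc l))"
      using N'[OF ik] by blast
    have "\<bar>ndet (n - 1) (\<lambda>k' l. M (if k' < k then k' else Suc k') (if l < i then l else Suc l))\<bar>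
      \<le> fact (n - 1) * B ^ (n - 1)"
      by (rule abs_ndet_le) (use ik in \<open>auto intro!: B\<close>)
    then show ?thesis using s by (auto simp: abs_mult)
  qed
  have "ndet n M * a j = (\<Sum>l<n. (if j = l then ndet n M else 0) * a l)"
    using j by (simp add: if_distrib[of "\<lambda>x. x * _"] cong: if_cong)
  also have "\<dots> = (\<Sum>l<n. (\<Sum>k<n. N j k * M k l) * a l)"
    by (intro sum.cong) (auto simp: N j)
  also have "\<dots> = (\<Sum>k<n. \<Sum>l<n. N j k * M k l * a l)"
    by (subst sum.swap) (simp add: sum_distrib_right)
  also have "\<dots> = (\<Sum>k<n. N j k * b k)"
    by (intro sum.cong) (auto simp: eq[symmetric] sum_distrib_left mult.assoc)
  finally have "\<bar>ndet n M * a j\<bar> \<le> (\<Sum>k<n. \<bar>N j k * b k\<bar>)" by simp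
  also have "\<dots> \<le> (\<Sum>k<n. (fact (n - 1) * B ^ (n - 1)) * \<beta>)"
    unfolding abs_mult by (intro sum_mono mult_mono NB b j order_trans[OF _ NB]) (use j in auto)
  finally show ?thesis by (simp add: abs_mult)
qed

subsection \<open>The Hahn--Banach theorem and dual systems\<close>

definition sublinear :: "('a::real_vector \<Rightarrow> real) \<Rightarrow> bool" where
  "sublinear q \<longleftrightarrow> (\<forall>x y. q (x + y) \<le> q x + q y) \<and> (\<forall>a\<ge>0. \<forall>x. q (a *\<^sub>R x) = a * q x)"

lemma sublinear_zero: "sublinear q \<Longrightarrow> q 0 = 0"
  unfolding sublinear_def by (metis scaleR_zero_left mult_zero_left order_refl)

lemma sublinear_ge: "sublinear q \<Longrightarrow> - q (- x) \<le> q x"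
  using sublinear_zero[of q] unfolding sublinear_def by (metis add.right_inverse add.inverse_inverse neg_le_iff_le
      diff_le_eq le_diff_eq diff_0 minus_le_iff add.commute)

lemma sublinearI:
  assumes add: "\<And>x y. q (x + y) \<le> q x + q y" and zero: "q 0 = 0"
    and le: "\<And>a x. 0 < a \<Longrightarrow> q (a *\<^sub>R x) \<le> a * q x"
  shows "sublinear q"
proof -
  have "q (a *\<^sub>R x) = a * q x" if "0 \<le> a" for a x
  proof (cases "a = 0")
    case False
    then have a: "0 < a" using that by simp
    have "q (inverse a *\<^sub>R (a *\<^sub>R x)) \<le> inverse a * q (a *\<^sub>R x)" by (rule le) (use a in auto)
    then have "a * q x \<le> q (a *\<^sub>R x)" using a by (simp add: field_simps)
    then show ?thesis using le[OF a, of x] by simp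
  qed (simp add: zero)
  with add show ?thesis by (auto simp: sublinear_def)
qed

text \<open>The infimum of \<open>q (x + t *\<^sub>R z) - t * q z\<close> over nonnegative
  \<open>t\<close> is at least \<open>- q (- x)\<close> by subadditivity. The choice
  \<open>t = 0\<close> gives \<open>q' \<le> q\<close>, and \<open>t = 1\<close> makes
  \<open>q' (- z)\<close> at most \<open>- q z\<close>, so \<open>q\<close> is lowered unless it is
  already odd at \<open>z\<close>.\<close>

lemma sublinear_lower:
  assumes q: "sublinear q"
  obtains q' where "sublinear q'" "\<And>x. q' x \<le> q x" "q' (- z) \<le> - q z"
proof -
  have add: "q (x + y) \<le> q x + q y" and hom: "a \<ge> 0 \<Longrightarrow> q (a *\<^sub>R x) = a * q x" for a x y
    using q by (auto simp: sublinear_def)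
  define g where "g x t = q (x + t *\<^sub>R z) - t * q z" for x t
  have gb: "- q (- x) \<le> g x t" if "0 \<le> t" for x t
    using add[of "x + t *\<^sub>R z" "- x"] hom[OF that, of z] by (simp add: g_def)
  then have bdd: "bdd_below (g x ` {0..})" for x by (auto intro!: bdd_belowI)
  define q' where "q' x = (INF t\<in>{0..}. g x t)" for x
  have le: "q' x \<le> g x t" if "0 \<le> t" for x t
    unfolding q'_def by (rule cINF_lower[OF bdd]) (use that in auto)
  have greatest: "c \<le> q' x" if "\<And>t. 0 \<le> t \<Longrightarrow> c \<le> g x t" for c x
    unfolding q'_def by (rule cINF_greatest) (use that in auto)
  have add': "q' (x + y) \<le> q' x + q' y" for x y
  proof -
    have "q' (x + y) \<le> g x s + g y t" if "0 \<le> s" "0 \<le> t" for s t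
    proof -
      have "q' (x + y) \<le> g (x + y) (s + t)" by (rule le) (use that in auto)
      also have "\<dots> \<le> g x s + g y t"
        using add[of "x + s *\<^sub>R z" "y + t *\<^sub>R z"] by (simp add: g_def algebra_simps)
      finally show ?thesis .
    qed
    then have "q' (x + y) - g x s \<le> q' y" if "0 \<le> s" for s
      by (intro greatest) (use that in \<open>auto simp: algebra_simps\<close>)
    then have "q' (x + y) - q' y \<le> q' x" by (intro greatest) (auto simp: algebra_simps)
    then show ?thesis by simp
  qed
  have hom_le: "q' (a *\<^sub>R x) \<le> a * q' x" if "0 < a" for a x
  proof -
    have "q' (a *\<^sub>R x) / a \<le> q' x"
    proof (rule greatest)
      fix t :: real assume t: "0 \<le> t"
      have "q' (a *\<^sub>R x) \<le> g (a *\<^sub>R x) (a * t)" by (rule le) (use that t in auto)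
      also have "\<dots> = a * g x t"
        using hom[of a "x + t *\<^sub>R z"] that by (simp add: g_def algebra_simps)
      finally show "q' (a *\<^sub>R x) / a \<le> g x t" using that by (simp add: field_simps)
    qed
    then show ?thesis using that by (simp add: field_simps)
  qed
  have "g 0 t = 0" if "0 \<le> t" for t using hom[OF that, of z] by (simp add: g_def)
  then have "g 0 ` {0..} = {0}" by force
  then have "q' 0 = 0" unfolding q'_def by simp
  then have "sublinear q'" by (intro sublinearI add' hom_le)
  moreover have "q' x \<le> q x" for x using le[of 0 x] by (simp add: g_def)
  moreover have "q' (- z) \<le> - q z" using le[of 1 "- z"] sublinear_zero[OF q] by (simp add: g_def)
  ultimately show thesis by (rule that)
qed

text \<open>A minimal sublinear functional is linear, since \<open>sublinear_lower\<close> cannot decrease it.\<close>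

lemma hahn_banach_sublinear:
  fixes p :: "'a::real_vector \<Rightarrow> real"
  assumes p: "sublinear p"
  obtains f where "linear f" "\<And>x. f x \<le> p x" "f v = p v"
proof -
  \<comment> \<open>The search for a minimal functional starts below \<open>p'\<close> rather than
    \<open>p\<close>: a linear \<open>f\<close> below \<open>p'\<close> has
    \<open>f (- v) \<le> - p v\<close>, hence \<open>f v = p v\<close>.\<close>
  obtain p' where p': "sublinear p'" "\<And>x. p' x \<le> p x" "p' (- v) \<le> - p v"
    using sublinear_lower[OF p] by blast
  define A where "A = {q. sublinear q \<and> (\<forall>x. q x \<le> p' x)}"
  \<comment> \<open>The order is reversed so that the maximal element delivered by Zorn's lemma is a
    minimal functional.\<close>
  define P where "P = (\<lambda>a b :: 'a \<Rightarrow> real. b \<le> a)"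
  have "\<exists>m\<in>A. \<forall>a\<in>A. P m a \<longrightarrow> a = m"
  proof (rule predicate_Zorn)
    show "partial_order_on A (relation_of P A)"
      by (rule partial_order_on_relation_ofI) (auto simp: P_def)
    fix C assume C: "C \<in> Chains (relation_of P A)"
    show "\<exists>u\<in>A. \<forall>a\<in>C. P a u"
    proof (cases "C = {}")
      case True
      then show ?thesis using p' by (auto simp: A_def)
    next
      case False
      have CA: "C \<subseteq> A" and tot: "\<And>q r. q \<in> C \<Longrightarrow> r \<in> C \<Longrightarrow> q \<le> r \<or> r \<le> q"
        using C by (auto simp: Chains_def relation_of_def P_def)
      have bdd: "bdd_below ((\<lambda>q. q x) ` C)" for x
      proof (rule bdd_belowI2)
        fix q assume "q \<in> C"
        then have "sublinear q" "q (- x) \<le> p' (- x)" using CA by (auto simp: A_def)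
        then show "- p' (- x) \<le> q x" using sublinear_ge[of q x] by linarith
      qed
      define u where "u x = (INF q\<in>C. q x)" for x
      have le: "u x \<le> q x" if "q \<in> C" for q x
        unfolding u_def by (rule cINF_lower[OF bdd that])
      have greatest: "c \<le> u x" if "\<And>q. q \<in> C \<Longrightarrow> c \<le> q x" for c x
        unfolding u_def by (rule cINF_greatest[OF False that])
      have sub: "sublinear q" if "q \<in> C" for q using CA that by (auto simp: A_def)
      have add: "u (x + y) \<le> u x + u y" for x y
      proof -
        have *: "u (x + y) \<le> q x + r y" if qr: "q \<in> C" "r \<in> C" for q r
        proof -
          consider "q \<le> r" | "r \<le> q" using tot[OF qr] by auto
          then show ?thesis
          proof cases
            case 1
            have "u (x + y) \<le> q (x + y)" by (rule le[OF qr(1)])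
            also have "\<dots> \<le> q x + q y" using sub[OF qr(1)] by (auto simp: sublinear_def)
            also have "\<dots> \<le> q x + r y" using 1 by (auto simp: le_fun_def)
            finally show ?thesis .
          next
            case 2
            have "u (x + y) \<le> r (x + y)" by (rule le[OF qr(2)])
            also have "\<dots> \<le> r x + r y" using sub[OF qr(2)] by (auto simp: sublinear_def)
            also have "\<dots> \<le> q x + r y" using 2 by (auto simp: le_fun_def)
            finally show ?thesis .
          qed
        qed
        have "u (x + y) - q x \<le> u y" if "q \<in> C" for q
          by (intro greatest) (use *[OF that] in \<open>auto simp: algebra_simps\<close>)
        then have "u (x + y) - u y \<le> u x" by (intro greatest) (auto simp: algebra_simps)
        then show ?thesis by simp
      qed
      have hom_le: "u (a *\<^sub>R x) \<le> a * u x" if "0 < a" for a x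
      proof -
        have "u (a *\<^sub>R x) / a \<le> u x"
        proof (rule greatest)
          fix q assume q: "q \<in> C"
          have "u (a *\<^sub>R x) \<le> q (a *\<^sub>R x)" by (rule le[OF q])
          also have "\<dots> = a * q x" using sub[OF q] that by (auto simp: sublinear_def)
          finally show "u (a *\<^sub>R x) / a \<le> q x" using that by (simp add: field_simps)
        qed
        then show ?thesis using that by (simp add: field_simps)
      qed
      have "q 0 = 0" if "q \<in> C" for q using sublinear_zero[OF sub[OF that]] .
      then have "(\<lambda>q. q 0) ` C = {0}" using False by force
      then have "u 0 = 0" unfolding u_def by simp
      then have "sublinear u" by (intro sublinearI add hom_le)
      moreover have "u x \<le> p' x" for x
      proof -
        obtain q where "q \<in> C" using False by blast
        then show ?thesis using le[of q x] CA by (force simp: A_def intro: order_trans)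
      qed
      ultimately show ?thesis using le by (auto simp: A_def P_def le_fun_def)
    qed
  qed
  then obtain f where f: "sublinear f" "\<And>x. f x \<le> p' x" 
    and min: "\<And>q. sublinear q \<Longrightarrow> (\<And>x. q x \<le> f x) \<Longrightarrow> q = f"
    unfolding A_def P_def le_fun_def by (auto, meson order_trans)
  have neg: "f (- z) = - f z" for z
  proof -
    obtain q where q: "sublinear q" "\<And>x. q x \<le> f x" "q (- z) \<le> - f z"
      using sublinear_lower[OF f(1)] by blast
    then have "q = f" by (intro min)
    then show ?thesis using q(3) sublinear_ge[OF f(1), of "- z"] by simp
  qed
  have "linear f"
  proof
    fix x y
    have *: "f (a + b) \<le> f a + f b" for a b using f(1) by (auto simp: sublinear_def)
    show "f (x + y) = f x + f y"
      using *[of x y] *[of "- x" "- y"] neg[of "x + y"] neg[of x] neg[of y] by (simp add: algebra_simps)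
  next
    fix a :: real and x
    have *: "f (b *\<^sub>R y) = b * f y" if "0 \<le> b" for b y using f(1) that by (auto simp: sublinear_def)
    show "f (a *\<^sub>R x) = a *\<^sub>R f x"
    proof (cases "0 \<le> a")
      case False
      then show ?thesis using *[of "- a" x] neg[of "a *\<^sub>R x"] by simp
    qed (simp add: *)
  qed
  moreover have "f x \<le> p x" for x using f(2) p'(2) order_trans by blast
  moreover have "f v = p v"
  proof (rule antisym)
    show "f v \<le> p v" by fact
    have "f (- v) \<le> - p v" using f(2)[of "- v"] p'(3) by linarith
    then show "p v \<le> f v" using neg[of v] by simp
  qed
  ultimately show thesis by (rule that)
qed

lemma hahn_banach_seminorm:
  fixes p :: "'a::real_normed_vector \<Rightarrow> real"
  assumes p: "sublinear p" and le: "\<And>x. p x \<le> norm x"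
  obtains f :: "'a \<Rightarrow>\<^sub>L real" where "\<And>x. f x \<le> p x" "f v = p v" "norm f \<le> 1"
proof -
  obtain f where f: "linear f" "\<And>x. f x \<le> p x" "f v = p v"
    using hahn_banach_sublinear[OF p] by blast
  have b: "norm (f x) \<le> norm x * 1" for x
    using f(2)[of x] f(2)[of "- x"] le[of x] le[of "- x"] linear_neg[OF f(1), of x] by (simp add: abs_if)
  interpret linear f by (rule f(1))
  have bl: "bounded_linear f"
    by (rule bounded_linear_intro[where K = 1]) (use b in \<open>auto simp: add scale\<close>)
  show thesis
  proof (rule that[of "Blinfun f"])
    show "norm (Blinfun f) \<le> 1"
      by (rule norm_blinfun_bound) (use b in \<open>auto simp: bounded_linear_Blinfun_apply[OF bl]\<close>)
  qed (use f in \<open>auto simp: bounded_linear_Blinfun_apply[OF bl]\<close>)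
qed

lemma norming_functional:
  fixes v :: "'a::real_normed_vector"
  obtains f :: "'a \<Rightarrow>\<^sub>L real" where "f v = norm v" "norm f \<le> 1"
  by (rule hahn_banach_seminorm[of norm v]) (auto simp: sublinear_def norm_triangle_ineq)

lemma infdist_subspace_sublinear:
  fixes L :: "'a::real_normed_vector set"
  assumes L: "subspace L"
  shows "sublinear (\<lambda>x. infdist x L)"
proof -
  have ne: "L \<noteq> {}" using subspace_0[OF L] by auto
  have le: "infdist x L \<le> norm (x - l)" if "l \<in> L" for x l
    using infdist_le[OF that, of x] by (simp add: dist_norm)
  have greatest: "c \<le> infdist x L" if "\<And>l. l \<in> L \<Longrightarrow> c \<le> norm (x - l)" for c x
    using that ne by (auto simp: infdist_def dist_norm intro!: cINF_greatest)
  have add: "infdist (x + y) L \<le> infdist x L + infdist y L" for x y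
  proof -
    have *: "infdist (x + y) L \<le> norm (x - l) + norm (y - m)" if "l \<in> L" "m \<in> L" for l m
    proof -
      have "infdist (x + y) L \<le> norm ((x + y) - (l + m))"
        by (rule le) (use that L in \<open>auto intro: subspace_add\<close>)
      also have "\<dots> \<le> norm (x - l) + norm (y - m)"
        using norm_triangle_ineq[of "x - l" "y - m"] by (simp add: algebra_simps)
      finally show ?thesis .
    qed
    have "infdist (x + y) L - norm (x - l) \<le> infdist y L" if "l \<in> L" for l
      by (intro greatest) (use *[OF that] in \<open>auto simp: algebra_simps\<close>)
    then have "infdist (x + y) L - infdist y L \<le> infdist x L" by (intro greatest) (auto simp: algebra_simps)
    then show ?thesis by simp
  qed
  have hom_le: "infdist (a *\<^sub>R x) L \<le> a * infdist x L" if "0 < a" for a x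
  proof -
    have "infdist (a *\<^sub>R x) L / a \<le> infdist x L"
    proof (rule greatest)
      fix l assume l: "l \<in> L"
      have "infdist (a *\<^sub>R x) L \<le> norm (a *\<^sub>R x - a *\<^sub>R l)"
        by (rule le) (use l L in \<open>auto intro: subspace_scale\<close>)
      also have "\<dots> = a * norm (x - l)" using that by (simp flip: scaleR_diff_right)
      finally show "infdist (a *\<^sub>R x) L / a \<le> norm (x - l)" using that by (simp add: field_simps)
    qed
    then show ?thesis using that by (simp add: field_simps)
  qed
  show ?thesis by (rule sublinearI) (use add hom_le subspace_0[OF L] in auto)
qed

text \<open>A functional dominated by the distance to \<open>L\<close> vanishes on \<open>L\<close>,
  because that distance is zero at \<open>x\<close> and at \<open>- x\<close>; attaining the
  positive distance at \<open>v\<close> allows normalization.\<close>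

lemma separating_functional:
  fixes L :: "'a::real_normed_vector set"
  assumes L: "subspace L" "closed L" and v: "v \<notin> L"
  obtains f :: "'a \<Rightarrow>\<^sub>L real" where "f v = 1" "\<And>x. x \<in> L \<Longrightarrow> f x = 0"
proof -
  have 0: "0 \<in> L" using L(1) by (rule subspace_0)
  obtain f :: "'a \<Rightarrow>\<^sub>L real" where f: "\<And>x. f x \<le> infdist x L" "f v = infdist v L"
    by (rule hahn_banach_seminorm[OF infdist_subspace_sublinear[OF L(1)], of v])
      (use infdist_le[OF 0] in auto)
  have pos: "infdist v L > 0" 
    using in_closed_iff_infdist_zero[OF L(2)] 0 v infdist_nonneg[of v L] by fastforce
  show thesis
  proof (rule that[of "inverse (infdist v L) *\<^sub>R f"])
    show "(inverse (infdist v L) *\<^sub>R f) v = 1" using f(2) pos by (simp add: blinfun.scaleR_left)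
    fix x assume "x \<in> L"
    then have "f x \<le> 0" "f (- x) \<le> 0" using f(1)[of x] f(1)[of "- x"] subspace_neg[OF L(1)] by auto
    then show "(inverse (infdist v L) *\<^sub>R f) x = 0" by (simp add: blinfun.scaleR_left blinfun.minus_right)
  qed
qed

section \<open>Biorthogonal systems and bounded coordinates\<close>

definition dual_system :: "nat \<Rightarrow> (nat \<Rightarrow> 'a::real_normed_vector) \<Rightarrow> (nat \<Rightarrow> 'a \<Rightarrow>\<^sub>L real) \<Rightarrow> bool" where
  "dual_system n w h \<longleftrightarrow> (\<forall>i<n. \<forall>j<n. h i (w j) = (if i = j then 1 else 0))"

lemma dual_system_coord:
  assumes "dual_system n w h" "i < n"
  shows "h i (\<Sum>j<n. a j *\<^sub>R w j) = a i"
proof -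
  have "h i (\<Sum>j<n. a j *\<^sub>R w j) = (\<Sum>j<n. if i = j then a j else 0)"
    unfolding blinfun.sum_right
    by (intro sum.cong) (use assms in \<open>auto simp: dual_system_def blinfun.scaleR_right\<close>)
  then show ?thesis using assms(2) by simp
qed

lemma dual_system_expand:
  assumes d: "dual_system n w h" and x: "x \<in> span (w ` {..<n})"
  shows "x = (\<Sum>i<n. h i x *\<^sub>R w i)"
  using x
proof (induction rule: span_induct_alt)
  case base
  then show ?case by simp
next
  case (step c x y)
  then obtain j where j: "j < n" "x = w j" by auto
  have "(\<Sum>i<n. h i x *\<^sub>R w i) = (\<Sum>i<n. if i = j then w i else 0)"
    by (intro sum.cong) (use d j in \<open>auto simp: dual_system_def\<close>)
  then have "(\<Sum>i<n. h i x *\<^sub>R w i) = x" using j by simp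
  moreover have "(\<Sum>i<n. h i (c *\<^sub>R x + y) *\<^sub>R w i) = c *\<^sub>R (\<Sum>i<n. h i x *\<^sub>R w i) + (\<Sum>i<n. h i y *\<^sub>R w i)"
    by (simp add: blinfun.add_right blinfun.scaleR_right scaleR_add_left sum.distrib scaleR_sum_right)
  ultimately show ?case using step by metis
qed

lemma dual_system_span_iff:
  assumes "dual_system n w h"
  shows "x \<in> span (w ` {..<n}) \<longleftrightarrow> x = (\<Sum>i<n. h i x *\<^sub>R w i)"
proof
  assume "x = (\<Sum>i<n. h i x *\<^sub>R w i)"
  moreover have "(\<Sum>i<n. h i x *\<^sub>R w i) \<in> span (w ` {..<n})"
    by (intro span_sum span_scale span_base) auto
  ultimately show "x \<in> span (w ` {..<n})" by simp
qed (rule dual_system_expand[OF assms])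

lemma dual_system_closed_span:
  assumes "dual_system n w h"
  shows "closed (span (w ` {..<n}))"
proof -
  have "span (w ` {..<n}) = {x. x = (\<Sum>i<n. h i x *\<^sub>R w i)}"
    using dual_system_span_iff[OF assms] by auto
  moreover have "closed {x. x = (\<Sum>i<n. h i x *\<^sub>R w i)}"
    by (intro closed_Collect_eq continuous_intros)
  ultimately show ?thesis by simp
qed

text \<open>Gram-Schmidt with functionals: a vector outside the span is corrected by its coordinates
  so that the earlier functionals vanish on it, and Hahn-Banach supplies a new functional vanishing
  on the earlier vectors. Coordinates on finite-dimensional subspaces thereby become bounded
  functionals on the whole space.\<close>

lemma dual_system_exists:
  fixes S :: "'a::real_normed_vector set"
  assumes "finite S"
  obtains n w h where "dual_system n w h" "span (w ` {..<n}) = span S"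
proof -
  have "\<exists>n w h. dual_system n w h \<and> span (w ` {..<n}) = span S"
    using assms
  proof (induction S)
    case empty
    show ?case by (rule exI[of _ 0]) (auto simp: dual_system_def)
  next
    case (insert u S)
    then obtain n w h where d: "dual_system n w h" and sp: "span (w ` {..<n}) = span S" by blast
    show ?case
    proof (cases "u \<in> span S")
      case True
      then show ?thesis using d sp by (metis span_redundant)
    next
      case False
      define u' where "u' = u - (\<Sum>i<n. h i u *\<^sub>R w i)"
      have s: "(\<Sum>i<n. h i u *\<^sub>R w i) \<in> span (w ` {..<n})"
        by (intro span_sum span_scale span_base) auto
      have u'n: "u' \<notin> span (w ` {..<n})"
        using False s span_add[OF _ s, of u'] by (auto simp: u'_def sp)
      have hu': "h i u' = 0" if "i < n" for i
        using dual_system_coord[OF d that] by (simp add: u'_def blinfun.diff_right)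
      obtain f :: "'a \<Rightarrow>\<^sub>L real" where f: "f u' = 1" "\<And>x. x \<in> span (w ` {..<n}) \<Longrightarrow> f x = 0"
        using separating_functional[OF subspace_span dual_system_closed_span[OF d] u'n] by blast
      define w' where "w' = w(n := u')"
      define h' where "h' = h(n := f)"
      have im: "w' ` {..<Suc n} = insert u' (w ` {..<n})" by (auto simp: w'_def lessThan_Suc)
      have "dual_system (Suc n) w' h'"
        unfolding dual_system_def
      proof (intro allI impI)
        fix i j assume "i < Suc n" "j < Suc n"
        moreover have "f (w j) = 0" if "j < n" for j by (rule f(2)) (use that in \<open>auto intro: span_base\<close>)
        ultimately show "h' i (w' j) = (if i = j then 1 else 0)"
          using hu' f(1) d by (auto simp: w'_def h'_def less_Suc_eq dual_system_def)
      qed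
      moreover have "span (w' ` {..<Suc n}) = span (insert u S)"
      proof -
        have "span (insert u' (w ` {..<n})) = span (insert u (w ` {..<n}))"
        proof (rule span_eq[THEN iffD2], intro conjI subsetI)
          fix x assume "x \<in> insert u' (w ` {..<n})"
          moreover have "u' \<in> span (insert u (w ` {..<n}))"
            unfolding u'_def using s span_mono[of "w ` {..<n}" "insert u (w ` {..<n})"]
            by (intro span_diff) (auto intro: span_base)
          ultimately show "x \<in> span (insert u (w ` {..<n}))"
            by (auto intro: span_base)
        next
          fix x assume "x \<in> insert u (w ` {..<n})"
          moreover have "u = u' + (\<Sum>i<n. h i u *\<^sub>R w i)" by (simp add: u'_def)
          moreover have "\<dots> \<in> span (insert u' (w ` {..<n}))"
            using s span_mono[of "w ` {..<n}" "insert u' (w ` {..<n})"]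
            by (auto intro!: span_add intro: span_base)
          ultimately show "x \<in> span (insert u' (w ` {..<n}))"
            by (auto intro: span_base)
        qed
        also have "\<dots> = span (insert u S)" using sp by (simp add: span_insert)
        finally show ?thesis by (simp add: im)
      qed
      ultimately show ?thesis by blast
    qed
  qed
  then show thesis using that by blast
qed

lemma dual_system_dim:
  assumes d: "dual_system n w h"
  shows "dim (span (w ` {..<n})) = n"
proof -
  have inj: "inj_on w {..<n}"
  proof (rule inj_onI)
    fix i j assume ij: "i \<in> {..<n}" "j \<in> {..<n}" "w i = w j"
    then have "h i (w i) = h i (w j)" by simp
    then show "i = j" using d ij(1,2) by (auto simp: dual_system_def split: if_splits)
  qed
  have "independent (w ` {..<n})"
  proof (rule independent_if_scalars_zero)
    fix f x assume s: "(\<Sum>x\<in>w ` {..<n}. f x *\<^sub>R x) = 0" and x: "x \<in> w ` {..<n}"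
    then obtain i where i: "i < n" "x = w i" by auto
    have "(\<Sum>j<n. f (w j) *\<^sub>R w j) = 0" using s inj by (simp add: sum.reindex)
    then have "h i (\<Sum>j<n. f (w j) *\<^sub>R w j) = 0" by simp
    then show "f x = 0" using dual_system_coord[OF d i(1)] i by simp
  qed simp
  then show ?thesis by (simp add: dim_eq_card_independent card_image[OF inj] dim_span)
qed

subsection \<open>Operators of finite rank\<close>

definition rank1 :: "('a::real_normed_vector \<Rightarrow>\<^sub>L real) \<Rightarrow> 'b::real_normed_vector \<Rightarrow> ('a \<Rightarrow>\<^sub>L 'b)" where
  "rank1 f v = blinfun_scaleR_left v o\<^sub>L f"

lemma rank1_apply [simp]: "blinfun_apply (rank1 f v) x = f x *\<^sub>R v"
  by (simp add: rank1_def)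

lemma blinfun_sum_apply: "blinfun_apply (sum F I) x = (\<Sum>i\<in>I. F i x)"
  by (rule blinfun.sum_left)

definition finite_rank :: "('a::real_normed_vector \<Rightarrow>\<^sub>L 'b::real_normed_vector) \<Rightarrow> bool" where
  "finite_rank F \<longleftrightarrow> (\<exists>S. finite S \<and> range (blinfun_apply F) \<subseteq> span S)"

lemma finite_rank_representation:
  assumes "finite_rank F"
  obtains n :: nat and f v where "F = (\<Sum>i<n. rank1 (f i) (v i))"
proof -
  obtain S where S: "finite S" "range (blinfun_apply F) \<subseteq> span S"
    using assms by (auto simp: finite_rank_def)
  obtain n w h where d: "dual_system n w h" "span (w ` {..<n}) = span S"
    using dual_system_exists[OF S(1)] by blast
  have "F = (\<Sum>i<n. rank1 (h i o\<^sub>L F) (w i))"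
  proof (rule blinfun_eqI)
    fix x
    have "F x \<in> span (w ` {..<n})" using S(2) d(2) by auto
    then show "F x = (\<Sum>i<n. rank1 (h i o\<^sub>L F) (w i)) x"
      using dual_system_expand[OF d(1)] by (simp add: blinfun_sum_apply)
  qed
  then show thesis by (rule that)
qed

lemma finite_rank_sum_rank1: "finite_rank (\<Sum>i<(n::nat). rank1 (f i) (v i))"
  unfolding finite_rank_def
  by (rule exI[of _ "v ` {..<n}"])
    (auto simp: blinfun_sum_apply intro!: span_sum span_scale intro: span_base)

lemma finite_rank_zero [simp]: "finite_rank 0"
  unfolding finite_rank_def by (rule exI[of _ "{}"]) auto

lemma finite_rank_add: "finite_rank F \<Longrightarrow> finite_rank G \<Longrightarrow> finite_rank (F + G)"
proof -
  assume "finite_rank F" "finite_rank G"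
  then obtain S T where "finite S" "range (blinfun_apply F) \<subseteq> span S" "finite T" "range (blinfun_apply G) \<subseteq> span T"
    by (auto simp: finite_rank_def)
  then have "range (blinfun_apply (F + G)) \<subseteq> span (S \<union> T)"
    using span_mono[of S "S \<union> T"] span_mono[of T "S \<union> T"] by (auto simp: blinfun.add_left intro!: span_add)
  then show ?thesis unfolding finite_rank_def using \<open>finite S\<close> \<open>finite T\<close> by blast
qed

lemma finite_rank_scaleR: "finite_rank F \<Longrightarrow> finite_rank (c *\<^sub>R F)"
  unfolding finite_rank_def by (fastforce simp: blinfun.scaleR_left intro: span_scale)

lemma finite_rank_uminus: "finite_rank F \<Longrightarrow> finite_rank (- F)"
  using finite_rank_scaleR[of F "-1"] by simp

lemma finite_rank_diff: "finite_rank F \<Longrightarrow> finite_rank G \<Longrightarrow> finite_rank (F - G)"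
  using finite_rank_add[of F "- G"] finite_rank_uminus[of G] by simp

lemma finite_rank_compose_right: "finite_rank F \<Longrightarrow> finite_rank (F o\<^sub>L A)"
  unfolding finite_rank_def by auto

lemma finite_rank_compose_left: "finite_rank F \<Longrightarrow> finite_rank (A o\<^sub>L F)"
proof -
  assume "finite_rank F"
  then obtain S where S: "finite S" "range (blinfun_apply F) \<subseteq> span S" by (auto simp: finite_rank_def)
  have "A (F x) \<in> span (blinfun_apply A ` S)" for x
    using S(2) linear_span_image[of "blinfun_apply A" S] blinfun.bounded_linear_right[THEN bounded_linear.linear]
    by blast
  then show ?thesis unfolding finite_rank_def using S(1) by (intro exI[of _ "blinfun_apply A ` S"]) auto
qed

lemma finite_rank_rank1 [simp]: "finite_rank (rank1 f v)"
  using finite_rank_sum_rank1[of "\<lambda>_. f" "\<lambda>_. v" 1] by (simp add: lessThan_Suc)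

subsection \<open>The general linear group\<close>

lemma GL_comp: "A \<in> GL \<Longrightarrow> B \<in> GL \<Longrightarrow> A o\<^sub>L B \<in> GL"
proof -
  assume "A \<in> GL" "B \<in> GL"
  then obtain A' B' where A: "A o\<^sub>L A' = id_blinfun" "A' o\<^sub>L A = id_blinfun"
    and B: "B o\<^sub>L B' = id_blinfun" "B' o\<^sub>L B = id_blinfun"
    by (auto simp: GL_def)
  have "A (A' x) = x" "A' (A x) = x" "B (B' x) = x" "B' (B x) = x" for x
    using A B by (metis blinfun_apply_blinfun_compose id_blinfun.rep_eq id_apply)+
  then have "(A o\<^sub>L B) o\<^sub>L (B' o\<^sub>L A') = id_blinfun" "(B' o\<^sub>L A') o\<^sub>L (A o\<^sub>L B) = id_blinfun"
    by (auto intro!: blinfun_eqI)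
  then show ?thesis by (auto simp: GL_def)
qed

definition binv :: "('a::real_normed_vector \<Rightarrow>\<^sub>L 'a) \<Rightarrow> ('a \<Rightarrow>\<^sub>L 'a)" where
  "binv T = (SOME S. T o\<^sub>L S = id_blinfun \<and> S o\<^sub>L T = id_blinfun)"

lemma binv_compose:
  assumes "T \<in> GL"
  shows "T o\<^sub>L binv T = id_blinfun" "binv T o\<^sub>L T = id_blinfun"
  using someI_ex[of "\<lambda>S. T o\<^sub>L S = id_blinfun \<and> S o\<^sub>L T = id_blinfun"] assms
  by (auto simp: GL_def binv_def)

lemma binv_apply [simp]:
  assumes "T \<in> GL"
  shows "T (binv T x) = x" "binv T (T x) = x"
  using binv_compose[OF assms] by (metis blinfun_apply_blinfun_compose id_blinfun.rep_eq id_apply)+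

lemma binv_GL: "T \<in> GL \<Longrightarrow> binv T \<in> GL"
  using binv_compose[of T] by (auto simp: GL_def)

lemma GL_id [simp]: "id_blinfun \<in> GL"
  by (auto simp: GL_def intro!: exI[of _ id_blinfun] blinfun_eqI)

lemma GL_scaleR:
  assumes "A \<in> GL" "c \<noteq> 0"
  shows "c *\<^sub>R A \<in> GL"
proof -
  have "(c *\<^sub>R A) o\<^sub>L (inverse c *\<^sub>R binv A) = id_blinfun" "(inverse c *\<^sub>R binv A) o\<^sub>L (c *\<^sub>R A) = id_blinfun"
    using assms by (auto intro!: blinfun_eqI simp: blinfun.scaleR_left blinfun.scaleR_right)
  then show ?thesis by (auto simp: GL_def)
qed

lemma GL_uminus: "A \<in> GL \<Longrightarrow> - A \<in> GL"
  using GL_scaleR[of A "-1"] by simp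

lemma GL_uminus_iff [simp]: "- A \<in> GL \<longleftrightarrow> A \<in> GL"
  using GL_uminus[of A] GL_uminus[of "- A"] by auto

lemma GL_injective: "A \<in> GL \<Longrightarrow> A x = 0 \<Longrightarrow> x = 0"
  using binv_apply(2)[of A x] by simp

definition lower_bound_on :: "'a::real_normed_vector set \<Rightarrow> real \<Rightarrow> ('a \<Rightarrow>\<^sub>L 'a) \<Rightarrow> bool" where
  "lower_bound_on L c A \<longleftrightarrow> 0 < c \<and> (\<forall>x\<in>L. c * norm x \<le> norm (A x))"

lemma GL_lower_bound:
  fixes A :: "'a::real_normed_vector \<Rightarrow>\<^sub>L 'a"
  assumes "A \<in> GL"
  obtains c where "lower_bound_on UNIV c A"
proof -
  define c where "c = inverse (norm (binv A) + 1)"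
  have p: "norm (binv A) + 1 > 0" using norm_ge_zero[of "binv A"] by linarith
  have "norm x \<le> (norm (binv A) + 1) * norm (A x)" for x
    using norm_blinfun[of "binv A" "A x"] assms by (simp add: algebra_simps add_increasing)
  then have "lower_bound_on UNIV c A"
    using p by (auto simp: lower_bound_on_def c_def field_simps)
  then show thesis by (rule that)
qed

lemma GL_bijI:
  fixes A :: "'a::real_normed_vector \<Rightarrow>\<^sub>L 'a"
  assumes c: "lower_bound_on UNIV c A" and surj: "\<And>y. \<exists>x. A x = y"
  shows "A \<in> GL"
proof -
  have c: "0 < c" "c * norm x \<le> norm (A x)" for x using c by (auto simp: lower_bound_on_def)
  define S where "S y = (SOME x. A x = y)" for y
  have AS: "A (S y) = y" for y unfolding S_def by (rule someI_ex[OF surj])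
  have inj: "x = x'" if "A x = A x'" for x x'
    using c(2)[of "x - x'"] c(1) that by (simp add: blinfun.diff_right mult_le_0_iff)
  have "bounded_linear S"
  proof (rule bounded_linear_intro)
    show "S (x + y) = S x + S y" for x y by (rule inj) (simp add: AS blinfun.add_right)
    show "S (r *\<^sub>R x) = r *\<^sub>R S x" for r x by (rule inj) (simp add: AS blinfun.scaleR_right)
    show "norm (S x) \<le> norm x * inverse c" for x using c(2)[of "S x"] c(1) by (simp add: AS field_simps)
  qed
  then have S: "blinfun_apply (Blinfun S) = S" by (rule bounded_linear_Blinfun_apply)
  have "A o\<^sub>L Blinfun S = id_blinfun" by (rule blinfun_eqI) (simp add: S AS)
  moreover have "Blinfun S o\<^sub>L A = id_blinfun" by (rule blinfun_eqI) (simp add: S, rule inj, simp add: AS)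
  ultimately show ?thesis by (auto simp: GL_def)
qed

lemma lower_bound_on_perturb:
  assumes "lower_bound_on L c A" "norm D \<le> d" "d < c"
  shows "lower_bound_on L (c - d) (A + D)"
proof -
  have "(c - d) * norm x \<le> norm ((A + D) x)" if "x \<in> L" for x
  proof -
    have "c * norm x \<le> norm (A x)" using assms(1) that by (auto simp: lower_bound_on_def)
    also have "\<dots> \<le> norm ((A + D) x) + norm (D x)"
      using norm_triangle_ineq4[of "(A + D) x" "D x"] by (simp add: blinfun.add_left)
    also have "norm (D x) \<le> d * norm x"
      using norm_blinfun[of D x] mult_right_mono[OF assms(2) norm_ge_zero[of x]] by linarith
    finally show ?thesis by (simp add: algebra_simps)
  qed
  then show ?thesis using assms(3) by (auto simp: lower_bound_on_def)
qed

text \<open>The equation \<open>V x + D x = y\<close> is a fixed-point equation for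
  \<open>x \<mapsto> binv V (y - D x)\<close>, a contraction with constant
  \<open>norm D / c\<close>.\<close>

lemma GL_perturb:
  fixes V :: "'a::banach \<Rightarrow>\<^sub>L 'a"
  assumes V: "V \<in> GL" and c: "lower_bound_on UNIV c V" and D: "norm D < c"
  shows "V + D \<in> GL"
proof (rule GL_bijI)
  show "lower_bound_on UNIV (c - norm D) (V + D)"
    by (rule lower_bound_on_perturb[OF c order_refl D])
  fix y
  have c0: "0 < c" and cV: "\<And>x. c * norm x \<le> norm (V x)" using c by (auto simp: lower_bound_on_def)
  have W: "norm (binv V z) \<le> norm z / c" for z
    using cV[of "binv V z"] V c0 by (simp add: field_simps)
  have "\<exists>!x. binv V (y - D x) = x"
  proof (rule banach_fix_type[of "norm D / c"])
    show "\<forall>x x'. dist (binv V (y - D x)) (binv V (y - D x')) \<le> norm D / c * dist x x'"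
    proof (intro allI)
      fix x x'
      have "norm (binv V (D (x' - x))) \<le> norm (D (x' - x)) / c" by (rule W)
      also have "\<dots> \<le> norm D * norm (x' - x) / c"
        using norm_blinfun[of D "x' - x"] c0 by (intro divide_right_mono) auto
      finally show "dist (binv V (y - D x)) (binv V (y - D x')) \<le> norm D / c * dist x x'"
        by (simp add: dist_norm norm_minus_commute flip: blinfun.diff_right)
    qed
  qed (use c0 D in auto)
  then obtain x where "binv V (y - D x) = x" by auto
  then have "V x = y - D x" using V by (metis binv_apply(1))
  then show "\<exists>x. (V + D) x = y" by (auto simp: blinfun.add_left intro!: exI[of _ x])
qed

lemma GL_near:
  fixes V :: "'a::banach \<Rightarrow>\<^sub>L 'a"
  assumes "V \<in> GL"
  obtains r where "0 < r" "\<And>A. norm (A - V) < r \<Longrightarrow> A \<in> GL" "\<And>A. norm (A - V) < r \<Longrightarrow> norm (binv A) \<le> inverse r"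
proof -
  obtain c where c: "lower_bound_on UNIV c V" using GL_lower_bound[OF assms] .
  then have c0: "0 < c" by (auto simp: lower_bound_on_def)
  show thesis
  proof (rule that[of "c / 2"])
    show "0 < c / 2" using c0 by simp
    fix A assume A: "norm (A - V) < c / 2"
    then show G: "A \<in> GL" using GL_perturb[OF assms c, of "A - V"] c0 by simp
    have "lower_bound_on UNIV (c - c / 2) (V + (A - V))"
      by (rule lower_bound_on_perturb[OF c]) (use A c0 in auto)
    then have "c / 2 * norm x \<le> norm (A x)" for x by (simp add: lower_bound_on_def)
    from this[of "binv A _"] show "norm (binv A) \<le> inverse (c / 2)"
      using G c0 by (intro norm_blinfun_bound) (auto simp: field_simps)
  qed
qed

lemma open_GL: "open (GL :: ('a::banach \<Rightarrow>\<^sub>L 'a) set)"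
  unfolding open_dist by (metis GL_near dist_norm)

lemma continuous_on_binv: "continuous_on (GL :: ('a::banach \<Rightarrow>\<^sub>L 'a) set) binv"
proof (rule continuous_onI)
  fix V :: "'a \<Rightarrow>\<^sub>L 'a" and e :: real assume V: "V \<in> GL" and e: "0 < e"
  obtain r where r: "0 < r" "\<And>A. norm (A - V) < r \<Longrightarrow> A \<in> GL" "\<And>A. norm (A - V) < r \<Longrightarrow> norm (binv A) \<le> inverse r"
    using GL_near[OF V] by blast
  \<comment> \<open>The two factors \<open>r\<close> absorb the bounds \<open>inverse r\<close> of
    \<open>binv A\<close> and \<open>binv V\<close> in the identity for their difference.\<close>
  define d where "d = min r (e * r * r / 2)"
  have "dist (binv A) (binv V) \<le> e" if A: "A \<in> GL" "dist A V < d" for A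
  proof -
    have n: "norm (A - V) < r" "norm (A - V) \<le> e * r * r"
      using A(2) e r(1) norm_ge_zero[of "A - V"] by (auto simp: d_def dist_norm simp del: norm_ge_zero)
    have "binv A - binv V = binv A o\<^sub>L (V - A) o\<^sub>L binv V"
      by (rule blinfun_eqI) (simp add: blinfun.diff_left blinfun.diff_right A(1) V)
    then have "norm (binv A - binv V) \<le> norm (binv A o\<^sub>L (V - A)) * norm (binv V)"
      by (simp add: norm_blinfun_compose)
    also have "\<dots> \<le> (norm (binv A) * norm (V - A)) * norm (binv V)"
      by (intro mult_right_mono norm_blinfun_compose) simp
    also have "\<dots> \<le> (inverse r * (e * r * r)) * inverse r"
      using n r e V A(1) by (intro mult_mono) (auto simp: norm_minus_commute)
    also have "\<dots> = e" using r(1) by (simp add: field_simps)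
    finally show ?thesis by (simp add: dist_norm)
  qed
  moreover have "d > 0" using r(1) e by (simp add: d_def)
  ultimately show "\<exists>d>0. \<forall>A\<in>GL. dist A V < d \<longrightarrow> dist (binv A) (binv V) \<le> e" by blast
qed

abbreviation shift :: "('a::real_normed_vector \<Rightarrow>\<^sub>L 'a) \<Rightarrow> real \<Rightarrow> ('a \<Rightarrow>\<^sub>L 'a)" (infixl "-\<^sub>I" 65)
  where "T -\<^sub>I t \<equiv> T - t *\<^sub>R id_blinfun"

lemma GL_shift:
  fixes T :: "'a::banach \<Rightarrow>\<^sub>L 'a"
  assumes "norm T < \<bar>t\<bar>"
  shows "T -\<^sub>I t \<in> GL"
proof -
  have "- t *\<^sub>R id_blinfun + T \<in> GL"
    by (rule GL_perturb[of _ "\<bar>t\<bar>"]) (use assms norm_ge_zero[of T] in \<open>auto intro!: GL_scaleR simp: lower_bound_on_def blinfun.scaleR_left blinfun.minus_left\<close>)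
  then show ?thesis by simp
qed

subsection \<open>The determinant of a finite-rank perturbation of the identity\<close>

text \<open>The determinant of the identity plus the sum of the \<open>rank1 (f i) (v i)\<close>,
  read off in the possibly dependent family \<open>v\<close>. Only the pairings
  \<open>f i (v j)\<close> enter, so it varies continuously with the functionals while
  \<open>n\<close> is fixed.\<close>

definition rep_det :: "nat \<Rightarrow> (nat \<Rightarrow> 'a::real_normed_vector \<Rightarrow>\<^sub>L real) \<Rightarrow> (nat \<Rightarrow> 'a) \<Rightarrow> real" where
  "rep_det n f v = ndet n (\<lambda>i j. (if i = j then 1 else 0) + f i (v j))"

text \<open>Expanding each \<open>v j\<close> in the dual system factors the array of pairings, and
  Sylvester's identity turns its determinant into one that depends on the operator and the dual
  system alone.\<close>

lemma rep_det_dual: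
  assumes d: "dual_system m w h" and v: "\<And>i. i < n \<Longrightarrow> v i \<in> span (w ` {..<m})"
  shows "rep_det n f v = ndet m (\<lambda>k l. (if k = l then 1 else 0) + h k (blinfun_apply (\<Sum>i<(n::nat). rank1 (f i) (v i)) (w l)))"
proof -
  have "f i (v j) = (\<Sum>k<m. f i (w k) * h k (v j))" if "j < n" for i j
    by (subst dual_system_expand[OF d v[OF that]])
      (simp add: blinfun.sum_right blinfun.scaleR_right mult.commute)
  then have "rep_det n f v = ndet n (\<lambda>i j. (if i = j then 1 else 0) + (\<Sum>k<m. f i (w k) * h k (v j)))"
    unfolding rep_det_def by (intro ndet_cong) auto
  also have "\<dots> = ndet m (\<lambda>k l. (if k = l then 1 else 0) + (\<Sum>i<n. h k (v i) * f i (w l)))"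
    by (rule ndet_sylvester)
  also have "\<dots> = ndet m (\<lambda>k l. (if k = l then 1 else 0) + h k (blinfun_apply (\<Sum>i<(n::nat). rank1 (f i) (v i)) (w l)))"
    by (intro ndet_cong) (simp add: blinfun_sum_apply blinfun.sum_right blinfun.scaleR_right mult.commute)
  finally show ?thesis .
qed

lemma rep_det_unique:
  assumes "(\<Sum>i<(n::nat). rank1 (f i) (v i)) = (\<Sum>i<(n'::nat). rank1 (f' i) (v' i))"
  shows "rep_det n f v = rep_det n' f' v'"
proof -
  obtain m w h where d: "dual_system m w h" "span (w ` {..<m}) = span (v ` {..<n} \<union> v' ` {..<n'})"
    using dual_system_exists[of "v ` {..<n} \<union> v' ` {..<n'}"] by auto
  have "rep_det n f v = ndet m (\<lambda>k l. (if k = l then 1 else 0) + h k (blinfun_apply (\<Sum>i<(n::nat). rank1 (f i) (v i)) (w l)))"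
    by (rule rep_det_dual[OF d(1)]) (auto simp: d(2) intro: span_base)
  moreover have "rep_det n' f' v' = ndet m (\<lambda>k l. (if k = l then 1 else 0) + h k (blinfun_apply (\<Sum>i<(n'::nat). rank1 (f' i) (v' i)) (w l)))"
    by (rule rep_det_dual[OF d(1)]) (auto simp: d(2) intro: span_base)
  ultimately show ?thesis using assms by simp
qed

text \<open>Junk value unless \<open>A - id_blinfun\<close> has finite rank.\<close>

definition opdet :: "('a::real_normed_vector \<Rightarrow>\<^sub>L 'a) \<Rightarrow> real" where
  "opdet A = (SOME d. \<exists>n f v. A = id_blinfun + (\<Sum>i<(n::nat). rank1 (f i) (v i)) \<and> d = rep_det n f v)"

lemma opdet_eq:
  assumes "A = id_blinfun + (\<Sum>i<(n::nat). rank1 (f i) (v i))"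
  shows "opdet A = rep_det n f v"
proof -
  have "\<exists>d n f v. A = id_blinfun + (\<Sum>i<(n::nat). rank1 (f i) (v i)) \<and> d = rep_det n f v"
    using assms by blast
  then have "\<exists>n' f' v'. A = id_blinfun + (\<Sum>i<(n'::nat). rank1 (f' i) (v' i)) \<and> opdet A = rep_det n' f' v'"
    unfolding opdet_def by (rule someI_ex)
  then obtain n' f' v' where *: "A = id_blinfun + (\<Sum>i<(n'::nat). rank1 (f' i) (v' i))" "opdet A = rep_det n' f' v'" 
    by blast
  have "(\<Sum>i<(n'::nat). rank1 (f' i) (v' i)) = (\<Sum>i<(n::nat). rank1 (f i) (v i))" using *(1) assms by simp
  then show ?thesis using *(2) rep_det_unique by metis
qed

lemma opdet_dual:
  fixes A :: "'a::real_normed_vector \<Rightarrow>\<^sub>L 'a"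
  assumes d: "dual_system m w h" and r: "\<And>x. A x - x \<in> span (w ` {..<m})"
  shows "opdet A = ndet m (\<lambda>k l. h k (A (w l)))"
proof -
  have "A = id_blinfun + (\<Sum>i<m. rank1 (h i o\<^sub>L (A - id_blinfun)) (w i))"
  proof (rule blinfun_eqI)
    fix x
    show "A x = (id_blinfun + (\<Sum>i<m. rank1 (h i o\<^sub>L (A - id_blinfun)) (w i))) x"
      using dual_system_expand[OF d r[of x]] by (simp add: blinfun.add_left blinfun_sum_apply blinfun.diff_left)
  qed
  then have "opdet A = rep_det m (\<lambda>i. h i o\<^sub>L (A - id_blinfun)) w" by (rule opdet_eq)
  also have "\<dots> = ndet m (\<lambda>k l. h k (A (w l)))"
    unfolding rep_det_def
    by (intro ndet_cong) (use d in \<open>auto simp: blinfun.diff_left blinfun.diff_right dual_system_def\<close>)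
  finally show ?thesis .
qed

text \<open>One dual system, whose span contains the ranges of \<open>A - id_blinfun\<close> and
  \<open>B - id_blinfun\<close>, serves for all three operators. \<open>B\<close> maps that span
  into itself, so the array of the composition is the product of the arrays.\<close>

lemma opdet_compose:
  assumes A: "finite_rank (A - id_blinfun)" and B: "finite_rank (B - id_blinfun)"
  shows "opdet (A o\<^sub>L B) = opdet A * opdet B"
proof -
  obtain S T where S: "finite S" "range (blinfun_apply (A - id_blinfun)) \<subseteq> span S"
    and T: "finite T" "range (blinfun_apply (B - id_blinfun)) \<subseteq> span T"
    using A B by (auto simp: finite_rank_def)
  obtain m w h where d: "dual_system m w h" "span (w ` {..<m}) = span (S \<union> T)"
    using dual_system_exists[of "S \<union> T"] S T by auto
  have rA: "A x - x \<in> span (w ` {..<m})" for x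
    using S(2) span_mono[of S "S \<union> T"] by (force simp: d(2) blinfun.diff_left dest!: range_subsetD[of _ _ x])
  have rB: "B x - x \<in> span (w ` {..<m})" for x
    using T(2) span_mono[of T "S \<union> T"] by (force simp: d(2) blinfun.diff_left dest!: range_subsetD[of _ _ x])
  have rAB: "(A o\<^sub>L B) x - x \<in> span (w ` {..<m})" for x
    using span_add[OF rA[of "B x"] rB[of x]] by simp
  have Bw: "B (w l) \<in> span (w ` {..<m})" if "l < m" for l
    using span_add[OF rB[of "w l"] span_base[of "w l"]] that by auto
  have "h k ((A o\<^sub>L B) (w l)) = (\<Sum>j<m. h k (A (w j)) * h j (B (w l)))" if "l < m" for k l
    unfolding blinfun_apply_blinfun_compose
    by (subst dual_system_expand[OF d(1) Bw[OF that]])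
      (simp add: blinfun.sum_right blinfun.scaleR_right mult.commute)
  then have "opdet (A o\<^sub>L B) = ndet m (\<lambda>k l. \<Sum>j<m. h k (A (w j)) * h j (B (w l)))"
    unfolding opdet_dual[OF d(1) rAB] by (intro ndet_cong) auto
  also have "\<dots> = opdet A * opdet B"
    unfolding opdet_dual[OF d(1) rA] opdet_dual[OF d(1) rB] by (rule ndet_mult)
  finally show ?thesis .
qed

lemma opdet_id [simp]: "opdet (id_blinfun :: 'a::real_normed_vector \<Rightarrow>\<^sub>L 'a) = 1"
proof -
  have "opdet (id_blinfun :: 'a \<Rightarrow>\<^sub>L 'a) = rep_det 0 (\<lambda>_. 0) (\<lambda>_. 0 :: 'a)" by (rule opdet_eq) simp
  also have "\<dots> = 1" using ndet_scalar[of 0 1] by (simp add: rep_det_def ndet_def)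
  finally show ?thesis .
qed

text \<open>The numbers \<open>f j x\<close> solve the linear system with the array of
  \<open>rep_det\<close> and right-hand side \<open>f i (A x)\<close>; Cramer's rule then controls
  them by \<open>A x\<close>.\<close>

lemma rep_det_coords:
  fixes A :: "'a::real_normed_vector \<Rightarrow>\<^sub>L 'a" and n :: nat
  assumes A: "A = id_blinfun + (\<Sum>i<(n::nat). rank1 (f i) (v i))" and i: "i < n"
  shows "(\<Sum>j<n. ((if i = j then 1 else 0) + f i (v j)) * f j x) = f i (A x)"
proof -
  have "f i (A x) = f i x + (\<Sum>j<n. f j x * f i (v j))"
    unfolding A by (simp add: blinfun.add_left blinfun.add_right blinfun_sum_apply blinfun.sum_right blinfun.scaleR_right)
  moreover have "(\<Sum>j<n. (if i = j then 1 else 0) * f j x) = f i x"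
    using i by (simp add: if_distrib[of "\<lambda>x. x * _"] cong: if_cong)
  ultimately show ?thesis by (simp only: distrib_right sum.distrib) (simp add: mult.commute)
qed

text \<open>Cramer's rule bounds the \<open>f i x\<close>, multiplied by the determinant, by
  \<open>norm (A x)\<close>, and \<open>x\<close> is recovered as \<open>A x\<close> minus a
  combination of the \<open>v i\<close>. The constant depends only on \<open>n\<close> and
  \<open>K\<close>, which makes the estimate uniform along a family whose determinant
  degenerates.\<close>

lemma rep_det_lower_bound:
  fixes n :: nat and K :: real
  assumes K: "0 \<le> K"
  obtains C where "0 \<le> C"
    "\<And>A :: 'a::real_normed_vector \<Rightarrow>\<^sub>L 'a. \<And>f v x. A = id_blinfun + (\<Sum>i<(n::nat). rank1 (f i) (v i)) \<Longrightarrow>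
        (\<And>i. i < n \<Longrightarrow> norm (f i) \<le> K) \<Longrightarrow> (\<And>i. i < n \<Longrightarrow> norm (v i) \<le> K) \<Longrightarrow>
        \<bar>rep_det n f v\<bar> * norm x \<le> C * norm (A x)"
proof -
  define B where "B = 1 + K * K"
  have B: "0 \<le> B" using K by (simp add: B_def)
  define C1 where "C1 = real n * (fact (n - 1) * B ^ (n - 1)) * K"
  have C1: "0 \<le> C1" using K B by (simp add: C1_def)
  show thesis
  proof (rule that[of "fact n * B ^ n + real n * C1 * K"])
    show "0 \<le> fact n * B ^ n + real n * C1 * K" using K B C1 by simp
    fix A :: "'a \<Rightarrow>\<^sub>L 'a" and f v x
    assume A: "A = id_blinfun + (\<Sum>i<(n::nat). rank1 (f i) (v i))"
      and f: "\<And>i. i < n \<Longrightarrow> norm (f i) \<le> K" and v: "\<And>i. i < n \<Longrightarrow> norm (v i) \<le> K"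
    let ?M = "\<lambda>i j. (if i = j then 1 else 0) + f i (v j)"
    let ?d = "rep_det n f v"
    have d: "?d = ndet n ?M" by (simp add: rep_det_def)
    have MB: "\<bar>?M i j\<bar> \<le> B" if "i < n" "j < n" for i j
    proof -
      have "norm (f i (v j)) \<le> K * K"
        by (rule order_trans[OF norm_blinfun mult_mono]) (use f v that K in auto)
      then show ?thesis by (auto simp: B_def)
    qed
    have dB: "\<bar>?d\<bar> \<le> fact n * B ^ n" unfolding d by (rule abs_ndet_le[OF MB])
    have coord: "\<bar>?d\<bar> * \<bar>f j x\<bar> \<le> C1 * norm (A x)" if j: "j < n" for j
    proof -
      have "\<bar>?d\<bar> * \<bar>f j x\<bar> \<le> real n * (fact (n - 1) * B ^ (n - 1)) * (K * norm (A x))"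
        unfolding d
      proof (rule abs_ndet_solution_le[OF MB, where a = "\<lambda>j. f j x" and b = "\<lambda>i. f i (A x)"])
        show "\<bar>f i (A x)\<bar> \<le> K * norm (A x)" if "i < n" for i
          using order_trans[OF norm_blinfun[of "f i" "A x"] mult_right_mono[OF f[OF that] norm_ge_zero]] by simp
      qed (use rep_det_coords[OF A] j in auto)
      then show ?thesis by (simp add: C1_def mult.assoc)
    qed
    have "x = A x - (\<Sum>i<n. f i x *\<^sub>R v i)" unfolding A by (simp add: blinfun.add_left blinfun_sum_apply)
    then have "norm x \<le> norm (A x) + norm (\<Sum>i<n. f i x *\<^sub>R v i)" by (metis norm_triangle_ineq4)
    also have "norm (\<Sum>i<n. f i x *\<^sub>R v i) \<le> (\<Sum>i<n. \<bar>f i x\<bar> * K)"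
      by (intro sum_norm_le) (auto intro!: mult_left_mono v)
    finally have "\<bar>?d\<bar> * norm x \<le> \<bar>?d\<bar> * (norm (A x) + (\<Sum>i<n. \<bar>f i x\<bar> * K))"
      by (intro mult_left_mono) auto
    also have "\<dots> = \<bar>?d\<bar> * norm (A x) + (\<Sum>i<n. (\<bar>?d\<bar> * \<bar>f i x\<bar>) * K)"
      by (simp add: distrib_left sum_distrib_left mult.assoc)
    also have "\<dots> \<le> fact n * B ^ n * norm (A x) + (\<Sum>i<n. (C1 * norm (A x)) * K)"
      by (intro add_mono sum_mono mult_right_mono dB) (use K coord in auto)
    finally show "\<bar>?d\<bar> * norm x \<le> (fact n * B ^ n + real n * C1 * K) * norm (A x)"
      by (simp add: algebra_simps)
  qed
qed

lemma rep_det_nonzero_GL: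
  fixes A :: "'a::real_normed_vector \<Rightarrow>\<^sub>L 'a"
  assumes A: "A = id_blinfun + (\<Sum>i<(n::nat). rank1 (f i) (v i))" and d: "rep_det n f v \<noteq> 0"
  shows "A \<in> GL"
proof -
  define K where "K = (\<Sum>i<n. norm (f i) + norm (v i))"
  have K0: "0 \<le> K" by (auto simp: K_def intro: sum_nonneg)
  have "norm (f i) + norm (v i) \<le> K" if "i < n" for i
    unfolding K_def by (rule member_le_sum) (use that in auto)
  then have K: "norm (f i) \<le> K" "norm (v i) \<le> K" if "i < n" for i
    using that norm_ge_zero[of "v i"] norm_ge_zero[of "f i"] by (meson add_increasing2 add_increasing order_refl order_trans)+
  obtain C where C: "0 \<le> C" "\<And>x. \<bar>rep_det n f v\<bar> * norm x \<le> C * norm (A x)"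
    using rep_det_lower_bound[OF K0, of n thesis, where ?'a = 'a] K A by meson
  show ?thesis
  proof (rule GL_bijI)
    have "\<bar>rep_det n f v\<bar> * norm x \<le> (C + 1) * norm (A x)" for x
      using C(2)[of x] norm_ge_zero[of "A x"] unfolding distrib_right by linarith
    then show "lower_bound_on UNIV (\<bar>rep_det n f v\<bar> / (C + 1)) A"
      using C(1) d by (auto simp: lower_bound_on_def field_simps)
    fix y
    \<comment> \<open>A preimage of \<open>y\<close> has the form \<open>y\<close> minus a
      combination of the \<open>v j\<close> whose coefficients are its own values under the
      functionals; this forces the linear system.\<close>
    obtain a where a: "\<And>i. i < n \<Longrightarrow> (\<Sum>j<n. ((if i = j then 1 else 0) + f i (v j)) * a j) = f i y"
      using ndet_solvable[of n "\<lambda>i j. (if i = j then 1 else 0) + f i (v j)" "\<lambda>i. f i y"] d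
      unfolding rep_det_def by blast
    define x where "x = y - (\<Sum>j<n. a j *\<^sub>R v j)"
    have "f i x = a i" if "i < n" for i
    proof -
      have "(\<Sum>j<n. (if i = j then 1 else 0) * a j) = a i"
        using that by (simp add: if_distrib[of "\<lambda>x. x * _"] cong: if_cong)
      then have "f i y = a i + (\<Sum>j<n. f i (v j) * a j)" 
        using a[OF that] by (simp add: distrib_right sum.distrib)
      then show ?thesis by (simp add: x_def blinfun.diff_right blinfun.sum_right blinfun.scaleR_right mult.commute)
    qed
    then have "A x = y" unfolding A by (simp add: blinfun.add_left blinfun_sum_apply) (simp add: x_def)
    then show "\<exists>x. A x = y" by blast
  qed
qed

lemma rep_det_zero_kernel:
  fixes A :: "'a::real_normed_vector \<Rightarrow>\<^sub>L 'a"
  assumes A: "A = id_blinfun + (\<Sum>i<(n::nat). rank1 (f i) (v i))" and d: "rep_det n f v = 0"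
  obtains x where "x \<noteq> 0" "A x = 0"
proof -
  obtain a where a: "\<exists>i<n. a i \<noteq> 0" "\<And>i. i < n \<Longrightarrow> (\<Sum>j<n. ((if i = j then 1 else 0) + f i (v j)) * a j) = 0"
    using ndet_zero_kernel[of n "\<lambda>i j. (if i = j then 1 else 0) + f i (v j)"] d
    unfolding rep_det_def by blast
  define x where "x = (\<Sum>j<n. a j *\<^sub>R v j)"
  have fx: "f i x = - a i" if "i < n" for i
  proof -
    have "(\<Sum>j<n. (if i = j then 1 else 0) * a j) = a i"
      using that by (simp add: if_distrib[of "\<lambda>x. x * _"] cong: if_cong)
    then have "0 = a i + (\<Sum>j<n. f i (v j) * a j)" 
      using a(2)[OF that] by (simp add: distrib_right sum.distrib)
    then show ?thesis by (simp add: x_def blinfun.sum_right blinfun.scaleR_right mult.commute)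
  qed
  show thesis
  proof (rule that)
    show "x \<noteq> 0" using a(1) fx by fastforce
    show "A x = 0" unfolding A using fx by (simp add: blinfun.add_left blinfun_sum_apply sum_negf) (simp add: x_def)
  qed
qed

lemma finite_rank_id_representation:
  assumes "finite_rank (A - id_blinfun)"
  obtains n :: nat and f v where "A = id_blinfun + (\<Sum>i<(n::nat). rank1 (f i) (v i))"
  using finite_rank_representation[OF assms] by (metis add.commute diff_add_cancel)

lemma opdet_nonzero_iff:
  assumes "finite_rank (A - id_blinfun)"
  shows "opdet A \<noteq> 0 \<longleftrightarrow> A \<in> GL"
proof -
  obtain n f v where A: "A = id_blinfun + (\<Sum>i<(n::nat). rank1 (f i) (v i))"
    using finite_rank_id_representation[OF assms] .
  show ?thesis
    unfolding opdet_eq[OF A] using rep_det_nonzero_GL[OF A] rep_det_zero_kernel[OF A] GL_injective by metis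
qed

lemma opdet_inj_GL:
  assumes "finite_rank (A - id_blinfun)" and inj: "\<And>x. A x = 0 \<Longrightarrow> x = 0"
  shows "A \<in> GL"
proof -
  obtain n f v where A: "A = id_blinfun + (\<Sum>i<(n::nat). rank1 (f i) (v i))"
    using finite_rank_id_representation[OF assms(1)] .
  show ?thesis using rep_det_nonzero_GL[OF A] rep_det_zero_kernel[OF A] inj by metis
qed

lemma continuous_on_ndet [continuous_intros]:
  fixes M :: "'b::topological_space \<Rightarrow> nat \<Rightarrow> nat \<Rightarrow> 'c::real_normed_field"
  assumes "\<And>i j. i < n \<Longrightarrow> j < n \<Longrightarrow> continuous_on S (\<lambda>s. M s i j)"
  shows "continuous_on S (\<lambda>s. ndet n (M s))"
  unfolding ndet_leibniz
  by (intro continuous_on_sum continuous_on_mult continuous_on_const continuous_on_prod assms)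
    (auto simp: permutes_in_image intro!: assms dest: permutes_in_image)

text \<open>With \<open>F\<close> fixed, the vectors \<open>v\<close> and the size of the array stay
  fixed and only the functionals \<open>f i o\<^sub>L E s\<close> vary. This form is used because
  the operator norm does not control determinants of unbounded size.\<close>

lemma continuous_on_opdet:
  fixes F :: "'a::banach \<Rightarrow>\<^sub>L 'a" and E :: "'b::topological_space \<Rightarrow> ('a \<Rightarrow>\<^sub>L 'a)"
  assumes F: "finite_rank F" and E: "continuous_on S E"
  shows "continuous_on S (\<lambda>s. opdet (id_blinfun + (F o\<^sub>L E s)))"
proof -
  obtain n f v where Fr: "F = (\<Sum>i<(n::nat). rank1 (f i) (v i))" using finite_rank_representation[OF F] .
  have "id_blinfun + (F o\<^sub>L E s) = id_blinfun + (\<Sum>i<(n::nat). rank1 (f i o\<^sub>L E s) (v i))" for s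
    by (rule blinfun_eqI) (simp add: Fr blinfun.add_left blinfun_sum_apply)
  then have "opdet (id_blinfun + (F o\<^sub>L E s)) = rep_det n (\<lambda>i. f i o\<^sub>L E s) v" for s by (rule opdet_eq)
  then show ?thesis
    unfolding rep_det_def by (auto intro!: continuous_intros E)
qed

subsection \<open>Fredholm operators of index zero\<close>

text \<open>On a Banach space these are exactly the Fredholm operators of index zero. In the form of
  invertible plus finite rank, questions about them reduce to determinants instead of dimension
  counts.\<close>

definition Fred0 :: "('a::real_normed_vector \<Rightarrow>\<^sub>L 'a) \<Rightarrow> bool" where
  "Fred0 A \<longleftrightarrow> (\<exists>U\<in>GL. finite_rank (A - U))"

lemma GL_imp_Fred0: "A \<in> GL \<Longrightarrow> Fred0 A"
  by (auto simp: Fred0_def intro!: bexI[of _ A])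

text \<open>Fredholm alternative: composing with the inverse of the invertible part gives a
  finite-rank perturbation of the identity, where injectivity makes the determinant nonzero.\<close>

lemma Fred0_inj_GL:
  fixes A :: "'a::banach \<Rightarrow>\<^sub>L 'a"
  assumes "Fred0 A" and inj: "\<And>x. A x = 0 \<Longrightarrow> x = 0"
  shows "A \<in> GL"
proof -
  obtain U where U: "U \<in> GL" "finite_rank (A - U)" using assms(1) by (auto simp: Fred0_def)
  have "(A o\<^sub>L binv U) - id_blinfun = (A - U) o\<^sub>L binv U"
    by (rule blinfun_eqI) (simp add: blinfun.diff_left U(1))
  then have "finite_rank ((A o\<^sub>L binv U) - id_blinfun)" using U(2) by (simp add: finite_rank_compose_right)
  then have "A o\<^sub>L binv U \<in> GL"
  proof (rule opdet_inj_GL)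
    fix x assume "(A o\<^sub>L binv U) x = 0"
    then have "binv U x = 0" using inj by simp
    then show "x = 0" using GL_injective[OF binv_GL[OF U(1)]] by simp
  qed
  then have "(A o\<^sub>L binv U) o\<^sub>L U \<in> GL" using U(1) by (rule GL_comp)
  moreover have "(A o\<^sub>L binv U) o\<^sub>L U = A" by (rule blinfun_eqI) (simp add: U(1))
  ultimately show ?thesis by simp
qed

lemma Fred0_add_finite_rank: "Fred0 A \<Longrightarrow> finite_rank F \<Longrightarrow> Fred0 (A + F)"
  unfolding Fred0_def by (metis add_diff_eq add.commute finite_rank_add)

lemma Fred0_finite_rank_diff: "Fred0 B \<Longrightarrow> finite_rank (A - B) \<Longrightarrow> Fred0 A"
  using Fred0_add_finite_rank[of B "A - B"] by simp

lemma Fred0_scaleR: "Fred0 A \<Longrightarrow> c \<noteq> 0 \<Longrightarrow> Fred0 (c *\<^sub>R A)"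
  unfolding Fred0_def by (metis GL_scaleR finite_rank_scaleR scaleR_diff_right)

lemma Fred0_compose:
  assumes "Fred0 A" "Fred0 B"
  shows "Fred0 (A o\<^sub>L B)"
proof -
  obtain U V where U: "U \<in> GL" "finite_rank (A - U)" and V: "V \<in> GL" "finite_rank (B - V)"
    using assms by (auto simp: Fred0_def)
  have "(A o\<^sub>L B) - (U o\<^sub>L V) = ((A - U) o\<^sub>L B) + (U o\<^sub>L (B - V))"
    by (rule blinfun_eqI) (simp add: blinfun.diff_left blinfun.add_left blinfun.diff_right)
  then have "finite_rank ((A o\<^sub>L B) - (U o\<^sub>L V))"
    using U V by (simp add: finite_rank_add finite_rank_compose_left finite_rank_compose_right)
  then show ?thesis unfolding Fred0_def using U V GL_comp by blast
qed

lemma Fred0_near: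
  fixes A :: "'a::banach \<Rightarrow>\<^sub>L 'a"
  assumes "Fred0 A"
  obtains r where "0 < r" "\<And>B. norm (B - A) < r \<Longrightarrow> Fred0 B"
proof -
  obtain U where U: "U \<in> GL" "finite_rank (A - U)" using assms by (auto simp: Fred0_def)
  obtain r where r: "0 < r" "\<And>B. norm (B - U) < r \<Longrightarrow> B \<in> GL" using GL_near[OF U(1)] by metis
  show thesis
  proof (rule that[OF r(1)])
    fix B assume "norm (B - A) < r"
    then have "U + (B - A) \<in> GL" by (intro r(2)) simp
    moreover have "B - (U + (B - A)) = A - U" by simp
    ultimately show "Fred0 B" unfolding Fred0_def using U(2) by metis
  qed
qed

subsection \<open>Semi-Fredholm operators\<close>

definition fin_codim :: "'a::real_normed_vector set \<Rightarrow> bool" where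
  "fin_codim L \<longleftrightarrow> subspace L \<and> closed L \<and> (\<exists>B. finite B \<and> span (L \<union> B) = UNIV)"

text \<open>On a Banach space, the operators with closed range and finite-dimensional kernel,
  encoded by one inequality that survives small perturbations.\<close>

definition semi_fredholm :: "('a::real_normed_vector \<Rightarrow>\<^sub>L 'a) \<Rightarrow> bool" where
  "semi_fredholm A \<longleftrightarrow> (\<exists>L c. fin_codim L \<and> lower_bound_on L c A)"

lemma linear_blinfun: "linear (blinfun_apply A)"
  by (rule bounded_linear.linear[OF blinfun.bounded_linear_right])

lemma fin_codim_UNIV [simp]: "fin_codim UNIV"
  by (auto simp: fin_codim_def intro!: exI[of _ "{}"])

lemma subspace_inter_kernel:
  fixes F :: "'a::real_normed_vector \<Rightarrow>\<^sub>L 'b::real_normed_vector"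
  shows "subspace L \<Longrightarrow> subspace {x\<in>L. F x = 0}"
  by (auto simp: subspace_def blinfun.add_right blinfun.scaleR_right)

lemma closed_inter_kernel:
  fixes F :: "'a::real_normed_vector \<Rightarrow>\<^sub>L 'b::real_normed_vector"
  assumes "closed L"
  shows "closed {x\<in>L. F x = 0}"
proof -
  have "closed {x. F x = 0}" by (intro closed_Collect_eq continuous_intros)
  then show ?thesis using closed_Int[OF assms] by (simp add: Collect_conj_eq)
qed

lemma finite_rank_kernel_complement:
  fixes F :: "'a::real_normed_vector \<Rightarrow>\<^sub>L 'b::real_normed_vector"
  assumes L: "subspace L" and F: "finite_rank F"
  obtains S where "finite S" "S \<subseteq> L" "L = span ({x\<in>L. F x = 0} \<union> S)"
proof -
  obtain B where B: "finite B" "range (blinfun_apply F) \<subseteq> span B" using F by (auto simp: finite_rank_def)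
  obtain C where C: "C \<subseteq> F ` L" "independent C" "F ` L \<subseteq> span C" using basis_exists[of "F ` L"] by metis
  have "C \<subseteq> span B" using B(2) C(1) by blast
  then have finC: "finite C" using independent_span_bound[OF B(1) C(2)] by simp
  define g where "g c = (SOME x. x \<in> L \<and> F x = c)" for c
  have g: "g c \<in> L \<and> F (g c) = c" if "c \<in> C" for c
    unfolding g_def by (rule someI_ex) (use C(1) that in blast)
  define S where "S = g ` C"
  have FS: "F ` S = C" using g by (force simp: S_def)
  have SL: "S \<subseteq> L" using g by (auto simp: S_def)
  have "x \<in> span ({x\<in>L. F x = 0} \<union> S)" if x: "x \<in> L" for x
  proof -
    have "F x \<in> span (F ` S)" using C(3) x by (auto simp: FS)
    also have "span (F ` S) = F ` span S" by (rule linear_span_image[OF linear_blinfun])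
    finally obtain y where y: "y \<in> span S" "F x = F y" by auto
    have "y \<in> L" using y(1) span_minimal[OF SL L] by blast
    then have "x - y \<in> {x\<in>L. F x = 0}" using x y L by (auto simp: blinfun.diff_right subspace_diff)
    then have "(x - y) + y \<in> span ({x\<in>L. F x = 0} \<union> S)"
      using y(1) span_mono[of S "{x\<in>L. F x = 0} \<union> S"] by (intro span_add) (auto intro: span_base)
    then show ?thesis by simp
  qed
  moreover have "span ({x\<in>L. F x = 0} \<union> S) \<subseteq> L" by (rule span_minimal) (use SL L in auto)
  ultimately have "L = span ({x\<in>L. F x = 0} \<union> S)" by blast
  with finC SL show thesis by (intro that[of S]) (auto simp: S_def)
qed

lemma fin_codim_inter_kernel:
  fixes F :: "'a::real_normed_vector \<Rightarrow>\<^sub>L 'b::real_normed_vector"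
  assumes L: "fin_codim L" and F: "finite_rank F"
  shows "fin_codim {x\<in>L. F x = 0}"
proof -
  obtain B where B: "finite B" "span (L \<union> B) = UNIV" using L by (auto simp: fin_codim_def)
  obtain S where S: "finite S" "L = span ({x\<in>L. F x = 0} \<union> S)"
    using finite_rank_kernel_complement[OF _ F] L unfolding fin_codim_def by metis
  have "L \<union> B \<subseteq> span ({x\<in>L. F x = 0} \<union> (S \<union> B))"
    using S(2) span_mono[of "{x\<in>L. F x = 0} \<union> S" "{x\<in>L. F x = 0} \<union> (S \<union> B)"] by (auto intro: span_base)
  then have "span (L \<union> B) \<subseteq> span ({x\<in>L. F x = 0} \<union> (S \<union> B))" by (metis span_mono span_span)
  then have "span ({x\<in>L. F x = 0} \<union> (S \<union> B)) = UNIV" using B(2) by auto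
  then show ?thesis
    using L S(1) B(1) unfolding fin_codim_def
    by (blast intro: subspace_inter_kernel closed_inter_kernel)
qed

lemma finite_rank_functional:
  fixes f :: "'a::real_normed_vector \<Rightarrow>\<^sub>L real"
  shows "finite_rank f"
  unfolding finite_rank_def by (rule exI[of _ "{1}"]) (auto simp: span_singleton)

lemma finite_rank_vanishing:
  assumes L: "fin_codim L" and D: "\<And>x. x \<in> L \<Longrightarrow> blinfun_apply D x = 0"
  shows "finite_rank D"
proof -
  obtain B where B: "finite B" "span (L \<union> B) = UNIV" using L by (auto simp: fin_codim_def)
  have "range (blinfun_apply D) = span (D ` (L \<union> B))"
    using linear_span_image[OF linear_blinfun[of D], of "L \<union> B"] B(2) by simp
  also have "\<dots> \<subseteq> span (insert 0 (D ` B))"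
    by (rule span_mono) (use D in auto)
  finally have "range (blinfun_apply D) \<subseteq> span (insert 0 (D ` B))" .
  moreover have "finite (insert 0 (D ` B))" using B(1) by simp
  ultimately show ?thesis unfolding finite_rank_def by metis
qed

section \<open>Extension of isomorphisms across finitely many dimensions\<close>

lemma closed_span_insert:
  fixes L :: "'a::real_normed_vector set"
  assumes L: "subspace L" "closed L"
  shows "closed (span (insert v L))"
proof (cases "v \<in> L")
  case True
  then show ?thesis using L by (simp add: insert_absorb span_eq_iff[THEN iffD2])
next
  case False
  obtain g :: "'a \<Rightarrow>\<^sub>L real" where g: "g v = 1" "\<And>x. x \<in> L \<Longrightarrow> g x = 0"
    using separating_functional[OF L False] by blast
  have "span (insert v L) = {x. x - g x *\<^sub>R v \<in> L}"
  proof (intro Set.set_eqI iffI)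
    fix x assume "x \<in> span (insert v L)"
    then obtain k where k: "x - k *\<^sub>R v \<in> L" using L by (auto simp: span_insert span_eq_iff[THEN iffD2])
    then have "g x = k" using g(2)[OF k] g(1) by (simp add: blinfun.diff_right blinfun.scaleR_right)
    then show "x \<in> {x. x - g x *\<^sub>R v \<in> L}" using k by simp
  next
    fix x assume "x \<in> {x. x - g x *\<^sub>R v \<in> L}"
    then show "x \<in> span (insert v L)" using L by (auto simp: span_insert span_eq_iff[THEN iffD2])
  qed
  moreover have "closed {x. x - g x *\<^sub>R v \<in> L}"
    using continuous_closed_vimage[OF L(2), of "\<lambda>x. x - g x *\<^sub>R v"]
    by (simp add: vimage_def continuous_intros)
  ultimately show ?thesis by simp
qed

lemma span_Un_insert: "span (L \<union> insert v S) = span (insert v (span (L \<union> S)))"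
  by (simp add: span_insert span_span)

lemma closed_span_Un_finite:
  fixes L :: "'a::real_normed_vector set"
  assumes "finite S" "subspace L" "closed L"
  shows "closed (span (L \<union> S))"
  using assms(1)
proof (induction S)
  case empty
  then show ?case using assms by (simp add: span_eq_iff[THEN iffD2])
next
  case (insert v S)
  then show ?case unfolding span_Un_insert by (intro closed_span_insert) auto
qed

text \<open>The correction \<open>rank1 g (e - V v)\<close> redirects \<open>v\<close> to
  \<open>e\<close> without touching \<open>L\<close>, provided \<open>g\<close> vanishes on
  \<open>L\<close> and \<open>g v = 1\<close>. The result is injective exactly when \<open>g\<close>
  is nonzero at the old preimage \<open>u\<close> of \<open>e\<close>, and index zero then gives
  invertibility.\<close>

lemma GL_prescribe:
  fixes V :: "'a::banach \<Rightarrow>\<^sub>L 'a"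
  assumes V: "V \<in> GL" and L: "subspace L" "closed L" and v: "v \<notin> L" and e: "e \<notin> V ` L"
  obtains V' where "V' \<in> GL" "\<And>x. x \<in> L \<Longrightarrow> V' x = V x" "V' v = e"
proof -
  define u where "u = binv V e"
  have Vu: "V u = e" using V by (simp add: u_def)
  have uL: "u \<notin> L" using e Vu by blast
  obtain g1 :: "'a \<Rightarrow>\<^sub>L real" where g1: "g1 v = 1" "\<And>x. x \<in> L \<Longrightarrow> g1 x = 0"
    using separating_functional[OF L v] by blast
  obtain g2 :: "'a \<Rightarrow>\<^sub>L real" where g2: "g2 u = 1" "\<And>x. x \<in> L \<Longrightarrow> g2 x = 0"
    using separating_functional[OF L uL] by blast
  have "\<exists>g :: 'a \<Rightarrow>\<^sub>L real. g v = 1 \<and> g u \<noteq> 0 \<and> (\<forall>x\<in>L. g x = 0)"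
  proof (cases "g1 u = 0")
    case False
    then show ?thesis using g1 by blast
  next
    case True
    \<comment> \<open>Two values suffice: if \<open>1 + g2 v\<close> vanishes, then
      \<open>1 + 2 * g2 v = - 1\<close>.\<close>
    define t :: real where "t = (if 1 + g2 v \<noteq> 0 then 1 else 2)"
    have t: "t \<noteq> 0" "1 + t * g2 v \<noteq> 0" by (auto simp: t_def)
    define g where "g = inverse (1 + t * g2 v) *\<^sub>R (g1 + t *\<^sub>R g2)"
    have "g v = 1" "g u \<noteq> 0" "\<And>x. x \<in> L \<Longrightarrow> g x = 0"
      using t True g1 g2 by (auto simp: g_def blinfun.scaleR_left blinfun.add_left)
    then show ?thesis by blast
  qed
  then obtain g :: "'a \<Rightarrow>\<^sub>L real" where g: "g v = 1" "g u \<noteq> 0" "\<And>x. x \<in> L \<Longrightarrow> g x = 0" by blast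
  define V' where "V' = V + rank1 g (e - V v)"
  have V'x: "V' x = V x + g x *\<^sub>R (e - V v)" for x by (simp add: V'_def blinfun.add_left)
  have "Fred0 V'" unfolding V'_def by (intro Fred0_add_finite_rank GL_imp_Fred0 V) simp
  then have "V' \<in> GL"
  proof (rule Fred0_inj_GL)
    fix x assume "V' x = 0"
    then have "V (x + g x *\<^sub>R (u - v)) = 0"
      by (simp add: V'x blinfun.add_right blinfun.scaleR_right blinfun.diff_right Vu)
    then have *: "x + g x *\<^sub>R (u - v) = 0" by (rule GL_injective[OF V])
    then have "g (x + g x *\<^sub>R (u - v)) = 0" by simp
    then have "g x * g u = 0" using g(1)
      by (simp add: blinfun.add_right blinfun.scaleR_right blinfun.diff_right algebra_simps)
    then show "x = 0" using * g(2) by simp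
  qed
  then show thesis by (rule that) (use g in \<open>auto simp: V'x\<close>)
qed

text \<open>Vectors of \<open>S\<close> are added one at a time; injectivity of \<open>A\<close> on
  the enlarged span keeps \<open>A v\<close> outside the image of the part already treated, as
  \<open>GL_prescribe\<close> requires.\<close>

lemma GL_extend_injective:
  fixes A V :: "'a::banach \<Rightarrow>\<^sub>L 'a"
  assumes S: "finite S" and L: "subspace L" "closed L" and V: "V \<in> GL" "\<And>x. x \<in> L \<Longrightarrow> V x = A x"
    and inj: "\<And>x. x \<in> span (L \<union> S) \<Longrightarrow> A x = 0 \<Longrightarrow> x = 0"
  obtains V' where "V' \<in> GL" "\<And>x. x \<in> span (L \<union> S) \<Longrightarrow> V' x = A x"
proof -
  have "\<exists>V'\<in>GL. \<forall>x\<in>span (L \<union> S). V' x = A x"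
    using S inj
  proof (induction S)
    case empty
    then show ?case using V L by (auto simp: span_eq_iff[THEN iffD2])
  next
    case (insert v S)
    define M where "M = span (L \<union> S)"
    have sub: "M \<subseteq> span (L \<union> insert v S)" unfolding M_def by (rule span_mono) auto
    obtain V1 where V1: "V1 \<in> GL" "\<And>x. x \<in> M \<Longrightarrow> V1 x = A x"
      using insert.IH insert.prems sub unfolding M_def by blast
    show ?case
    proof (cases "v \<in> M")
      case True
      then have "span (L \<union> insert v S) = M"
        unfolding span_Un_insert M_def by (simp add: insert_absorb span_span)
      then show ?thesis using V1 by blast
    next
      case False
      have M: "subspace M" "closed M" unfolding M_def using closed_span_Un_finite[OF insert.hyps(1) L] by auto
      have vin: "v \<in> span (L \<union> insert v S)" by (auto intro: span_base)
      have "A v \<notin> V1 ` M"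
      proof
        assume "A v \<in> V1 ` M"
        then obtain x where x: "x \<in> M" "A v = A x" using V1(2) by auto
        then have "A (v - x) = 0" by (simp add: blinfun.diff_right)
        moreover have "v - x \<in> span (L \<union> insert v S)" using vin x sub by (blast intro: span_diff)
        ultimately show False using insert.prems x False by fastforce
      qed
      then obtain V' where V': "V' \<in> GL" "\<And>x. x \<in> M \<Longrightarrow> V' x = V1 x" "V' v = A v"
        using GL_prescribe[OF V1(1) M False] by blast
      have "V' x = A x" if x: "x \<in> span (L \<union> insert v S)" for x
      proof -
        obtain k where k: "x - k *\<^sub>R v \<in> M"
          using x unfolding span_Un_insert M_def by (auto simp: span_insert span_span)
        have "V' (x - k *\<^sub>R v) = A (x - k *\<^sub>R v)" using V'(2) V1(2) k by simp
        then show ?thesis using V'(3) by (simp add: blinfun.diff_right blinfun.scaleR_right)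
      qed
      then show ?thesis using V'(1) by blast
    qed
  qed
  then show thesis using that by blast
qed

lemma riesz_almost_orthogonal:
  fixes M :: "'a::real_normed_vector set"
  assumes M: "subspace M" "closed M" "M \<noteq> UNIV"
  obtains e where "norm e = 1" "\<And>m. m \<in> M \<Longrightarrow> 1 / 2 \<le> norm (e - m)"
proof -
  obtain y where y: "y \<notin> M" using M(3) by blast
  have ne: "M \<noteq> {}" using subspace_0[OF M(1)] by blast
  define d where "d = infdist y M"
  have d: "0 < d" using in_closed_iff_infdist_zero[OF M(2) ne] y infdist_nonneg[of y M] by (auto simp: d_def less_le)
  obtain m0 where m0: "m0 \<in> M" "norm (y - m0) < 2 * d"
  proof -
    have "\<exists>m\<in>M. dist y m < 2 * d"
    proof (rule ccontr)
      assume "\<not> ?thesis"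
      then have "2 * d \<le> infdist y M" unfolding infdist_notempty[OF ne] by (intro cINF_greatest ne) auto
      then show False using d by (simp add: d_def)
    qed
    then show thesis using that by (auto simp: dist_norm)
  qed
  define r where "r = norm (y - m0)"
  have r: "0 < r" "r < 2 * d" using y m0 by (auto simp: r_def)
  show thesis
  proof (rule that[of "inverse r *\<^sub>R (y - m0)"])
    show "norm (inverse r *\<^sub>R (y - m0)) = 1" using r by (simp add: r_def)
    fix m assume m: "m \<in> M"
    have "m0 + r *\<^sub>R m \<in> M" using m m0(1) M(1) by (simp add: subspace_add subspace_scale)
    then have "d \<le> norm (y - (m0 + r *\<^sub>R m))" unfolding d_def using infdist_le by (force simp: dist_norm)
    also have "y - (m0 + r *\<^sub>R m) = r *\<^sub>R (inverse r *\<^sub>R (y - m0) - m)"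
      using r by (simp add: algebra_simps)
    also have "norm \<dots> = r * norm (inverse r *\<^sub>R (y - m0) - m)" using r by simp
    finally have "d \<le> r * norm (inverse r *\<^sub>R (y - m0) - m)" .
    then have "r * (1 / 2) \<le> r * norm (inverse r *\<^sub>R (y - m0) - m)" using r by linarith
    then show "1 / 2 \<le> norm (inverse r *\<^sub>R (y - m0) - m)" using r by (simp only: mult_le_cancel_left_pos)
  qed
qed

lemma closed_GL_image:
  assumes V: "V \<in> GL" and L: "closed L"
  shows "closed (blinfun_apply V ` L)"
proof -
  have "blinfun_apply V ` L = blinfun_apply (binv V) -` L"
  proof (intro Set.set_eqI iffI)
    fix y assume "y \<in> blinfun_apply (binv V) -` L"
    then have "V (binv V y) \<in> V ` L" by blast
    then show "y \<in> V ` L" using V by simp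
  qed (use V in auto)
  then show ?thesis by (simp add: continuous_closed_vimage[OF L] linear_continuous_at blinfun.bounded_linear_right)
qed

text \<open>The new lower bound depends on the old one but not on the operator; this is what makes the
  index-zero operators closed among the semi-Fredholm ones.\<close>

lemma GL_extend_lower_bound:
  fixes L :: "'a::banach set"
  assumes S: "finite S" and L: "subspace L" "closed L" and c: "0 < c"
  obtains c' where "0 < c'" "\<And>V. V \<in> GL \<Longrightarrow> lower_bound_on L c V \<Longrightarrow>
      \<exists>V'\<in>GL. (\<forall>x\<in>L. blinfun_apply V' x = blinfun_apply V x) \<and> lower_bound_on (span (L \<union> S)) c' V'"
proof -
  have "\<exists>c'>0. \<forall>V\<in>GL. lower_bound_on L c V \<longrightarrow>
      (\<exists>V'\<in>GL. (\<forall>x\<in>L. blinfun_apply V' x = blinfun_apply V x) \<and> lower_bound_on (span (L \<union> S)) c' V')"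
    using S
  proof (induction S)
    case empty
    then show ?case using c L by (auto intro!: exI[of _ c] simp: span_eq_iff[THEN iffD2])
  next
    case (insert v S)
    define M where "M = span (L \<union> S)"
    have M: "subspace M" "closed M" unfolding M_def using closed_span_Un_finite[OF insert.hyps(1) L] by auto
    have LM: "L \<subseteq> M" unfolding M_def by (auto intro: span_base)
    obtain c1 where c1: "0 < c1" "\<And>V. V \<in> GL \<Longrightarrow> lower_bound_on L c V \<Longrightarrow>
      \<exists>V'\<in>GL. (\<forall>x\<in>L. blinfun_apply V' x = blinfun_apply V x) \<and> lower_bound_on M c1 V'"
      using insert.IH unfolding M_def by blast
    show ?case
    proof (cases "v \<in> M")
      case True
      then have "span (L \<union> insert v S) = M"
        unfolding span_Un_insert M_def by (simp add: insert_absorb span_span)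
      then show ?thesis using c1 by auto
    next
      case False
      \<comment> \<open>The term \<open>3 / c1\<close> accounts for the component in
        \<open>M\<close>, and \<open>2 * norm v\<close> for the component along
        \<open>v\<close>.\<close>
      define k where "k = 3 / c1 + 2 * norm v"
      have k: "0 < k" using c1 by (auto simp: k_def add_pos_nonneg)
      have "\<exists>V'\<in>GL. (\<forall>x\<in>L. blinfun_apply V' x = blinfun_apply V x) \<and> lower_bound_on (span (L \<union> insert v S)) (1 / k) V'"
        if V: "V \<in> GL" "lower_bound_on L c V" for V
      proof -
        obtain V1 where V1: "V1 \<in> GL" "\<And>x. x \<in> L \<Longrightarrow> V1 x = V x" "lower_bound_on M c1 V1"
          using c1(2)[OF V] by blast
        have VM: "subspace (V1 ` M)" "closed (V1 ` M)"
          using closed_GL_image[OF V1(1) M(2)] linear_subspace_image[OF linear_blinfun M(1)] by auto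
        have "V1 v \<notin> V1 ` M"
        proof
          assume "V1 v \<in> V1 ` M"
          then obtain x where "x \<in> M" "V1 v = V1 x" by auto
          then show False using V1(1) False by (metis binv_apply(2))
        qed
        then have "V1 ` M \<noteq> UNIV" by blast
        \<comment> \<open>Sending \<open>v\<close> to a unit vector at distance at least
          \<open>1 / 2\<close> from the image of \<open>M\<close> controls the coefficient of
          \<open>v\<close> by a constant that does not depend on \<open>V\<close>.\<close>
        then obtain e where e: "norm e = 1" "\<And>m. m \<in> V1 ` M \<Longrightarrow> 1 / 2 \<le> norm (e - m)"
          using riesz_almost_orthogonal[OF VM] by blast
        have "e \<notin> V1 ` M" using e(2)[of e] by auto
        then obtain V' where V': "V' \<in> GL" "\<And>x. x \<in> M \<Longrightarrow> V' x = V1 x" "V' v = e"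
          using GL_prescribe[OF V1(1) M False] by blast
        have "1 / k * norm x \<le> norm (V' x)" if x: "x \<in> span (L \<union> insert v S)" for x
        proof -
          obtain a where a: "x - a *\<^sub>R v \<in> M"
            using x unfolding span_Un_insert M_def by (auto simp: span_insert span_span)
          define l where "l = x - a *\<^sub>R v"
          have l: "l \<in> M" "x = l + a *\<^sub>R v" using a by (auto simp: l_def)
          have y: "V' x = V1 l + a *\<^sub>R e" by (simp add: l(2) blinfun.add_right blinfun.scaleR_right V' l(1))
          have ya: "\<bar>a\<bar> \<le> 2 * norm (V' x)"
          proof (cases "a = 0")
            case False
            have "- inverse a *\<^sub>R l \<in> M" using l(1) M(1) by (intro subspace_scale)
            then have "1 / 2 \<le> norm (e - V1 (- inverse a *\<^sub>R l))" by (intro e(2)) blast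
            then have "\<bar>a\<bar> * (1 / 2) \<le> \<bar>a\<bar> * norm (e - V1 (- inverse a *\<^sub>R l))" by (intro mult_left_mono) auto
            also have "\<dots> = norm (a *\<^sub>R (e - V1 (- inverse a *\<^sub>R l)))" by simp
            also have "a *\<^sub>R (e - V1 (- inverse a *\<^sub>R l)) = V' x"
              using False by (simp add: y blinfun.scaleR_right blinfun.minus_right algebra_simps)
            finally show ?thesis by simp
          qed simp
          have "c1 * norm l \<le> norm (V1 l)" using V1(3) l(1) by (auto simp: lower_bound_on_def)
          also have "\<dots> \<le> norm (V' x) + norm (a *\<^sub>R e)" using norm_triangle_ineq4[of "V' x" "a *\<^sub>R e"] by (simp add: y)
          also have "\<dots> \<le> 3 * norm (V' x)" using ya e(1) by simp
          finally have "norm l \<le> 3 / c1 * norm (V' x)" using c1(1) by (simp add: field_simps)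
          moreover have "norm x \<le> norm l + \<bar>a\<bar> * norm v" unfolding l(2) by (metis norm_triangle_ineq norm_scaleR)
          moreover have "\<bar>a\<bar> * norm v \<le> (2 * norm (V' x)) * norm v" by (intro mult_right_mono ya) simp
          ultimately have "norm x \<le> k * norm (V' x)" by (simp add: k_def algebra_simps)
          then show ?thesis using k by (simp add: field_simps)
        qed
        then have "lower_bound_on (span (L \<union> insert v S)) (1 / k) V'" using k by (auto simp: lower_bound_on_def)
        moreover have "\<forall>x\<in>L. blinfun_apply V' x = blinfun_apply V x" using V'(2) V1(2) LM by auto
        ultimately show ?thesis using V'(1) by blast
      qed
      then show ?thesis using k by (intro exI[of _ "1 / k"]) auto
    qed
  qed
  then show thesis using that by blast
qed

text \<open>This is half of the local constancy of the index. A nearby \<open>T\<close> inherits the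
  bound \<open>c / 2\<close> on \<open>L\<close> and agrees there with an invertible
  \<open>V\<close>, which is replaced by \<open>V'\<close> bounded below everywhere by
  \<open>c'\<close>. As \<open>c'\<close> is fixed before \<open>T\<close>, closeness of
  \<open>T\<close> to \<open>A\<close> keeps \<open>V' + (A - T)\<close> invertible, and it differs
  from \<open>A\<close> by the finite-rank operator \<open>T - V'\<close>.\<close>

lemma Fred0_closed_in_semi_fredholm:
  fixes A :: "'a::banach \<Rightarrow>\<^sub>L 'a"
  assumes "semi_fredholm A"
  obtains r where "0 < r" "\<And>T. norm (T - A) < r \<Longrightarrow> Fred0 T \<Longrightarrow> Fred0 A"
proof -
  obtain L c where L: "fin_codim L" and c: "lower_bound_on L c A"
    using assms by (auto simp: semi_fredholm_def)
  have c0: "0 < c" using c by (auto simp: lower_bound_on_def)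
  have Ls: "subspace L" "closed L" using L by (auto simp: fin_codim_def)
  obtain B where B: "finite B" "span (L \<union> B) = UNIV" using L by (auto simp: fin_codim_def)
  obtain c' where c': "0 < c'" "\<And>V. V \<in> GL \<Longrightarrow> lower_bound_on L (c / 2) V \<Longrightarrow>
      \<exists>V'\<in>GL. (\<forall>x\<in>L. blinfun_apply V' x = blinfun_apply V x) \<and> lower_bound_on UNIV c' V'"
    using GL_extend_lower_bound[OF B(1) Ls, of "c / 2"] c0 unfolding B(2) by auto
  show thesis
  proof (rule that[of "min (c / 2) c'"])
    show "0 < min (c / 2) c'" using c0 c' by simp
    fix T assume T: "norm (T - A) < min (c / 2) c'" "Fred0 T"
    have cT: "lower_bound_on L (c / 2) T"
      using lower_bound_on_perturb[OF c, of "T - A" "c / 2"] T c0 by simp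
    obtain U where U: "U \<in> GL" "finite_rank (T - U)" using T(2) by (auto simp: Fred0_def)
    define L0 where "L0 = {x\<in>L. (T - U) x = 0}"
    obtain S where S: "finite S" "S \<subseteq> L" "L = span (L0 \<union> S)"
      using finite_rank_kernel_complement[OF Ls(1) U(2)] unfolding L0_def by blast
    have L0: "subspace L0" "closed L0"
      using subspace_inter_kernel[OF Ls(1), of "T - U"] closed_inter_kernel[OF Ls(2), of "T - U"] by (auto simp: L0_def)
    have "x = 0" if "x \<in> span (L0 \<union> S)" "T x = 0" for x
      using cT that c0 S(3) by (auto simp: lower_bound_on_def mult_le_0_iff)
    moreover have "U x = T x" if "x \<in> L0" for x using that by (simp add: L0_def blinfun.diff_left)
    ultimately obtain V where V: "V \<in> GL" "\<And>x. x \<in> span (L0 \<union> S) \<Longrightarrow> V x = T x"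
      using GL_extend_injective[OF S(1) L0 U(1), of T] by metis
    note V = V(1) V(2)[folded S(3)]
    have "lower_bound_on L (c / 2) V" using cT V(2) by (auto simp: lower_bound_on_def)
    then obtain V' where V': "V' \<in> GL" "\<And>x. x \<in> L \<Longrightarrow> V' x = V x" "lower_bound_on UNIV c' V'"
      using c'(2)[OF V(1)] by blast
    have "V' + (A - T) \<in> GL"
      by (rule GL_perturb[OF V'(1,3)]) (use T in \<open>simp add: norm_minus_commute\<close>)
    moreover have "finite_rank (T - V')"
      by (rule finite_rank_vanishing[OF L]) (simp add: blinfun.diff_left V' V)
    moreover have "A - (V' + (A - T)) = T - V'" by simp
    ultimately show "Fred0 A" unfolding Fred0_def by metis
  qed
qed

lemma Fred0_connected:
  fixes C :: "('a::banach \<Rightarrow>\<^sub>L 'a) set"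
  assumes C: "connected C" and sf: "\<And>A. A \<in> C \<Longrightarrow> semi_fredholm A"
    and ab: "a \<in> C" "b \<in> C" and "Fred0 a"
  shows "Fred0 b"
proof -
  have "\<forall>A\<in>C. eventually (\<lambda>B. Fred0 A = Fred0 B) (at A within C)"
  proof
    fix A assume A: "A \<in> C"
    obtain r1 where r1: "0 < r1" "\<And>T. norm (T - A) < r1 \<Longrightarrow> Fred0 T \<Longrightarrow> Fred0 A"
      using Fred0_closed_in_semi_fredholm[OF sf[OF A]] by blast
    show "eventually (\<lambda>B. Fred0 A = Fred0 B) (at A within C)"
    proof (cases "Fred0 A")
      case True
      obtain r2 where "0 < r2" "\<And>B. norm (B - A) < r2 \<Longrightarrow> Fred0 B" using Fred0_near[OF True] by blast
      then show ?thesis using True unfolding eventually_at by (auto simp: dist_norm)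
    next
      case False
      then show ?thesis using r1 unfolding eventually_at by (auto simp: dist_norm)
    qed
  qed
  then show ?thesis using connected_local_const[OF C ab] \<open>Fred0 a\<close> by blast
qed

lemma Fred0_imp_semi_fredholm:
  assumes "Fred0 A"
  shows "semi_fredholm A"
proof -
  obtain U where U: "U \<in> GL" "finite_rank (A - U)" using assms by (auto simp: Fred0_def)
  obtain c where c: "lower_bound_on UNIV c U" using GL_lower_bound[OF U(1)] .
  have "fin_codim {x\<in>UNIV. (A - U) x = 0}" by (rule fin_codim_inter_kernel[OF _ U(2)]) simp
  moreover have "lower_bound_on {x\<in>UNIV. (A - U) x = 0} c A"
    using c by (auto simp: lower_bound_on_def blinfun.diff_left)
  ultimately show ?thesis by (auto simp: semi_fredholm_def)
qed

subsection \<open>Operators on hereditarily indecomposable spaces\<close>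

lemma subspace_closure:
  fixes W :: "'a::real_normed_vector set"
  assumes "subspace W"
  shows "subspace (closure W)"
proof (rule subspaceI)
  show "0 \<in> closure W" using subspace_0[OF assms] closure_subset by blast
next
  fix x y assume "x \<in> closure W" "y \<in> closure W"
  then obtain f g where "\<And>n. f n \<in> W" "f \<longlonglongrightarrow> x" "\<And>n. g n \<in> W" "g \<longlonglongrightarrow> y"
    by (auto simp: closure_sequential)
  then have "(\<lambda>n. f n + g n) \<longlonglongrightarrow> x + y" "\<And>n. f n + g n \<in> W"
    using assms by (auto intro: tendsto_add subspace_add)
  then show "x + y \<in> closure W"
    unfolding closure_sequential by (intro exI[of _ "\<lambda>n. f n + g n"]) auto
next
  fix c :: real and x assume "x \<in> closure W"
  then obtain f where "\<And>n. f n \<in> W" "f \<longlonglongrightarrow> x" by (auto simp: closure_sequential)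
  then have "(\<lambda>n. c *\<^sub>R f n) \<longlonglongrightarrow> c *\<^sub>R x" "\<And>n. c *\<^sub>R f n \<in> W"
    using assms by (auto intro: tendsto_scaleR subspace_scale)
  then show "c *\<^sub>R x \<in> closure W"
    unfolding closure_sequential by (intro exI[of _ "\<lambda>n. c *\<^sub>R f n"]) auto
qed

lemma fin_codim_imp_banach_subspace:
  fixes L :: "'a::real_normed_vector set"
  assumes inf: "infinite_dimensional (UNIV :: 'a set)" and L: "fin_codim L"
  shows "banach_subspace L"
proof -
  obtain B where B: "finite B" "span (L \<union> B) = UNIV" using L by (auto simp: fin_codim_def)
  have "infinite_dimensional L"
    unfolding infinite_dimensional_def
  proof
    assume "\<exists>C. finite C \<and> L \<subseteq> span C"
    then obtain C where C: "finite C" "L \<subseteq> span C" by blast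
    have "L \<union> B \<subseteq> span (C \<union> B)" using C(2) span_mono[of C "C \<union> B"] by (auto intro: span_base)
    then have "span (L \<union> B) \<subseteq> span (C \<union> B)" by (metis span_mono span_span)
    then show False using inf B C(1) unfolding infinite_dimensional_def by (metis finite_UnI)
  qed
  then show ?thesis using L by (auto simp: banach_subspace_def fin_codim_def)
qed

lemma fin_codim_inter_kernels:
  fixes f :: "nat \<Rightarrow> 'a::real_normed_vector \<Rightarrow>\<^sub>L real"
  assumes "fin_codim L"
  shows "fin_codim {x\<in>L. \<forall>k<n. f k x = 0}"
proof (induction n)
  case 0
  then show ?case using assms by simp
next
  case (Suc n)
  have "{x\<in>L. \<forall>k<Suc n. f k x = 0} = {x\<in>{x\<in>L. \<forall>k<n. f k x = 0}. f n x = 0}"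
    by (auto simp: less_Suc_eq)
  then show ?case using fin_codim_inter_kernel[OF Suc finite_rank_functional[of "f n"]] by simp
qed

lemma not_semi_fredholm_small_vector:
  assumes A: "\<not> semi_fredholm A" and M: "fin_codim M" and d: "0 < d"
  obtains x where "x \<in> M" "norm x = 1" "norm (blinfun_apply A x) \<le> d"
proof -
  obtain x where x: "x \<in> M" "norm (A x) < d * norm x"
    using A M d unfolding semi_fredholm_def lower_bound_on_def by (meson not_le)
  have x0: "0 < norm x" using x d by auto
  show thesis
  proof (rule that[of "inverse (norm x) *\<^sub>R x"])
    show "inverse (norm x) *\<^sub>R x \<in> M" using M x by (auto simp: fin_codim_def intro: subspace_scale)
  qed (use x x0 in \<open>auto simp: blinfun.scaleR_right field_simps\<close>)
qed

text \<open>A basic sequence \<open>z n\<close> is built so that its coordinates \<open>a n\<close> satisfy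
  \<open>\<bar>a n\<bar> \<le> 2 ^ n * norm x\<close>, while \<open>norm (A (z n))\<close> decays faster.\<close>

lemma not_semi_fredholm_small_subspace:
  fixes A :: "'a::real_normed_vector \<Rightarrow>\<^sub>L 'a"
  assumes A: "\<not> semi_fredholm A" and L: "fin_codim L" and e: "0 < e"
  obtains Z where "banach_subspace Z" "Z \<subseteq> L" "\<And>x. x \<in> Z \<Longrightarrow> norm (A x) \<le> e * norm x"
proof -
  have "\<forall>z::'a. \<exists>f :: 'a \<Rightarrow>\<^sub>L real. blinfun_apply f z = norm z \<and> norm f \<le> 1"
    using norming_functional by metis
  then obtain nf :: "'a \<Rightarrow> 'a \<Rightarrow>\<^sub>L real" where nf: "\<And>z. blinfun_apply (nf z) z = norm z" "\<And>z. norm (nf z) \<le> 1"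
    by metis
  \<comment> \<open>The norming functionals of earlier vectors kill the later ones, so coordinates
    can be found recursively. Of the two powers of \<open>1/2\<close>, the first cancels the growth
    \<open>2 ^ n\<close> of the coordinates and the second makes the errors sum to at most
    one.\<close>
  define Q where "Q z n x \<longleftrightarrow> x \<in> L \<and> norm x = 1 \<and> norm (A x) \<le> e * ((1/2) ^ n * (1/2) ^ Suc n) \<and>
      (\<forall>k<n. nf (z k) x = 0)" for z :: "nat \<Rightarrow> 'a" and n :: nat and x :: 'a
  have "\<exists>z. \<forall>n. Q z n (z n)"
  proof (rule dependent_wellorder_choice)
    show "Q f x r = Q g x r" if "\<And>y. y < x \<Longrightarrow> f y = g y" for r f g x
      using that by (auto simp: Q_def)
    show "\<exists>r. Q f x r" for x f
      using not_semi_fredholm_small_vector[OF A fin_codim_inter_kernels[OF L, of x "\<lambda>k. nf (f k)"],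
          of "e * ((1/2) ^ x * (1/2) ^ Suc x)"] e
      unfolding Q_def by (auto simp: mult_pos_pos)
  qed
  then obtain z where "\<And>n. Q z n (z n)" by blast
  then have zL: "z n \<in> L" and z1: "norm (z n) = 1" and zA: "norm (A (z n)) \<le> e * ((1/2) ^ n * (1/2) ^ Suc n)"
    and zk: "k < n \<Longrightarrow> nf (z k) (z n) = 0" for n k
    by (auto simp: Q_def)
  have coord: "\<bar>a n\<bar> \<le> 2 ^ n * norm (\<Sum>k<N. a k *\<^sub>R z k)" if "n < N" for a n N
    using that
  proof (induction n rule: less_induct)
    case (less n)
    let ?x = "\<Sum>k<N. a k *\<^sub>R z k"
    have "nf (z n) ?x = (\<Sum>k<N. a k * nf (z n) (z k))" by (simp add: blinfun.sum_right blinfun.scaleR_right)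
    also have "\<dots> = (\<Sum>k<Suc n. a k * nf (z n) (z k))"
      by (rule sum.mono_neutral_right) (use less.prems zk in auto)
    also have "\<dots> = a n + (\<Sum>k<n. a k * nf (z n) (z k))" by (simp add: nf z1)
    finally have "a n = nf (z n) ?x - (\<Sum>k<n. a k * nf (z n) (z k))" by simp
    then have "\<bar>a n\<bar> \<le> \<bar>nf (z n) ?x\<bar> + \<bar>\<Sum>k<n. a k * nf (z n) (z k)\<bar>" by linarith
    also have "\<bar>nf (z n) ?x\<bar> \<le> norm ?x"
      using norm_blinfun[of "nf (z n)" ?x] mult_right_mono[OF nf(2)[of "z n"] norm_ge_zero[of ?x]] by simp
    also have "\<bar>\<Sum>k<n. a k * nf (z n) (z k)\<bar> \<le> (\<Sum>k<n. 2 ^ k * norm ?x)"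
    proof (rule order_trans[OF sum_abs sum_mono])
      fix k assume k: "k \<in> {..<n}"
      have "\<bar>nf (z n) (z k)\<bar> \<le> 1"
        using norm_blinfun[of "nf (z n)" "z k"] nf(2)[of "z n"] z1[of k] by simp
      then have "\<bar>a k * nf (z n) (z k)\<bar> \<le> \<bar>a k\<bar>" by (simp add: abs_mult mult_left_le)
      also have "\<dots> \<le> 2 ^ k * norm ?x" by (rule less.IH) (use k less.prems in auto)
      finally show "\<bar>a k * nf (z n) (z k)\<bar> \<le> 2 ^ k * norm ?x" .
    qed
    \<comment> \<open>The remaining \<open>norm ?x\<close> completes \<open>2 ^ n - 1\<close> to
      \<open>2 ^ n\<close>, which closes the induction.\<close>
    also have "(\<Sum>k<n. 2 ^ k * norm ?x) = (2 ^ n - 1) * norm ?x"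
      by (simp add: sum_distrib_right[symmetric] geometric_sum[of "2::real"])
    finally show ?case by (simp add: algebra_simps)
  qed
  define W where "W = span (range z)"
  have rep: "\<exists>N a. x = (\<Sum>k<N. a k *\<^sub>R z k)" if "x \<in> W" for x
    using that unfolding W_def
  proof (induction rule: span_induct_alt)
    case base
    show ?case by (rule exI[of _ 0]) simp
  next
    case (step c x y)
    then obtain j N a where j: "x = z j" and y: "y = (\<Sum>k<N. a k *\<^sub>R z k)" by blast
    define M where "M = max N (Suc j)"
    have "c *\<^sub>R x = (\<Sum>k<M. (if k = j then c else 0) *\<^sub>R z k)"
    proof -
      have "j < M" by (simp add: M_def)
      then show ?thesis by (simp add: j if_distrib[of "\<lambda>x. x *\<^sub>R _"] cong: if_cong)
    qed
    moreover have "y = (\<Sum>k<M. (if k < N then a k else 0) *\<^sub>R z k)"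
      unfolding y by (rule sum.mono_neutral_cong_left) (auto simp: M_def)
    ultimately have "c *\<^sub>R x + y = (\<Sum>k<M. ((if k = j then c else 0) + (if k < N then a k else 0)) *\<^sub>R z k)"
      by (simp only: scaleR_add_left sum.distrib)
    then show ?case
      by (intro exI[of _ M] exI[of _ "\<lambda>k. (if k = j then c else 0) + (if k < N then a k else 0)"])
  qed
  have bound: "norm (A x) \<le> e * norm x" if "x \<in> W" for x
  proof -
    obtain N a where x: "x = (\<Sum>k<N. a k *\<^sub>R z k)" using rep \<open>x \<in> W\<close> by blast
    have "norm (A x) \<le> (\<Sum>k<N. \<bar>a k\<bar> * norm (A (z k)))"
      unfolding x blinfun.sum_right by (intro sum_norm_le) (simp add: blinfun.scaleR_right)
    also have "\<dots> \<le> (\<Sum>k<N. (2 ^ k * norm x) * (e * ((1/2) ^ k * (1/2) ^ Suc k)))"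
      by (intro sum_mono mult_mono zA) (use coord x in auto)
    also have "\<dots> = (\<Sum>k<N. (e * norm x) * (1/2) ^ Suc k)"
      by (intro sum.cong refl) (simp add: power_divide)
    also have "\<dots> = (e * norm x) * (\<Sum>k<N. (1/2) ^ Suc k)" by (simp only: sum_distrib_left)
    also have "\<dots> \<le> (e * norm x) * 1"
    proof (rule mult_left_mono)
      have "(\<Sum>k<N. (1/2::real) ^ Suc k) = 1 - (1/2) ^ N" by (induction N) auto
      then show "(\<Sum>k<N. (1/2::real) ^ Suc k) \<le> 1" by simp
    qed (use e in auto)
    finally show ?thesis by simp
  qed
  define Z where "Z = closure W"
  have Lc: "subspace L" "closed L" using L by (auto simp: fin_codim_def)
  have "W \<subseteq> L" unfolding W_def by (rule span_minimal) (use zL Lc in auto)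
  then have ZL: "Z \<subseteq> L" unfolding Z_def using Lc(2) by (rule closure_minimal)
  have "closed {x. norm (A x) \<le> e * norm x}" by (intro closed_Collect_le continuous_intros)
  then have "Z \<subseteq> {x. norm (A x) \<le> e * norm x}"
    unfolding Z_def by (intro closure_minimal) (use bound in auto)
  then have Zb: "norm (A x) \<le> e * norm x" if "x \<in> Z" for x using that by auto
  have zZ: "z n \<in> Z" for n
    using closure_subset[of W] by (auto simp: Z_def W_def intro: span_base)
  have "infinite_dimensional Z"
    unfolding infinite_dimensional_def
  proof
    assume "\<exists>C. finite C \<and> Z \<subseteq> span C"
    then obtain C where C: "finite C" "Z \<subseteq> span C" by blast
    define n where "n = Suc (card C)"
    have "inj z"
    proof (rule linorder_injI)
      fix i j :: nat assume "i < j"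
      then show "z i \<noteq> z j" using zk[of i j] nf(1)[of "z i"] z1[of i] by auto
    qed
    then have inj: "inj_on z {..<n}" by (rule inj_on_subset) simp
    have "independent (z ` {..<n})"
    proof (rule independent_if_scalars_zero)
      fix f x assume s: "(\<Sum>x\<in>z ` {..<n}. f x *\<^sub>R x) = 0" and x: "x \<in> z ` {..<n}"
      then obtain i where i: "i < n" "x = z i" by auto
      have "(\<Sum>j<n. f (z j) *\<^sub>R z j) = 0" using s inj by (simp add: sum.reindex)
      then show "f x = 0" using coord[OF i(1), of "\<lambda>j. f (z j)"] i by simp
    qed simp
    moreover have "z ` {..<n} \<subseteq> span C" using zZ C(2) by auto
    ultimately have "card (z ` {..<n}) \<le> card C" using independent_span_bound[OF C(1)] by blast
    then show False unfolding card_image[OF inj] by (simp add: n_def)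
  qed
  then have "banach_subspace Z"
    unfolding banach_subspace_def Z_def W_def by (simp add: subspace_closure)
  then show thesis using ZL Zb by (rule that)
qed

text \<open>Completeness makes the image of \<open>Y\<close> closed, the lower bound makes the
  inverse on it Lipschitz, and a finite spanning set of the image would pull back to one of
  \<open>Y\<close>.\<close>

lemma lower_bound_on_not_strictly_singular:
  fixes A :: "'a::banach \<Rightarrow>\<^sub>L 'a"
  assumes Y: "banach_subspace Y" and c: "lower_bound_on Y c A"
  shows "\<not> strictly_singular A"
proof -
  have c: "0 < c" "\<And>x. x \<in> Y \<Longrightarrow> c * norm x \<le> norm (A x)" using c by (auto simp: lower_bound_on_def)
  have Ys: "subspace Y" "closed Y" "infinite_dimensional Y" using Y by (auto simp: banach_subspace_def)
  have inj: "x = y" if "x \<in> Y" "y \<in> Y" "A x = A y" for x y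
    using c(2)[of "x - y"] c(1) that Ys(1) by (simp add: blinfun.diff_right subspace_diff mult_le_0_iff)
  define Z where "Z = A ` Y"
  define g where "g = the_inv_into Y (blinfun_apply A)"
  have injA: "inj_on (blinfun_apply A) Y" using inj by (auto intro: inj_onI)
  have g: "g (A x) = x" if "x \<in> Y" for x unfolding g_def by (rule the_inv_into_f_f[OF injA that])
  have "complete Z"
    unfolding Z_def
    by (rule complete_isometric_image[OF c(1) Ys(1)])
      (use c(2) Ys(2) in \<open>auto simp: blinfun.bounded_linear_right complete_eq_closed\<close>)
  then have Zc: "closed Z" by (simp add: complete_eq_closed)
  have Zsub: "subspace Z" unfolding Z_def by (rule linear_subspace_image[OF linear_blinfun Ys(1)])
  have "infinite_dimensional Z"
    unfolding infinite_dimensional_def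
  proof
    assume "\<exists>C. finite C \<and> Z \<subseteq> span C"
    then obtain C where C: "finite C" "Z \<subseteq> span C" by blast
    obtain D where D: "D \<subseteq> Z" "independent D" "Z \<subseteq> span D" using basis_exists[of Z] by metis
    have finD: "finite D" using independent_span_bound[OF C(1) D(2)] D(1) C(2) by auto
    have AgD: "A ` (g ` D) = D" using D(1) g by (force simp: Z_def)
    have gDY: "g ` D \<subseteq> Y" using D(1) g by (force simp: Z_def)
    have "Y \<subseteq> span (g ` D)"
    proof
      fix x assume x: "x \<in> Y"
      have "A x \<in> span (A ` (g ` D))" using D(3) x unfolding AgD by (auto simp: Z_def)
      also have "span (A ` (g ` D)) = A ` span (g ` D)" by (rule linear_span_image[OF linear_blinfun])
      finally obtain y where y: "y \<in> span (g ` D)" "A x = A y" by auto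
      moreover have "y \<in> Y" using y(1) span_minimal[OF gDY Ys(1)] by blast
      ultimately show "x \<in> span (g ` D)" using inj x by metis
    qed
    then show False using Ys(3) finD unfolding infinite_dimensional_def by blast
  qed
  then have ZB: "banach_subspace Z" using Zc Zsub by (simp add: banach_subspace_def)
  have "homeomorphism Y Z (blinfun_apply A) g"
    unfolding homeomorphism_def
  proof (intro conjI ballI)
    show "g ` Z = Y" using g by (force simp: Z_def)
    show "continuous_on Y (blinfun_apply A)" by (intro continuous_intros)
    show "continuous_on Z g"
    proof (rule continuous_onI)
      fix w e assume w: "w \<in> Z" and e: "0 < (e::real)"
      have "dist (g w') (g w) \<le> e" if w': "w' \<in> Z" "dist w' w < c * e" for w'
      proof -
        obtain y y' where y: "y \<in> Y" "w = A y" "y' \<in> Y" "w' = A y'" using w w'(1) unfolding Z_def by blast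
        have "c * norm (y' - y) \<le> norm (A (y' - y))" by (rule c(2)) (use y Ys(1) in \<open>auto intro: subspace_diff\<close>)
        also have "\<dots> < c * e" using w'(2) y by (simp add: dist_norm blinfun.diff_right)
        finally show ?thesis using c(1) y g by (simp add: dist_norm)
      qed
      then show "\<exists>d>0. \<forall>x'\<in>Z. dist x' w < d \<longrightarrow> dist (g x') (g w) \<le> e"
        using c(1) e by (intro exI[of _ "c * e"]) auto
    qed
  qed (use g in \<open>auto simp: Z_def\<close>)
  then show ?thesis using Y ZB by (auto simp: strictly_singular_def)
qed

lemma not_strictly_singular_lower_bound:
  assumes "\<not> strictly_singular A"
  obtains Y c where "banach_subspace Y" "lower_bound_on Y c A"
proof -
  obtain Y Z g where Y: "banach_subspace Y" "banach_subspace Z" "homeomorphism Y Z (blinfun_apply A) g"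
    using assms by (auto simp: strictly_singular_def)
  have sub: "subspace Y" using Y(1) by (simp add: banach_subspace_def)
  have g: "\<And>y. y \<in> Y \<Longrightarrow> g (A y) = y" "\<And>y. y \<in> Y \<Longrightarrow> A y \<in> Z" "continuous_on Z g"
    using Y(3) by (auto simp: homeomorphism_def)
  have 0: "0 \<in> Z" "g 0 = 0" using g(1,2)[of 0] subspace_0[OF sub] by auto
  obtain d where d: "0 < d" "\<And>w. w \<in> Z \<Longrightarrow> norm w < d \<Longrightarrow> norm (g w) < 1"
  proof -
    have "\<exists>d>0. \<forall>w\<in>Z. dist w 0 < d \<longrightarrow> dist (g w) (g 0) < 1"
    proof -
      have "\<forall>e>0. \<exists>d>0. \<forall>w\<in>Z. dist w 0 < d \<longrightarrow> dist (g w) (g 0) < e"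
        using g(3) 0(1) unfolding continuous_on_iff by (rule bspec)
      from this[rule_format, of 1] show ?thesis by simp
    qed
    then show thesis using that 0(2) by auto
  qed
  have "d / 2 * norm y \<le> norm (A y)" if y: "y \<in> Y" for y
  proof (cases "A y = 0")
    case True
    then show ?thesis using g(1)[OF y] 0 by simp
  next
    case False
    define r where "r = d / (2 * norm (A y))"
    have r: "0 < r" using d False by (simp add: r_def)
    have ry: "r *\<^sub>R y \<in> Y" using y sub by (rule subspace_scale[rotated])
    have "norm (A (r *\<^sub>R y)) < d" using r d False by (simp add: blinfun.scaleR_right r_def)
    then have "norm (g (A (r *\<^sub>R y))) < 1" using d(2) g(2)[OF ry] by blast
    then have "norm (r *\<^sub>R y) < 1" using g(1)[OF ry] by simp
    then show ?thesis using r False d by (simp add: r_def field_simps)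
  qed
  then have "lower_bound_on Y (d / 2) A" using d by (auto simp: lower_bound_on_def)
  with Y(1) show thesis by (rule that)
qed

section \<open>Indecomposability and the Fredholm dichotomy\<close>

locale hi_banach =
  fixes X :: "'a::banach itself"
  assumes inf_dim: "infinite_dimensional (UNIV :: 'a set)"
    and hi: "hereditarily_indecomposable TYPE('a)"
begin

text \<open>Where \<open>A\<close> stretches \<open>Y\<close> by at least \<open>c\<close> and some
  \<open>Z\<close> by at most \<open>c / 2\<close>, vectors of \<open>Y\<close> and \<open>Z\<close>
  cannot nearly cancel: \<open>norm y \<le> K * norm (y + z)\<close>. Hence the sum of
  \<open>Y\<close> and \<open>Z\<close> is direct and closed, which indecomposability
  forbids.\<close>

lemma not_strictly_singular_imp_semi_fredholm:
  fixes A :: "'a \<Rightarrow>\<^sub>L 'a"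
  assumes "\<not> strictly_singular A"
  shows "semi_fredholm A"
proof (rule ccontr)
  assume nsf: "\<not> semi_fredholm A"
  obtain Y c where Y: "banach_subspace Y" and c: "lower_bound_on Y c A"
    using not_strictly_singular_lower_bound[OF assms] .
  have c: "0 < c" "\<And>x. x \<in> Y \<Longrightarrow> c * norm x \<le> norm (A x)" using c by (auto simp: lower_bound_on_def)
  obtain Z where Z: "banach_subspace Z" "\<And>x. x \<in> Z \<Longrightarrow> norm (A x) \<le> c / 2 * norm x"
    using not_semi_fredholm_small_subspace[OF nsf fin_codim_UNIV, of "c / 2"] c(1) by (metis half_gt_zero)
  have Ys: "subspace Y" "closed Y" and Zs: "subspace Z" "closed Z"
    using Y Z by (auto simp: banach_subspace_def)
  define K where "K = 2 / c * norm A + 1"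
  have K: "1 \<le> K" using c(1) by (simp add: K_def)
  have yb: "norm y \<le> K * norm (y + z)" if yz: "y \<in> Y" "z \<in> Z" for y z
  proof -
    have "c * norm y \<le> norm (A y)" by (rule c(2)[OF yz(1)])
    also have "\<dots> \<le> norm (A (y + z)) + norm (A z)"
      using norm_triangle_ineq4[of "A (y + z)" "A z"] by (simp add: blinfun.add_right)
    also have "\<dots> \<le> norm A * norm (y + z) + c / 2 * norm z" by (intro add_mono norm_blinfun Z(2) yz)
    also have "norm z \<le> norm (y + z) + norm y" using norm_triangle_ineq4[of "y + z" y] by simp
    finally have "c * norm y \<le> norm A * norm (y + z) + c / 2 * (norm (y + z) + norm y)"
      using c(1) by simp
    then have "c / 2 * norm y \<le> (norm A + c / 2) * norm (y + z)" by (simp add: algebra_simps)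
    then show ?thesis using c(1) by (simp add: K_def field_simps)
  qed
  have "Y \<inter> Z = {0}"
  proof
    show "Y \<inter> Z \<subseteq> {0}"
    proof
      fix x assume x: "x \<in> Y \<inter> Z"
      then have "- x \<in> Z" using Zs by (auto intro: subspace_neg)
      then show "x \<in> {0}" using yb[of x "- x"] x by simp
    qed
  qed (use Ys Zs in \<open>auto intro: subspace_0\<close>)
  moreover have "closed {y + z | y z. y \<in> Y \<and> z \<in> Z}"
  proof -
    \<comment> \<open>Addition on \<open>Y \<times> Z\<close> is bounded below by the previous
      estimate, so it carries completeness to the sum.\<close>
    have "complete ((\<lambda>p. fst p + snd p) ` (Y \<times> Z))"
    proof (rule complete_isometric_image[of "1 / (2 * K + 1)"])
      show "subspace (Y \<times> Z)" by (rule subspace_Times) fact+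
      show "bounded_linear (\<lambda>p :: 'a \<times> 'a. fst p + snd p)" by (intro bounded_linear_intros)
      show "complete (Y \<times> Z)" using Ys Zs by (simp add: complete_eq_closed closed_Times)
      show "\<forall>x\<in>Y \<times> Z. 1 / (2 * K + 1) * norm x \<le> norm (fst x + snd x)"
      proof clarify
        fix y z assume yz: "y \<in> Y" "z \<in> Z"
        have "norm (y, z) \<le> norm y + norm z" by (rule norm_Pair_le)
        also have "norm z \<le> norm (y + z) + norm y" using norm_triangle_ineq4[of "y + z" y] by simp
        finally have "norm (y, z) \<le> (2 * K + 1) * norm (y + z)" using yb[OF yz] by (simp add: algebra_simps)
        then show "1 / (2 * K + 1) * norm (y, z) \<le> norm (fst (y, z) + snd (y, z))"
          using K by (simp add: field_simps)
      qed
    qed (use K in auto)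
    moreover have "(\<lambda>p. fst p + snd p) ` (Y \<times> Z) = {y + z | y z. y \<in> Y \<and> z \<in> Z}" by force
    ultimately show ?thesis by (simp add: complete_eq_closed)
  qed
  ultimately show False using hi Y Z(1) unfolding hereditarily_indecomposable_def by blast
qed

lemma strictly_singular_iff_not_semi_fredholm:
  fixes A :: "'a \<Rightarrow>\<^sub>L 'a"
  shows "strictly_singular A \<longleftrightarrow> \<not> semi_fredholm A"
  using not_strictly_singular_imp_semi_fredholm[of A] lower_bound_on_not_strictly_singular
    fin_codim_imp_banach_subspace[OF inf_dim] unfolding semi_fredholm_def by blast

text \<open>If the sum were bounded below on some \<open>L\<close> of finite codimension,
  \<open>A\<close> would be small on an infinite-dimensional \<open>Z\<close> inside
  \<open>L\<close>, leaving \<open>B\<close> bounded below on \<open>Z\<close>. This is why the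
  small subspace is found inside a prescribed \<open>L\<close>.\<close>

lemma strictly_singular_add:
  fixes A B :: "'a \<Rightarrow>\<^sub>L 'a"
  assumes "strictly_singular A" "strictly_singular B"
  shows "strictly_singular (A + B)"
proof (rule ccontr)
  assume "\<not> strictly_singular (A + B)"
  then have "semi_fredholm (A + B)" by (rule not_strictly_singular_imp_semi_fredholm)
  then obtain L c where L: "fin_codim L" and c: "lower_bound_on L c (A + B)" by (auto simp: semi_fredholm_def)
  have c: "0 < c" "\<And>x. x \<in> L \<Longrightarrow> c * norm x \<le> norm ((A + B) x)" using c by (auto simp: lower_bound_on_def)
  have nsf: "\<not> semi_fredholm A" using assms(1) by (simp add: strictly_singular_iff_not_semi_fredholm)
  obtain Z where Z: "banach_subspace Z" "Z \<subseteq> L" "\<And>x. x \<in> Z \<Longrightarrow> norm (A x) \<le> c / 2 * norm x"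
    using not_semi_fredholm_small_subspace[OF nsf L, of "c / 2"] c(1) by (metis half_gt_zero)
  have "c / 2 * norm x \<le> norm (B x)" if x: "x \<in> Z" for x
    using c(2)[of x] Z(2,3) x norm_triangle_ineq[of "A x" "B x"] by (force simp: blinfun.add_left)
  then have "lower_bound_on Z (c / 2) B" using c(1) by (auto simp: lower_bound_on_def)
  then show False using lower_bound_on_not_strictly_singular[OF Z(1)] assms(2) by blast
qed

lemma strictly_singular_scaleR:
  fixes A :: "'a \<Rightarrow>\<^sub>L 'a"
  assumes "strictly_singular A"
  shows "strictly_singular (r *\<^sub>R A)"
proof (rule ccontr)
  assume "\<not> strictly_singular (r *\<^sub>R A)"
  then obtain Y c where Y: "banach_subspace Y" and c: "lower_bound_on Y c (r *\<^sub>R A)"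
    using not_strictly_singular_lower_bound by blast
  have c: "0 < c" "\<And>x. x \<in> Y \<Longrightarrow> c * norm x \<le> \<bar>r\<bar> * norm (A x)"
    using c by (auto simp: lower_bound_on_def blinfun.scaleR_left)
  have "r \<noteq> 0"
  proof
    assume "r = 0"
    then have "Y \<subseteq> span {}" using c by (force simp: mult_le_0_iff)
    then show False using Y unfolding banach_subspace_def infinite_dimensional_def by blast
  qed
  then have "lower_bound_on Y (c / \<bar>r\<bar>) A"
    using c by (auto simp: lower_bound_on_def field_simps)
  then show False using lower_bound_on_not_strictly_singular[OF Y] assms by blast
qed

lemma strictly_singular_zero: "strictly_singular (0 :: 'a \<Rightarrow>\<^sub>L 'a)"
proof (rule ccontr)
  assume "\<not> ?thesis"
  then obtain Y c where Y: "banach_subspace Y" and c: "lower_bound_on Y c (0 :: 'a \<Rightarrow>\<^sub>L 'a)"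
    using not_strictly_singular_lower_bound by blast
  then have "Y \<subseteq> span {}" by (force simp: lower_bound_on_def mult_le_0_iff)
  then show False using Y unfolding banach_subspace_def infinite_dimensional_def by blast
qed

lemma strictly_singular_uminus:
  fixes A :: "'a \<Rightarrow>\<^sub>L 'a"
  shows "strictly_singular A \<Longrightarrow> strictly_singular (- A)"
  using strictly_singular_scaleR[of A "-1"] by simp

lemma strictly_singular_diff:
  fixes A B :: "'a \<Rightarrow>\<^sub>L 'a"
  shows "strictly_singular A \<Longrightarrow> strictly_singular B \<Longrightarrow> strictly_singular (A - B)"
  using strictly_singular_add[of A "- B"] strictly_singular_uminus[of B] by simp

lemma Fred0_imp_not_strictly_singular:
  fixes A :: "'a \<Rightarrow>\<^sub>L 'a"
  shows "Fred0 A \<Longrightarrow> \<not> strictly_singular A"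
  using Fred0_imp_semi_fredholm strictly_singular_iff_not_semi_fredholm by blast

lemma connected_segment:
  fixes A B :: "'b::real_normed_vector"
  shows "connected ((\<lambda>s::real. (1 - s) *\<^sub>R A + s *\<^sub>R B) ` {0..1})"
  by (intro connected_continuous_image continuous_intros) simp

text \<open>At most one of the two segments from \<open>A\<close> to \<open>id_blinfun\<close> and to
  \<open>- id_blinfun\<close> meets the strictly singular operators.\<close>

lemma semi_fredholm_imp_Fred0:
  fixes A :: "'a \<Rightarrow>\<^sub>L 'a"
  assumes A: "semi_fredholm A"
  shows "Fred0 A"
proof -
  define p where "p u s = (1 - s) *\<^sub>R A + s *\<^sub>R (u *\<^sub>R id_blinfun)" for u s :: real
  have *: "Fred0 A" if u: "u \<noteq> 0" and sf: "\<And>s. s \<in> {0..1} \<Longrightarrow> semi_fredholm (p u s)" for u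
  proof (rule Fred0_connected[OF connected_segment[of A "u *\<^sub>R id_blinfun"]])
    show "Fred0 (u *\<^sub>R id_blinfun :: 'a \<Rightarrow>\<^sub>L 'a)" using u by (intro GL_imp_Fred0 GL_scaleR) auto
    show "u *\<^sub>R id_blinfun \<in> (\<lambda>s. (1 - s) *\<^sub>R A + s *\<^sub>R u *\<^sub>R id_blinfun) ` {0..1}"
      by (rule image_eqI[of _ _ 1]) auto
    show "A \<in> (\<lambda>s. (1 - s) *\<^sub>R A + s *\<^sub>R u *\<^sub>R id_blinfun) ` {0..1}"
      by (rule image_eqI[of _ _ 0]) auto
  qed (use sf in \<open>auto simp: p_def\<close>)
  show ?thesis
  proof (cases "\<forall>s\<in>{0..1}. semi_fredholm (p 1 s)")
    case True
    then show ?thesis using *[of 1] by auto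
  next
    case False
    then obtain s where s: "0 \<le> s" "s \<le> 1" "\<not> semi_fredholm (p 1 s)" by auto
    have "s \<noteq> 0" using s(3) A by (auto simp: p_def)
    moreover have "semi_fredholm (id_blinfun :: 'a \<Rightarrow>\<^sub>L 'a)" by (intro Fred0_imp_semi_fredholm GL_imp_Fred0 GL_id)
    then have "s \<noteq> 1" using s(3) by (auto simp: p_def)
    ultimately have s01: "0 < s" "s < 1" using s by auto
    have ss: "strictly_singular (p 1 s)" using s(3) by (simp add: strictly_singular_iff_not_semi_fredholm)
    show ?thesis
    proof (rule *[of "-1"])
      fix r :: real assume r: "r \<in> {0..1}"
      show "semi_fredholm (p (-1) r)"
      proof (rule ccontr)
        assume "\<not> ?thesis"
        then have "strictly_singular (p (-1) r)" by (simp add: strictly_singular_iff_not_semi_fredholm)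
        \<comment> \<open>The weights cancel \<open>A\<close> and leave a multiple of the identity
          with a positive coefficient.\<close>
        then have "strictly_singular ((1 - r) *\<^sub>R p 1 s - (1 - s) *\<^sub>R p (-1) r)"
          by (intro strictly_singular_diff strictly_singular_scaleR ss)
        also have "(1 - r) *\<^sub>R p 1 s - (1 - s) *\<^sub>R p (-1) r = ((1 - r) * s + (1 - s) * r) *\<^sub>R id_blinfun"
          by (simp add: p_def scaleR_add_right scaleR_add_left scaleR_diff_right mult.commute)
        finally have ss2: "strictly_singular (((1 - r) * s + (1 - s) * r) *\<^sub>R id_blinfun :: 'a \<Rightarrow>\<^sub>L 'a)" .
        have "(1 - r) * s + (1 - s) * r > 0"
        proof (cases "r = 0")
          case False
          then show ?thesis using r s01 by (intro add_nonneg_pos mult_nonneg_nonneg mult_pos_pos) auto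
        qed (use s01 in auto)
        then have "Fred0 (((1 - r) * s + (1 - s) * r) *\<^sub>R id_blinfun :: 'a \<Rightarrow>\<^sub>L 'a)"
          by (intro GL_imp_Fred0 GL_scaleR) auto
        then show False using ss2 Fred0_imp_not_strictly_singular by blast
      qed
    qed simp
  qed
qed

lemma Fred0_iff_not_strictly_singular:
  fixes A :: "'a \<Rightarrow>\<^sub>L 'a"
  shows "Fred0 A \<longleftrightarrow> \<not> strictly_singular A"
  using semi_fredholm_imp_Fred0 Fred0_imp_not_strictly_singular strictly_singular_iff_not_semi_fredholm by blast

end

subsection \<open>Isolated singular points and finite ascent\<close>

primrec bpow :: "('a::real_normed_vector \<Rightarrow>\<^sub>L 'a) \<Rightarrow> nat \<Rightarrow> ('a \<Rightarrow>\<^sub>L 'a)" where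
  "bpow A 0 = id_blinfun"
| "bpow A (Suc n) = A o\<^sub>L bpow A n"

lemma bpow_apply: "blinfun_apply (bpow A n) = (blinfun_apply A ^^ n)"
  by (induction n) (auto simp: fun_eq_iff)

lemma norm_bpow_apply_le: "norm (bpow A n x) \<le> norm A ^ n * norm x"
proof (induction n)
  case (Suc n)
  have "norm (bpow A (Suc n) x) \<le> norm A * norm (bpow A n x)" by (simp add: norm_blinfun)
  also have "\<dots> \<le> norm A * (norm A ^ n * norm x)" by (intro mult_left_mono Suc) simp
  finally show ?case by (simp add: mult.assoc)
qed simp

lemma Fred0_bpow: "Fred0 A \<Longrightarrow> Fred0 (bpow A n)"
  by (induction n) (auto intro: GL_imp_Fred0 Fred0_compose)

text \<open>The Neumann series for the inverse of \<open>U - e\<close> in powers of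
  \<open>e\<close>, tested against a functional and a vector so that only a scalar series
  remains.\<close>

lemma resolvent_power_series:
  fixes U :: "'a::banach \<Rightarrow>\<^sub>L 'a" and f :: "'a \<Rightarrow>\<^sub>L real"
  assumes U: "U \<in> GL" and e: "\<bar>e\<bar> * norm (binv U) < 1" and G: "U -\<^sub>I e \<in> GL"
  shows "(\<lambda>n. f (binv U (bpow (binv U) n v)) * e ^ n) sums f (binv (U -\<^sub>I e) v)"
proof -
  define W where "W = binv U"
  define s where "s n = e ^ n *\<^sub>R bpow W n v" for n
  have "norm (s n) \<le> norm v * (\<bar>e\<bar> * norm W) ^ n" for n
  proof -
    have "norm (s n) \<le> \<bar>e\<bar> ^ n * (norm W ^ n * norm v)"
      unfolding s_def norm_scaleR power_abs by (intro mult_left_mono norm_bpow_apply_le) auto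
    then show ?thesis by (simp add: power_mult_distrib mult_ac)
  qed
  moreover have "summable (\<lambda>n. norm v * (\<bar>e\<bar> * norm W) ^ n)"
    by (intro summable_mult summable_geometric) (use e in \<open>simp add: W_def\<close>)
  ultimately have sm: "summable s" by (rule summable_comparison_test'[where N = 0, rotated])
  define S where "S = suminf s"
  have sS: "s sums S" using sm by (simp add: S_def summable_sums)
  have "(\<lambda>n. s (Suc n)) sums (S - s 0)" using sS by (simp add: sums_Suc_iff)
  moreover have "s (Suc n) = e *\<^sub>R W (s n)" for n by (simp add: s_def blinfun.scaleR_right)
  ultimately have 1: "(\<lambda>n. e *\<^sub>R W (s n)) sums (S - v)" by (simp add: s_def)
  have WS: "(\<lambda>n. W (s n)) sums W S" by (rule bounded_linear.sums[OF blinfun.bounded_linear_right sS])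
  then have "(\<lambda>n. e *\<^sub>R W (s n)) sums (e *\<^sub>R W S)" by (rule sums_scaleR_right)
  then have eW: "e *\<^sub>R W S = S - v" using 1 sums_unique2 by blast
  have "(U -\<^sub>I e) (W S) = v"
    using U by (simp add: blinfun.diff_left blinfun.scaleR_left eW) (simp add: W_def)
  then have "binv (U -\<^sub>I e) v = W S" using G by (metis binv_apply(2))
  moreover have "(\<lambda>n. f (W (s n))) sums f (W S)"
    by (rule bounded_linear.sums[OF blinfun.bounded_linear_right WS])
  ultimately show ?thesis by (simp add: s_def blinfun.scaleR_right W_def mult.commute)
qed

text \<open>The space is real, but the scalar power series converges on the complex disc of the same
  radius. Complexifying such entries, rather than the space, is enough to use the theory of zeros of
  holomorphic functions.\<close>

lemma resolvent_holomorphic: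
  fixes U :: "'a::banach \<Rightarrow>\<^sub>L 'a" and f :: "'a \<Rightarrow>\<^sub>L real"
  assumes U: "U \<in> GL" and r: "r * norm (binv U) < 1" and G: "\<And>e. \<bar>e\<bar> < r \<Longrightarrow> U -\<^sub>I e \<in> GL"
  obtains \<phi> :: "complex \<Rightarrow> complex" where "\<phi> holomorphic_on ball 0 r"
    "\<And>e. \<bar>e\<bar> < r \<Longrightarrow> \<phi> (of_real e) = of_real (f (binv (U -\<^sub>I e) v))"
proof -
  define c where "c n = f (binv U (bpow (binv U) n v))" for n
  have sms: "(\<lambda>n. c n * e ^ n) sums f (binv (U -\<^sub>I e) v)" if "\<bar>e\<bar> < r" for e
  proof -
    have "\<bar>e\<bar> * norm (binv U) \<le> r * norm (binv U)" using that by (intro mult_right_mono) auto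
    then show ?thesis unfolding c_def using resolvent_power_series[OF U _ G[OF that], of f v] r by simp
  qed
  define \<phi> where "\<phi> z = (\<Sum>n. complex_of_real (c n) * (z - 0) ^ n)" for z
  have sm: "summable (\<lambda>n. complex_of_real (c n) * (z - 0) ^ n)" if z: "z \<in> ball 0 r" for z
  proof -
    obtain \<rho> where \<rho>: "norm z < \<rho>" "\<rho> < r" using z dense by auto
    then have "summable (\<lambda>n. c n * \<rho> ^ n)" using sms[of \<rho>] norm_ge_zero[of z] by (auto dest: sums_summable)
    then have "summable (\<lambda>n. complex_of_real (c n * \<rho> ^ n))" by (rule summable_of_real)
    then have "summable (\<lambda>n. complex_of_real (c n) * of_real \<rho> ^ n)" by simp
    then show ?thesis
      using powser_inside[of "\<lambda>n. complex_of_real (c n)" "of_real \<rho>" z] \<rho> norm_ge_zero[of z] by simp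
  qed
  show thesis
  proof (rule that[of \<phi>])
    show "\<phi> holomorphic_on ball 0 r"
    proof (rule power_series_holomorphic)
      fix z :: complex assume "z \<in> ball 0 r"
      then show "(\<lambda>n. complex_of_real (c n) * (z - 0) ^ n) sums \<phi> z"
        unfolding \<phi>_def using sm by (intro summable_sums)
    qed
    fix e :: real assume e: "\<bar>e\<bar> < r"
    have "(\<lambda>n. complex_of_real (c n * e ^ n)) sums of_real (f (binv (U -\<^sub>I e) v))"
      using sms[OF e] by (rule sums_of_real)
    then show "\<phi> (of_real e) = of_real (f (binv (U -\<^sub>I e) v))"
      unfolding \<phi>_def by (simp add: sums_iff)
  qed
qed

lemma of_real_ndet:
  "of_real (ndet n M) = (ndet n (\<lambda>i j. of_real (M i j)) :: complex)"
  unfolding ndet_leibniz by (simp add: of_real_sum of_real_prod)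

lemma holomorphic_on_ndet:
  fixes M :: "complex \<Rightarrow> nat \<Rightarrow> nat \<Rightarrow> complex"
  assumes "\<And>i j. i < n \<Longrightarrow> j < n \<Longrightarrow> (\<lambda>z. M z i j) holomorphic_on S"
  shows "(\<lambda>z. ndet n (M z)) holomorphic_on S"
proof -
  have "(\<lambda>z. M z i (p i)) holomorphic_on S" if "p permutes {0..<n}" "i \<in> {0..<n}" for p i
    using permutes_in_image[OF that(1), of i] that(2) by (intro assms) auto
  then show ?thesis
    unfolding ndet_leibniz by (intro holomorphic_intros) auto
qed

text \<open>Near \<open>0\<close> the function is \<open>z ^ m\<close> times a function not
  vanishing at \<open>0\<close>; the value at \<open>z0\<close> excludes the zero function, and
  \<open>m = 0\<close> covers the case \<open>D 0 \<noteq> 0\<close>.\<close>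

lemma holomorphic_order_lower_bound:
  assumes D: "D holomorphic_on ball 0 r" and r: "0 < r" and nz: "z0 \<in> ball 0 r" "D z0 \<noteq> 0"
  obtains m c r' where "0 < c" "0 < r'" "r' \<le> r" "\<And>z. norm z < r' \<Longrightarrow> c * norm z ^ m \<le> norm (D z)"
proof -
  obtain g m r1 where g: "0 < r1" "r1 \<le> r" "g holomorphic_on ball 0 r1" "g 0 \<noteq> 0"
    "\<And>w. w \<in> ball 0 r1 \<Longrightarrow> D w = w ^ m * g w"
  proof (cases "D 0 = 0")
    case True
    have nc: "\<not> D constant_on ball 0 r" using nz r True unfolding constant_on_def by (metis centre_in_ball)
    have c: "0 \<in> ball (0::complex) r" using r by simp
    obtain g r1 n where "0 < n" "0 < r1" "ball (0::complex) r1 \<subseteq> ball 0 r" "g holomorphic_on ball 0 r1"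
      "\<And>w. w \<in> ball 0 r1 \<Longrightarrow> D w = (w - 0) ^ n * g w" "\<And>w. w \<in> ball 0 r1 \<Longrightarrow> g w \<noteq> 0"
      by (rule holomorphic_factor_zero_nonconstant[OF D open_ball connected_ball c True nc]) (rule that, assumption+)
    then show thesis by (intro that[of r1 g n]) (auto simp: ball_subset_ball_iff)
  next
    case False
    then show thesis by (intro that[of r D 0]) (use r D in auto)
  qed
  have "continuous_on (ball 0 r1) g" using g(3) by (rule holomorphic_on_imp_continuous_on)
  then have "isCont g 0" using g(1) by (simp add: continuous_on_eq_continuous_at)
  then obtain d where d: "0 < d" "\<And>z. norm z < d \<Longrightarrow> norm (g z - g 0) < norm (g 0) / 2"
  proof -
    have "\<exists>d>0. \<forall>x. dist x 0 < d \<longrightarrow> dist (g x) (g 0) < norm (g 0) / 2"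
      using \<open>isCont g 0\<close>[unfolded continuous_at_eps_delta, rule_format, of "norm (g 0) / 2"] g(4) by simp
    then show thesis using that by (auto simp: dist_norm)
  qed
  show thesis
  proof (rule that[of "norm (g 0) / 2" "min d r1" m])
    fix z :: complex assume z: "norm z < min d r1"
    have "norm (g 0) / 2 \<le> norm (g z)"
      using d(2)[of z] z norm_triangle_ineq2[of "g 0" "g z"] by (simp add: norm_minus_commute)
    then have "norm (g 0) / 2 * norm z ^ m \<le> norm (g z) * norm z ^ m" by (rule mult_right_mono) simp
    then show "norm (g 0) / 2 * norm z ^ m \<le> norm (D z)"
      using z by (simp add: g(5) norm_mult norm_power mult.commute)
  qed (use g d in auto)
qed

text \<open>If \<open>U\<close> is invertible and \<open>A - U\<close> has finite rank, then \<open>det ((A - e) (U - e)\<inverse>)\<close> extends to a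
  holomorphic function of \<open>e\<close> near \<open>0\<close>, which vanishes identically or to finite order.\<close>

lemma Fred0_shift_dichotomy:
  fixes A :: "'a::banach \<Rightarrow>\<^sub>L 'a"
  assumes "Fred0 A"
  obtains r where "0 < r" "\<And>e. \<bar>e\<bar> < r \<Longrightarrow> A -\<^sub>I e \<notin> GL"
  | r m c where "0 < r" "0 < c" "\<And>e. 0 < \<bar>e\<bar> \<Longrightarrow> \<bar>e\<bar> < r \<Longrightarrow> A -\<^sub>I e \<in> GL"
      "\<And>e x. 0 < \<bar>e\<bar> \<Longrightarrow> \<bar>e\<bar> < r \<Longrightarrow> c * \<bar>e\<bar> ^ m * norm x \<le> norm ((A -\<^sub>I e) x)"
proof -
  obtain U where U: "U \<in> GL" "finite_rank (A - U)" using assms by (auto simp: Fred0_def)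
  obtain n f v where F: "A - U = (\<Sum>i<(n::nat). rank1 (f i) (v i))" using finite_rank_representation[OF U(2)] .
  obtain r0 where r0: "0 < r0" "\<And>B. norm (B - U) < r0 \<Longrightarrow> B \<in> GL" "\<And>B. norm (B - U) < r0 \<Longrightarrow> norm (binv B) \<le> inverse r0"
    using GL_near[OF U(1)] by blast
  define Ue where "Ue e = U -\<^sub>I e" for e :: real
  \<comment> \<open>One radius for two purposes: \<open>U - e\<close> stays invertible with inverse
    at most \<open>inverse r0\<close>, and the Neumann series converges.\<close>
  define r where "r = min r0 (inverse (norm (binv U) + 1))"
  have p: "norm (binv U) + 1 > 0" using norm_ge_zero[of "binv U"] by linarith
  have r: "0 < r" using r0(1) p by (simp add: r_def)
  have "r * norm (binv U) \<le> inverse (norm (binv U) + 1) * norm (binv U)" by (intro mult_right_mono) (auto simp: r_def)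
  also have "\<dots> < 1" using p by (simp add: field_simps)
  finally have r1: "r * norm (binv U) < 1" .
  have id_le: "norm (e *\<^sub>R id_blinfun :: 'a \<Rightarrow>\<^sub>L 'a) \<le> \<bar>e\<bar>" for e
    by (rule norm_blinfun_bound) (auto simp: blinfun.scaleR_left)
  have near: "norm (Ue e - U) < r0" if "\<bar>e\<bar> < r" for e
    using id_le[of e] that by (simp add: Ue_def r_def)
  have Ge: "Ue e \<in> GL" and Be: "norm (binv (Ue e)) \<le> inverse r0" if "\<bar>e\<bar> < r" for e
    using r0 near[OF that] by auto
  define d where "d e = rep_det n (\<lambda>i. f i o\<^sub>L binv (Ue e)) v" for e
  have comp: "(A -\<^sub>I e) o\<^sub>L binv (Ue e) = id_blinfun + (\<Sum>i<n. rank1 (f i o\<^sub>L binv (Ue e)) (v i))"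
    if "\<bar>e\<bar> < r" for e
  proof (rule blinfun_eqI)
    fix x
    have "A y = U y + (\<Sum>i<n. rank1 (f i) (v i)) y" for y
      using F by (metis blinfun.diff_left add_diff_cancel_left' add_diff_eq)
    then have "(A -\<^sub>I e) y = Ue e y + (\<Sum>i<n. f i y *\<^sub>R v i)" for y
      by (simp add: Ue_def blinfun.diff_left blinfun_sum_apply)
    then show "((A -\<^sub>I e) o\<^sub>L binv (Ue e)) x = (id_blinfun + (\<Sum>i<n. rank1 (f i o\<^sub>L binv (Ue e)) (v i))) x"
      using Ge[OF that] by (simp add: blinfun.add_left blinfun_sum_apply)
  qed
  have eq: "A -\<^sub>I e = ((A -\<^sub>I e) o\<^sub>L binv (Ue e)) o\<^sub>L Ue e" if "\<bar>e\<bar> < r" for e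
    using Ge[OF that] by (intro blinfun_eqI) simp
  have zero: "A -\<^sub>I e \<notin> GL" if e: "\<bar>e\<bar> < r" and "d e = 0" for e
  proof
    assume "A -\<^sub>I e \<in> GL"
    then have "(A -\<^sub>I e) o\<^sub>L binv (Ue e) \<in> GL" using Ge[OF e] by (intro GL_comp binv_GL)
    then show False using rep_det_zero_kernel[OF comp[OF e]] that(2) GL_injective unfolding d_def by metis
  qed
  have nonzero: "A -\<^sub>I e \<in> GL" if e: "\<bar>e\<bar> < r" and "d e \<noteq> 0" for e
    using eq[OF e] GL_comp[OF rep_det_nonzero_GL[OF comp[OF e]] Ge[OF e]] that(2) unfolding d_def by simp
  have "\<forall>i j. \<exists>\<phi> :: complex \<Rightarrow> complex. \<phi> holomorphic_on ball 0 r \<and>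
    (\<forall>e. \<bar>e\<bar> < r \<longrightarrow> \<phi> (of_real e) = of_real (f i (binv (Ue e) (v j))))"
    using resolvent_holomorphic[OF U(1) r1] Ge unfolding Ue_def by metis
  then obtain \<phi> :: "nat \<Rightarrow> nat \<Rightarrow> complex \<Rightarrow> complex" where \<phi>: "\<And>i j. \<phi> i j holomorphic_on ball 0 r"
    "\<And>i j e. \<bar>e\<bar> < r \<Longrightarrow> \<phi> i j (of_real e) = of_real (f i (binv (Ue e) (v j)))"
    by metis
  define D where "D z = ndet n (\<lambda>i j. (if i = j then 1 else 0) + \<phi> i j z)" for z
  have D: "D holomorphic_on ball 0 r" unfolding D_def by (intro holomorphic_on_ndet holomorphic_intros \<phi>)
  have Dd: "D (of_real e) = of_real (d e)" if "\<bar>e\<bar> < r" for e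
    unfolding D_def d_def rep_det_def of_real_ndet using \<phi>(2)[OF that] by (intro ndet_cong) simp
  show thesis
  proof (cases "\<forall>z\<in>ball 0 r. D z = 0")
    case True
    have "d e = 0" if "\<bar>e\<bar> < r" for e using True Dd[OF that] that by simp
    then show thesis using that(1)[OF r] zero by blast
  next
    case False
    then obtain z0 where z0: "z0 \<in> ball 0 r" "D z0 \<noteq> 0" by blast
    obtain m c r' where m: "0 < c" "0 < r'" "r' \<le> r" "\<And>z. norm z < r' \<Longrightarrow> c * norm z ^ m \<le> norm (D z)"
      by (rule holomorphic_order_lower_bound[OF D r z0]) (rule that, assumption+)
    have dm: "c * \<bar>e\<bar> ^ m \<le> \<bar>d e\<bar>" if "\<bar>e\<bar> < r'" for e
      using m(4)[of "of_real e"] Dd[of e] that m(3) by simp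
    \<comment> \<open>The functionals in the determinant are
      \<open>f i o\<^sub>L binv (Ue e)\<close>. Bounding them by one \<open>K\<close> for all
      \<open>e\<close> makes \<open>C\<close> independent of \<open>e\<close>, so the order of
      vanishing of \<open>d\<close> passes to the lower bound of \<open>A - e\<close>.\<close>
    define K where "K = (\<Sum>i<n. norm (f i) * inverse r0 + norm (v i))"
    have K0: "0 \<le> K" using r0(1) by (auto simp: K_def intro!: sum_nonneg add_nonneg_nonneg)
    have Ki: "norm (f i) * inverse r0 + norm (v i) \<le> K" if "i < n" for i
      unfolding K_def by (rule member_le_sum) (use that r0(1) in auto)
    have fK: "norm (f i) * inverse r0 \<le> K" and vK: "norm (v i) \<le> K" if "i < n" for i
    proof -
      have "0 \<le> norm (f i) * inverse r0" using r0(1) by simp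
      then show "norm (f i) * inverse r0 \<le> K" "norm (v i) \<le> K"
        using Ki[OF that] norm_ge_zero[of "v i"] by linarith+
    qed
    obtain C where C: "0 \<le> C" "\<And>A :: 'a \<Rightarrow>\<^sub>L 'a. \<And>f v x. A = id_blinfun + (\<Sum>i<n. rank1 (f i) (v i)) \<Longrightarrow>
        (\<And>i. i < n \<Longrightarrow> norm (f i) \<le> K) \<Longrightarrow> (\<And>i. i < n \<Longrightarrow> norm (v i) \<le> K) \<Longrightarrow>
        \<bar>rep_det n f v\<bar> * norm x \<le> C * norm (A x)"
      by (rule rep_det_lower_bound[OF K0, of n, where ?'a = 'a]) (rule that, assumption, blast)
    \<comment> \<open>Here \<open>c\<close> comes from the determinant and \<open>r0\<close> from
      the lower bound of \<open>U - e\<close>; \<open>C + 1\<close> replaces \<open>C\<close>, which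
      may be zero.\<close>
    define c' where "c' = c * r0 / (C + 1)"
    have c': "0 < c'" using m(1) r0(1) C(1) by (simp add: c'_def)
    have low: "c' * \<bar>e\<bar> ^ m * norm x \<le> norm ((A -\<^sub>I e) x)" if e: "\<bar>e\<bar> < r'" for e x
    proof -
      have er: "\<bar>e\<bar> < r" using e m(3) by simp
      have "norm (f i o\<^sub>L binv (Ue e)) \<le> K" if "i < n" for i
      proof -
        have "norm (f i o\<^sub>L binv (Ue e)) \<le> norm (f i) * norm (binv (Ue e))" by (rule norm_blinfun_compose)
        also have "\<dots> \<le> norm (f i) * inverse r0" by (intro mult_left_mono Be er) simp
        finally show ?thesis using fK[OF that] by simp
      qed
      then have 1: "\<bar>d e\<bar> * norm (Ue e x) \<le> C * norm (((A -\<^sub>I e) o\<^sub>L binv (Ue e)) (Ue e x))"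
        unfolding d_def by (intro C(2)[OF comp[OF er]] vK)
      have "norm x = norm (binv (Ue e) (Ue e x))" using Ge[OF er] by simp
      also have "\<dots> \<le> norm (binv (Ue e)) * norm (Ue e x)" by (rule norm_blinfun)
      also have "\<dots> \<le> inverse r0 * norm (Ue e x)" by (intro mult_right_mono Be er) simp
      finally have "r0 * norm x \<le> norm (Ue e x)" using r0(1) by (simp add: field_simps)
      then have "(c * \<bar>e\<bar> ^ m) * (r0 * norm x) \<le> \<bar>d e\<bar> * norm (Ue e x)"
        using m(1) r0(1) by (intro mult_mono dm e) auto
      also have "\<dots> \<le> C * norm ((A -\<^sub>I e) x)" using 1 Ge[OF er] by simp
      also have "\<dots> \<le> (C + 1) * norm ((A -\<^sub>I e) x)" by (intro mult_right_mono) auto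
      finally show ?thesis using C(1) by (simp add: c'_def field_simps)
    qed
    show thesis
    proof (rule that(2)[OF m(2) c'])
      fix e :: real assume e: "0 < \<bar>e\<bar>" "\<bar>e\<bar> < r'"
      have "0 < c * \<bar>e\<bar> ^ m" using m(1) e by simp
      then have "d e \<noteq> 0" using dm[OF e(2)] by auto
      then show "A -\<^sub>I e \<in> GL" using nonzero e m(3) by simp
    qed (use low in auto)
  qed
qed

section \<open>Generalized kernels, ascent and Riesz projections\<close>

definition gker :: "('a::real_normed_vector \<Rightarrow>\<^sub>L 'a) \<Rightarrow> 'a set" where
  "gker A = {x. \<exists>n. (blinfun_apply A ^^ n) x = 0}"

lemma funpow_zero_mono:
  fixes A :: "'a::real_normed_vector \<Rightarrow>\<^sub>L 'a"
  assumes "(blinfun_apply A ^^ n) x = 0" "n \<le> m"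
  shows "(blinfun_apply A ^^ m) x = 0"
proof -
  have "(blinfun_apply A ^^ k) 0 = 0" for k by (induction k) auto
  then show ?thesis using assms by (metis comp_apply funpow_add le_add_diff_inverse2)
qed

text \<open>If \<open>A\<close> to the power \<open>m + 1\<close> kills \<open>y\<close>, the
  polynomial \<open>w e\<close> with coefficients \<open>z j\<close>, the powers
  \<open>m - j\<close> of \<open>A\<close> applied to \<open>y\<close>, telescopes:
  \<open>A - e\<close> maps it to \<open>- (e ^ Suc m *\<^sub>R y)\<close>. The lower bound of order
  \<open>m\<close> forces \<open>norm (w e)\<close> to be at most a multiple of \<open>e\<close>, so
  in the limit \<open>w 0\<close>, which is the power \<open>m\<close> of \<open>A\<close> at
  \<open>y\<close>, vanishes.\<close>

lemma ascent_le:
  fixes A :: "'a::banach \<Rightarrow>\<^sub>L 'a"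
  assumes r: "0 < r" and c: "0 < c"
    and low: "\<And>e x. 0 < \<bar>e\<bar> \<Longrightarrow> \<bar>e\<bar> < r \<Longrightarrow> c * \<bar>e\<bar> ^ m * norm x \<le> norm ((A -\<^sub>I e) x)"
    and x: "x \<in> gker A"
  shows "(blinfun_apply A ^^ m) x = 0"
proof -
  have step: "(blinfun_apply A ^^ m) y = 0" if y: "(blinfun_apply A ^^ Suc m) y = 0" for y
  proof -
    define z where "z j = (blinfun_apply A ^^ (m - j)) y" for j
    have Az: "A (z 0) = 0" "A (z (Suc j)) = z j" if "j < m" for j
      using y that by (simp_all add: z_def Suc_diff_Suc[symmetric] flip: funpow.simps(2) comp_apply[of "blinfun_apply A"])
    have Az0: "A (z 0) = 0" using y by (simp add: z_def)
    define w where "w e = (\<Sum>j\<le>m. e ^ j *\<^sub>R z j)" for e :: real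
    have key: "(A -\<^sub>I e) (w e) = - (e ^ Suc m *\<^sub>R y)" for e
    proof -
      have "(A -\<^sub>I e) (\<Sum>j\<le>k. e ^ j *\<^sub>R z j) = - (e ^ Suc k *\<^sub>R z k)" if "k \<le> m" for k
        using that
      proof (induction k)
        case 0
        then show ?case by (simp add: blinfun.diff_left blinfun.scaleR_left Az0)
      next
        case (Suc k)
        then have "A (z (Suc k)) = z k" by (intro Az(2)) simp
        then show ?case using Suc by (simp add: blinfun.add_right blinfun.diff_left blinfun.scaleR_left blinfun.scaleR_right scaleR_diff_right mult.commute)
      qed
      from this[of m] show ?thesis by (simp add: w_def z_def)
    qed
    have bound: "c * norm (w e) \<le> e * norm y" if e: "0 < e" "e < r" for e
    proof -
      have "c * e ^ m * norm (w e) \<le> norm ((A -\<^sub>I e) (w e))" using low[of e "w e"] e by simp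
      also have "\<dots> = e ^ m * (e * norm y)" using e by (simp add: key)
      finally have "e ^ m * (c * norm (w e)) \<le> e ^ m * (e * norm y)" by (simp add: mult_ac)
      then show ?thesis using e by (simp add: mult_le_cancel_left_pos)
    qed
    have "((\<lambda>e. c * norm (w e)) \<longlongrightarrow> c * norm (w 0)) (at_right 0)"
      unfolding w_def by (intro tendsto_intros)
    moreover have "((\<lambda>e. e * norm y) \<longlongrightarrow> 0 * norm y) (at_right (0::real))" by (intro tendsto_intros)
    moreover have "eventually (\<lambda>e. c * norm (w e) \<le> e * norm y) (at_right 0)"
      unfolding eventually_at_right_field using bound r by (intro exI[of _ r]) auto
    ultimately have "c * norm (w 0) \<le> 0 * norm y" by (intro tendsto_le[OF trivial_limit_at_right_real])
    then have "w 0 = 0" using c by (simp add: mult_le_0_iff)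
    moreover have "w 0 = z 0" unfolding w_def by (simp add: power_0_left if_distrib[of "\<lambda>x. x *\<^sub>R _"] cong: if_cong)
    ultimately show ?thesis by (simp add: z_def)
  qed
  have all: "(blinfun_apply A ^^ m) y = 0" if "(blinfun_apply A ^^ (m + k)) y = 0" for k y
    using that
  proof (induction k arbitrary: y)
    case (Suc k)
    have "(blinfun_apply A ^^ Suc m) ((blinfun_apply A ^^ k) y) = 0"
      using Suc.prems by (metis add_Suc_right add_Suc comp_apply funpow_add)
    then have "(blinfun_apply A ^^ m) ((blinfun_apply A ^^ k) y) = 0" by (rule step)
    then show ?case using Suc.IH by (metis comp_apply funpow_add)
  qed simp
  obtain n where "(blinfun_apply A ^^ n) x = 0" using x by (auto simp: gker_def)
  then have "(blinfun_apply A ^^ (m + n)) x = 0" by (rule funpow_zero_mono) simp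
  then show ?thesis by (rule all)
qed

lemma subspace_gker: "subspace (gker A)"
proof (rule subspaceI)
  show "0 \<in> gker A" by (auto simp: gker_def intro!: exI[of _ 0])
next
  fix x y assume "x \<in> gker A" "y \<in> gker A"
  then obtain n m where nm: "(blinfun_apply A ^^ n) x = 0" "(blinfun_apply A ^^ m) y = 0" by (auto simp: gker_def)
  have "(blinfun_apply A ^^ (n + m)) x = 0" "(blinfun_apply A ^^ (n + m)) y = 0"
    using nm by (auto intro: funpow_zero_mono)
  then have "bpow A (n + m) x + bpow A (n + m) y = 0" by (simp add: bpow_apply)
  then have "bpow A (n + m) (x + y) = 0" by (simp only: blinfun.add_right)
  then show "x + y \<in> gker A" by (auto simp: gker_def bpow_apply)
next
  fix c :: real and x assume "x \<in> gker A"
  then obtain n where "(blinfun_apply A ^^ n) x = 0" by (auto simp: gker_def)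
  then have "c *\<^sub>R bpow A n x = 0" by (simp add: bpow_apply)
  then have "bpow A n (c *\<^sub>R x) = 0" by (simp only: blinfun.scaleR_right)
  then show "c *\<^sub>R x \<in> gker A" by (auto simp: gker_def bpow_apply)
qed

lemma gker_image: "x \<in> gker A \<Longrightarrow> A x \<in> gker A"
proof -
  assume "x \<in> gker A"
  then obtain n where "(blinfun_apply A ^^ n) x = 0" by (auto simp: gker_def)
  then have "(blinfun_apply A ^^ n) (A x) = 0" by (simp add: funpow_swap1[symmetric])
  then show ?thesis by (auto simp: gker_def)
qed

lemma Fred0_kernel_finite:
  assumes "Fred0 B"
  obtains S where "finite S" "\<And>x. blinfun_apply B x = 0 \<Longrightarrow> x \<in> span S"
proof -
  obtain U where U: "U \<in> GL" "finite_rank (B - U)" using assms by (auto simp: Fred0_def)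
  have "finite_rank (binv U o\<^sub>L (U - B))"
    using finite_rank_compose_left[OF finite_rank_uminus[OF U(2)]] by simp
  then obtain S where S: "finite S" "range (blinfun_apply (binv U o\<^sub>L (U - B))) \<subseteq> span S" 
    by (auto simp: finite_rank_def)
  have "x \<in> span S" if "B x = 0" for x
    using range_subsetD[OF S(2), of x] that U(1) by (simp add: blinfun.diff_left)
  with S(1) show thesis by (rule that)
qed

text \<open>If \<open>B = bpow A m\<close> kills \<open>N = gker A\<close>, then \<open>V = B + (\<Sum>i<k. rank1 (h i) (w i))\<close> is invertible
  for a dual system spanning \<open>N\<close>, and the spectral projection onto \<open>N\<close> is the second summand composed with the inverse of \<open>V\<close>.\<close>

lemma riesz_projection:
  fixes A :: "'a::banach \<Rightarrow>\<^sub>L 'a"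
  assumes A: "Fred0 A" and m: "\<And>x. x \<in> gker A \<Longrightarrow> (blinfun_apply A ^^ m) x = 0"
  obtains P k w g where "dual_system k w g" "span (w ` {..<k}) = gker A"
    "P = (\<Sum>i<k. rank1 (g i) (w i))" "\<And>x. P x \<in> gker A" "\<And>x. x \<in> gker A \<Longrightarrow> P x = x" 
    "\<And>x. A (P x) = P (A x)"
proof -
  define B where "B = bpow A m"
  define N where "N = gker A"
  have NB: "x \<in> N \<longleftrightarrow> B x = 0" for x using m by (auto simp: N_def B_def bpow_apply gker_def)
  have BA: "B (A x) = A (B x)" for x by (simp add: B_def bpow_apply funpow_swap1)
  have BB: "B x = 0" if "B (B x) = 0" for x
  proof -
    have "(blinfun_apply A ^^ (m + m)) x = 0" using that by (simp add: B_def bpow_apply funpow_add)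
    then have "x \<in> gker A" by (auto simp: gker_def)
    then show ?thesis using NB by (simp add: N_def)
  qed
  have FB: "Fred0 B" unfolding B_def by (rule Fred0_bpow[OF A])
  obtain S where S: "finite S" "\<And>x. B x = 0 \<Longrightarrow> x \<in> span S" using Fred0_kernel_finite[OF FB] by blast
  obtain C where C: "C \<subseteq> N" "independent C" "N \<subseteq> span C" using basis_exists[of N] by metis
  have "C \<subseteq> span S" using C(1) S(2) NB by blast
  then have "finite C" using independent_span_bound[OF S(1) C(2)] by simp
  then obtain k w h where d: "dual_system k w h" and sp: "span (w ` {..<k}) = span C"
    using dual_system_exists by blast
  have "span C = N" using C(1,3) span_minimal[OF C(1)] subspace_gker by (auto simp: N_def)
  then have spN: "span (w ` {..<k}) = N" using sp by simp
  have wN: "w i \<in> N" if "i < k" for i using spN that by (auto intro: span_base)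
  define R where "R = (\<Sum>i<k. rank1 (h i) (w i))"
  have Rx: "R x = (\<Sum>i<k. h i x *\<^sub>R w i)" for x by (simp add: R_def blinfun_sum_apply)
  have RN: "R x \<in> N" for x unfolding Rx spN[symmetric] by (intro span_sum span_scale span_base) auto
  have RonN: "R x = x" if "x \<in> N" for x unfolding Rx using dual_system_expand[OF d] that spN by simp
  have hR: "h i (R x) = h i x" if "i < k" for i x unfolding Rx by (rule dual_system_coord[OF d that])
  define V where "V = B + R"
  have "Fred0 V" unfolding V_def R_def by (intro Fred0_add_finite_rank FB finite_rank_sum_rank1)
  then have V: "V \<in> GL"
  proof (rule Fred0_inj_GL)
    fix x assume "V x = 0"
    then have e: "B x = - R x" by (simp add: V_def blinfun.add_left eq_neg_iff_add_eq_0)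
    \<comment> \<open>For a kernel vector \<open>x\<close> of \<open>V\<close>, \<open>B x\<close>
      lies in \<open>N\<close>, which \<open>B\<close> kills; since the kernels of \<open>B\<close>
      and its square coincide, this ends the argument.\<close>
    then have "B (B x) = 0" using RN[of x] NB[of "R x"] by (simp add: blinfun.minus_right)
    then have "B x = 0" by (rule BB)
    then have "R x = 0" "x \<in> N" using e NB by auto
    then show "x = 0" using RonN by simp
  qed
  have Vw: "V (w j) = w j" if "j < k" for j
    using wN[OF that] RonN NB by (simp add: V_def blinfun.add_left)
  define g where "g i = h i o\<^sub>L binv V" for i
  have dg: "dual_system k w g"
    unfolding dual_system_def
  proof (intro allI impI)
    fix i j assume "i < k" "j < k"
    then show "g i (w j) = (if i = j then 1 else 0)"
      using d Vw[of j] V binv_apply(2)[OF V, of "w j"] by (simp add: g_def dual_system_def)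
  qed
  define P where "P = (\<Sum>i<k. rank1 (g i) (w i))"
  have Px: "P x = R (binv V x)" for x by (simp add: P_def Rx blinfun_sum_apply g_def)
  have PN: "P x \<in> N" for x unfolding Px by (rule RN)
  have PonN: "P x = x" if "x \<in> N" for x
    using dual_system_expand[OF dg, of x] that spN by (simp add: P_def blinfun_sum_apply)
  \<comment> \<open>\<open>V\<close> sends \<open>x - R x\<close> to \<open>B x\<close>, so its
    inverse carries the range of \<open>B\<close> into the kernel of \<open>R\<close>. Thus
    \<open>P\<close> projects onto \<open>N\<close> along the range of \<open>B\<close>, and
    commutation with \<open>A\<close> can be checked on the two summands.\<close>
  have PB: "P (B x) = 0" for x
  proof -
    have "R (x - R x) = 0" unfolding blinfun.diff_right using RonN[OF RN[of x]] by simp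
    moreover have "B (x - R x) = B x" using RN[of x] NB by (simp add: blinfun.diff_right)
    ultimately have "V (x - R x) = B x" by (simp add: V_def blinfun.add_left)
    then have "binv V (B x) = x - R x" using V by (metis binv_apply(2))
    then show ?thesis using \<open>R (x - R x) = 0\<close> by (simp add: Px)
  qed
  have "A (P x) = P (A x)" for x
  proof -
    define y where "y = binv V x"
    have "V y = x" using V by (simp add: y_def)
    then have x: "x = B y + R y" by (simp add: V_def blinfun.add_left)
    have AR: "A (R y) \<in> N" using gker_image[of "R y" A] RN[of y] by (simp add: N_def)
    have "P (A x) = P (B (A y)) + P (A (R y))" unfolding x by (simp add: blinfun.add_right BA)
    also have "\<dots> = A (R y)" using PB PonN[OF AR] by simp
    finally show ?thesis by (simp add: Px y_def)
  qed
  then show thesis using dg spN PN PonN P_def unfolding N_def by (intro that[of k w g P]) auto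
qed

subsection \<open>Connectedness in the general linear group\<close>

lemma connected_component_path:
  fixes p :: "real \<Rightarrow> 'b::topological_space"
  assumes "continuous_on {0..1} p" "\<And>s. s \<in> {0..1} \<Longrightarrow> p s \<in> S"
  shows "connected_component S (p 0) (p 1)"
  unfolding connected_component_def
  by (rule exI[of _ "p ` {0..1}"]) (use assms in \<open>auto intro: connected_continuous_image\<close>)

lemma connected_component_image:
  assumes "connected_component S a b" "continuous_on S f" "f ` S \<subseteq> S'"
  shows "connected_component S' (f a) (f b)"
proof -
  obtain C where C: "connected C" "C \<subseteq> S" "a \<in> C" "b \<in> C"
    using assms(1) by (auto simp: connected_component_def)
  have "connected (f ` C)" by (rule connected_continuous_image[OF continuous_on_subset[OF assms(2) C(2)] C(1)])
  then show ?thesis using C assms(3) unfolding connected_component_def by (intro exI[of _ "f ` C"]) auto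
qed

lemma connected_component_GL_compose:
  fixes A B :: "'a::real_normed_vector \<Rightarrow>\<^sub>L 'a"
  assumes A: "connected_component GL A A'" and B: "connected_component GL B B'"
  shows "connected_component GL (A o\<^sub>L B) (A' o\<^sub>L B')"
proof -
  have G: "A' \<in> GL" "B \<in> GL" using A B connected_component_in by blast+
  have "connected_component GL (A o\<^sub>L B) (A' o\<^sub>L B)"
    by (rule connected_component_image[OF A]) (use G in \<open>auto intro!: continuous_intros GL_comp\<close>)
  moreover have "connected_component GL (A' o\<^sub>L B) (A' o\<^sub>L B')"
    by (rule connected_component_image[OF B]) (use G in \<open>auto intro!: continuous_intros GL_comp\<close>)
  ultimately show ?thesis by (rule connected_component_trans)
qed

section \<open>Paths between reflections\<close>

definition rank1_reflection :: "('a::real_normed_vector \<Rightarrow>\<^sub>L real) \<Rightarrow> 'a \<Rightarrow> ('a \<Rightarrow>\<^sub>L 'a)" where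
  "rank1_reflection g v = id_blinfun - 2 *\<^sub>R rank1 g v"

lemma rank1_reflection_apply [simp]: "rank1_reflection g v x = x - (2 * g x) *\<^sub>R v"
  by (simp add: rank1_reflection_def blinfun.diff_left blinfun.scaleR_left)

lemma rank1_reflection_involution: "blinfun_apply g v = 1 \<Longrightarrow> rank1_reflection g v o\<^sub>L rank1_reflection g v = id_blinfun"
  by (rule blinfun_eqI) (simp add: blinfun.diff_right blinfun.scaleR_right scaleR_2)

lemma rank1_reflection_GL: "blinfun_apply g v = 1 \<Longrightarrow> rank1_reflection g v \<in> GL"
  using rank1_reflection_involution[of g v] by (auto simp: GL_def)

lemma rank1_reflection_connected_vector:
  assumes "blinfun_apply g v = 1" "blinfun_apply g v' = 1"
  shows "connected_component GL (rank1_reflection g v) (rank1_reflection g v')"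
proof -
  define p where "p s = (1 - s) *\<^sub>R rank1_reflection g v + s *\<^sub>R rank1_reflection g v'" for s
  have eq: "p s = rank1_reflection g ((1 - s) *\<^sub>R v + s *\<^sub>R v')" for s
    by (rule blinfun_eqI) (simp add: p_def blinfun.add_left blinfun.diff_left blinfun.scaleR_left algebra_simps)
  have "connected_component GL (p 0) (p 1)"
  proof (rule connected_component_path)
    show "continuous_on {0..1} p" unfolding p_def by (intro continuous_intros)
    show "p s \<in> GL" for s
      unfolding eq by (rule rank1_reflection_GL) (simp add: blinfun.add_right blinfun.scaleR_right assms)
  qed
  then show ?thesis by (simp add: p_def)
qed

lemma rank1_reflection_connected_functional:
  assumes "blinfun_apply g v = 1" "blinfun_apply g' v = 1"
  shows "connected_component GL (rank1_reflection g v) (rank1_reflection g' v)"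
proof -
  define p where "p s = (1 - s) *\<^sub>R rank1_reflection g v + s *\<^sub>R rank1_reflection g' v" for s
  have eq: "p s = rank1_reflection ((1 - s) *\<^sub>R g + s *\<^sub>R g') v" for s
    by (rule blinfun_eqI) (simp add: p_def blinfun.add_left blinfun.diff_left blinfun.scaleR_left algebra_simps)
  have "connected_component GL (p 0) (p 1)"
  proof (rule connected_component_path)
    show "continuous_on {0..1} p" unfolding p_def by (intro continuous_intros)
    show "p s \<in> GL" for s
      unfolding eq by (rule rank1_reflection_GL) (simp add: blinfun.add_left blinfun.scaleR_left assms)
  qed
  then show ?thesis by (simp add: p_def)
qed

text \<open>The vector is moved to a multiple of \<open>v'\<close>, then the functional to
  \<open>g'\<close>. The scalar passes from the vector to the functional in between, because only
  the product \<open>rank1 g v\<close> matters.\<close>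

lemma rank1_reflection_connected_aux:
  assumes "blinfun_apply g v = 1" "blinfun_apply g' v' = 1" "blinfun_apply g v' \<noteq> 0"
  shows "connected_component GL (rank1_reflection g v) (rank1_reflection g' v')"
proof -
  define c where "c = inverse (g v')"
  have 1: "connected_component GL (rank1_reflection g v) (rank1_reflection g (c *\<^sub>R v'))"
    using assms by (intro rank1_reflection_connected_vector) (auto simp: c_def blinfun.scaleR_right)
  have eq: "rank1_reflection g (c *\<^sub>R v') = rank1_reflection (c *\<^sub>R g) v'"
    by (rule blinfun_eqI) (simp add: blinfun.scaleR_left)
  have "connected_component GL (rank1_reflection (c *\<^sub>R g) v') (rank1_reflection g' v')"
    using assms by (intro rank1_reflection_connected_functional) (auto simp: c_def blinfun.scaleR_left)
  with 1 show ?thesis unfolding eq by (rule connected_component_trans)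
qed

text \<open>If neither functional sees the other vector, both take the value \<open>1\<close> at
  \<open>v + v'\<close>, which serves as an intermediate vector.\<close>

lemma rank1_reflection_connected:
  assumes "blinfun_apply g v = 1" "blinfun_apply g' v' = 1"
  shows "connected_component GL (rank1_reflection g v) (rank1_reflection g' v')"
proof (cases "g v' = 0 \<and> g' v = 0")
  case True
  have "connected_component GL (rank1_reflection g v) (rank1_reflection g (v + v'))"
    using assms True by (intro rank1_reflection_connected_vector) (auto simp: blinfun.add_right)
  moreover have "connected_component GL (rank1_reflection g (v + v')) (rank1_reflection g' (v + v'))"
    using assms True by (intro rank1_reflection_connected_functional) (auto simp: blinfun.add_right)
  moreover have "connected_component GL (rank1_reflection g' (v + v')) (rank1_reflection g' v')"
    using assms True by (intro rank1_reflection_connected_vector) (auto simp: blinfun.add_right)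
  ultimately show ?thesis by (blast intro: connected_component_trans)
next
  case False
  then show ?thesis
    using rank1_reflection_connected_aux[OF assms] rank1_reflection_connected_aux[OF assms(2,1)] connected_component_sym
    by metis
qed

lemma bpow_add: "bpow A (m + n) = bpow A m o\<^sub>L bpow A n"
  by (induction m) (auto intro!: blinfun_eqI)

lemma bpow_involution:
  assumes "A o\<^sub>L A = id_blinfun"
  shows "bpow A n = (if even n then id_blinfun else A)"
proof (induction n)
  case (Suc n)
  then show ?case using assms by (auto intro!: blinfun_eqI)
qed simp

text \<open>For a dual system, the reflections given by the single pairs \<open>g i\<close>,
  \<open>w i\<close> multiply to the identity minus twice the projection onto the span, and each
  factor can be moved to the fixed reflection.\<close>

lemma projection_reflection_connected:
  assumes d: "dual_system k w g" and r: "blinfun_apply g0 v0 = 1" and j: "j \<le> k"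
  shows "connected_component GL (id_blinfun - 2 *\<^sub>R (\<Sum>i<j. rank1 (g i) (w i))) (bpow (rank1_reflection g0 v0) j)"
  using j
proof (induction j)
  case 0
  then show ?case by (simp add: connected_component_refl)
next
  case (Suc j)
  have g: "g j (w j) = 1" and gi: "\<And>i. i < j \<Longrightarrow> g j (w i) = 0" using d Suc.prems by (auto simp: dual_system_def)
  have "id_blinfun - 2 *\<^sub>R (\<Sum>i<Suc j. rank1 (g i) (w i)) =
      rank1_reflection (g j) (w j) o\<^sub>L (id_blinfun - 2 *\<^sub>R (\<Sum>i<j. rank1 (g i) (w i)))"
  proof (rule blinfun_eqI)
    fix x
    have "g j (\<Sum>i<j. g i x *\<^sub>R w i) = 0"
      unfolding blinfun.sum_right by (rule sum.neutral) (use gi in \<open>auto simp: blinfun.scaleR_right\<close>)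
    then show "(id_blinfun - 2 *\<^sub>R (\<Sum>i<Suc j. rank1 (g i) (w i))) x =
      (rank1_reflection (g j) (w j) o\<^sub>L (id_blinfun - 2 *\<^sub>R (\<Sum>i<j. rank1 (g i) (w i)))) x"
      by (simp add: blinfun.diff_left blinfun.scaleR_left blinfun_sum_apply blinfun.add_left blinfun.diff_right
          blinfun.scaleR_right algebra_simps)
  qed
  then show ?case
    using connected_component_GL_compose[OF rank1_reflection_connected[OF g r] Suc.IH] Suc.prems by simp
qed

subsection \<open>Negative eigenvalues\<close>

text \<open>The form that membership in \<open>NS {..<0}\<close> takes once \<open>Fred0\<close> is
  known to be the complement of the strictly singular operators.\<close>

definition neg_admissible :: "('a::real_normed_vector \<Rightarrow>\<^sub>L 'a) \<Rightarrow> bool" where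
  "neg_admissible T \<longleftrightarrow> T \<in> GL \<and> (\<forall>t\<le>0. Fred0 (T -\<^sub>I t))"

definition neg_points :: "('a::real_normed_vector \<Rightarrow>\<^sub>L 'a) \<Rightarrow> real set" where
  "neg_points T = {t. t < 0 \<and> T -\<^sub>I t \<notin> GL}"

text \<open>Both \<open>dim\<close> and the sum have junk value \<open>0\<close> in infinite cases; these do not occur when \<open>T\<close> is \<open>neg_admissible\<close>.\<close>

definition neg_mult :: "('a::real_normed_vector \<Rightarrow>\<^sub>L 'a) \<Rightarrow> nat" where
  "neg_mult T = (\<Sum>t\<in>neg_points T. dim (gker (T -\<^sub>I t)))"

definition neg_regular :: "('a::real_normed_vector \<Rightarrow>\<^sub>L 'a) \<Rightarrow> bool" where
  "neg_regular E \<longleftrightarrow> (\<forall>t\<le>0. E -\<^sub>I t \<in> GL)"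

lemma gker_trivial_iff:
  fixes A :: "'a::banach \<Rightarrow>\<^sub>L 'a"
  assumes "Fred0 A"
  shows "A \<in> GL \<longleftrightarrow> gker A = {0}"
proof
  assume G: "A \<in> GL"
  have "x = 0" if "(blinfun_apply A ^^ n) x = 0" for n x
    using that by (induction n) (auto dest: GL_injective[OF G])
  then show "gker A = {0}" using subspace_0[OF subspace_gker[of A]] by (auto simp: gker_def)
next
  assume g: "gker A = {0}"
  show "A \<in> GL"
  proof (rule Fred0_inj_GL[OF assms])
    fix x assume "A x = 0"
    then have "x \<in> gker A" by (auto simp: gker_def intro!: exI[of _ 1])
    then show "x = 0" using g by simp
  qed
qed

text \<open>Applying \<open>T - s\<close> lowers the exponent and stays in the generalized kernel of
  \<open>T - t\<close>. This reduces to an eigenvector, on which \<open>T - t\<close> is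
  multiplication by \<open>s - t \<noteq> 0\<close>.\<close>

lemma gker_disjoint:
  fixes T :: "'a::real_normed_vector \<Rightarrow>\<^sub>L 'a"
  assumes "s \<noteq> t" "x \<in> gker (T -\<^sub>I s)" "x \<in> gker (T -\<^sub>I t)"
  shows "x = 0"
proof -
  obtain n where "(blinfun_apply (T -\<^sub>I s) ^^ n) x = 0" using assms(2) by (auto simp: gker_def)
  then show ?thesis using assms(3)
  proof (induction n arbitrary: x)
    case (Suc n)
    define y where "y = (T -\<^sub>I s) x"
    have "(blinfun_apply (T -\<^sub>I s) ^^ n) y = 0"
      using Suc.prems(1) by (simp add: y_def funpow_swap1)
    moreover have "y \<in> gker (T -\<^sub>I t)"
    proof -
      have "y = (T -\<^sub>I t) x + (t - s) *\<^sub>R x"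
        by (simp add: y_def blinfun.diff_left blinfun.scaleR_left algebra_simps)
      then show ?thesis
        using gker_image[OF Suc.prems(2)] Suc.prems(2) by (simp add: subspace_add[OF subspace_gker] subspace_scale[OF subspace_gker])
    qed
    ultimately have "y = 0" by (rule Suc.IH)
    then have Tx: "T x = s *\<^sub>R x" by (simp add: y_def blinfun.diff_left blinfun.scaleR_left)
    have "(blinfun_apply (T -\<^sub>I t) ^^ k) x = (s - t) ^ k *\<^sub>R x" for k
    proof (induction k)
      case (Suc k)
      then show ?case
        by (simp add: blinfun.diff_left blinfun.scaleR_left blinfun.scaleR_right Tx algebra_simps)
    qed simp
    moreover obtain k where "(blinfun_apply (T -\<^sub>I t) ^^ k) x = 0" using Suc.prems(2) by (auto simp: gker_def)
    ultimately show ?case using assms(1) by simp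
  qed simp
qed

lemma shift_shift: "(T -\<^sub>I t) -\<^sub>I e = T -\<^sub>I (t + e)"
  by (simp add: scaleR_add_left)

text \<open>The set of \<open>t \<le> 0\<close> near which \<open>T - t\<close> is never invertible is open and closed in \<open>{..0}\<close>.\<close>

lemma neg_admissible_isolated:
  fixes T :: "'a::banach \<Rightarrow>\<^sub>L 'a"
  assumes T: "neg_admissible T" and t: "t \<le> 0"
  obtains r m c where "0 < r" "0 < c" "\<And>e. 0 < \<bar>e\<bar> \<Longrightarrow> \<bar>e\<bar> < r \<Longrightarrow> T -\<^sub>I (t + e) \<in> GL"
      "\<And>e x. 0 < \<bar>e\<bar> \<Longrightarrow> \<bar>e\<bar> < r \<Longrightarrow>
        c * \<bar>e\<bar> ^ m * norm x \<le> norm (((T -\<^sub>I t) -\<^sub>I e) x)"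
proof -
  define bad where "bad t \<longleftrightarrow> (\<exists>r>0. \<forall>e. \<bar>e\<bar> < r \<longrightarrow> T -\<^sub>I (t + e) \<notin> GL)" for t
  have F: "Fred0 (T -\<^sub>I t)" if "t \<le> 0" for t using T that by (auto simp: neg_admissible_def)
  have not_bad: "\<not> bad t" if "T -\<^sub>I t \<in> GL" for t
    using that unfolding bad_def by (metis abs_zero add.right_neutral)
  have "\<forall>t\<in>{..0}. eventually (\<lambda>t'. bad t = bad t') (at t within {..0})"
  proof
    fix t :: real assume t: "t \<in> {..0}"
    have "\<exists>d>0. \<forall>t'. t' \<noteq> t \<and> \<bar>t' - t\<bar> < d \<longrightarrow> bad t = bad t'"
    proof (cases rule: Fred0_shift_dichotomy[OF F[of t]])
      case 1
      then show ?case using t by simp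
    next
      case (2 r)
      have "bad t" using 2 unfolding bad_def shift_shift by blast
      moreover have "bad t'" if "\<bar>t' - t\<bar> < r / 2" for t'
        unfolding bad_def
      proof (intro exI[of _ "r / 2"] conjI allI impI)
        fix e assume "\<bar>e\<bar> < r / 2"
        then have "\<bar>(t' - t) + e\<bar> < r" using that by linarith
        from 2(2)[OF this] show "T -\<^sub>I (t' + e) \<notin> GL" unfolding shift_shift by simp
      qed (use 2 in simp)
      ultimately show ?thesis using 2(1) by (intro exI[of _ "r / 2"]) auto
    next
      case (3 r m c)
      have g: "T -\<^sub>I t' \<in> GL" if "t' \<noteq> t" "\<bar>t' - t\<bar> < r" for t'
        using 3(3)[of "t' - t"] that unfolding shift_shift by simp
      have "\<not> bad t"
      proof
        assume "bad t"
        then obtain r' where r': "0 < r'" "\<And>e. \<bar>e\<bar> < r' \<Longrightarrow> T -\<^sub>I (t + e) \<notin> GL"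
          unfolding bad_def by blast
        define e where "e = min r r' / 2"
        have "0 < e" "e < r" "e < r'" using r'(1) 3(1) by (auto simp: e_def min_def)
        then show False using r'(2)[of e] g[of "t + e"] by simp
      qed
      then show ?thesis using g not_bad 3(1) by (intro exI[of _ r]) auto
    qed
    then show "eventually (\<lambda>t'. bad t = bad t') (at t within {..0})"
      unfolding eventually_at by (auto simp: dist_real_def)
  qed
  moreover have "connected {..(0::real)}" by (rule convex_connected) simp
  \<comment> \<open>To the left of \<open>- norm T\<close> the shifted operator is invertible, so
    the constant value of \<open>bad\<close> is \<open>False\<close>.\<close>
  moreover define t1 where "t1 = - (norm T + 1)"
  moreover have "t1 \<in> {..0}" unfolding t1_def atMost_iff using norm_ge_zero[of T] by linarith
  ultimately have "bad t1 = bad t" using t by (intro connected_local_const[of "{..0}" t1 t bad]) auto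
  moreover have "\<not> bad t1" by (rule not_bad, rule GL_shift) (use norm_ge_zero[of T] in \<open>simp add: t1_def\<close>)
  ultimately have nb: "\<not> bad t" by simp
  show thesis
  proof (cases rule: Fred0_shift_dichotomy[OF F[OF t]])
    case (1 r)
    then show ?thesis using nb unfolding bad_def shift_shift by blast
  next
    case (2 r m c)
    show ?thesis by (rule that[OF 2(1,2)]) (use 2(3,4) in \<open>auto simp: shift_shift\<close>)
  qed
qed

lemma finite_neg_points:
  fixes T :: "'a::banach \<Rightarrow>\<^sub>L 'a"
  assumes T: "neg_admissible T"
  shows "finite (neg_points T)"
proof -
  have "finite ({- norm T..0} \<inter> neg_points T)"
  proof (rule finite_not_islimpt_in_compact)
    fix z assume "z \<in> {- norm T..0}"
    then have "z \<le> 0" by simp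
    then obtain r where r: "0 < r" "\<And>e. 0 < \<bar>e\<bar> \<Longrightarrow> \<bar>e\<bar> < r \<Longrightarrow> T -\<^sub>I (z + e) \<in> GL"
      using neg_admissible_isolated[OF T] by metis
    show "\<not> z islimpt neg_points T"
    proof
      assume "z islimpt neg_points T"
      then obtain t where t: "t \<in> neg_points T" "t \<noteq> z" "dist t z < r"
        using r(1) unfolding islimpt_approachable by blast
      then show False using r(2)[of "t - z"] by (auto simp: neg_points_def dist_real_def)
    qed
  qed simp
  moreover have "neg_points T \<subseteq> {- norm T..0}"
  proof
    fix t assume t: "t \<in> neg_points T"
    then have "\<not> norm T < \<bar>t\<bar>" using GL_shift[of T t] by (auto simp: neg_points_def)
    then show "t \<in> {- norm T..0}" using t by (auto simp: neg_points_def)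
  qed
  ultimately show ?thesis by (simp add: Int_absorb1)
qed

section \<open>Splitting off eigenvalues and the sign of the determinant\<close>

lemma sgn_eq_on_connected:
  fixes f :: "'b::topological_space \<Rightarrow> real"
  assumes S: "connected S" "continuous_on S f" "\<And>x. x \<in> S \<Longrightarrow> f x \<noteq> 0" and ab: "a \<in> S" "b \<in> S"
  shows "sgn (f a) = sgn (f b)"
proof -
  have c: "connected (f ` S)" using S by (intro connected_continuous_image)
  have "\<not> (f x < 0 \<and> 0 < f y)" if "x \<in> S" "y \<in> S" for x y
    using connectedD_interval[OF c, of "f x" "f y" 0] that S(3) by fastforce
  then show ?thesis using ab S(3) by (metis linorder_neqE_linordered_idom sgn_neg sgn_pos)
qed

text \<open>With \<open>P\<close> the projection onto the generalized eigenspace at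
  \<open>t\<close>, \<open>E\<close> is \<open>T\<close> on the kernel of \<open>P\<close> and the
  identity on its range, while \<open>G\<close> is the identity on the kernel and \<open>T\<close>
  on the range. On that range the only real eigenvalue of \<open>T\<close> is \<open>t < 0\<close>,
  so a segment deforms \<open>T\<close> into minus the identity there; this gives the sign and the
  component of \<open>G\<close>.\<close>

lemma neg_split:
  fixes T :: "'a::banach \<Rightarrow>\<^sub>L 'a"
  assumes T: "neg_admissible T" and t: "t \<in> neg_points T" and r0: "blinfun_apply g0 v0 = 1"
  obtains G E where "T = G o\<^sub>L E" "neg_admissible E" "finite_rank (T - E)" "finite_rank (G - id_blinfun)"
    "neg_points E = neg_points T - {t}"
    "\<And>s. s < 0 \<Longrightarrow> s \<noteq> t \<Longrightarrow> gker (E -\<^sub>I s) = gker (T -\<^sub>I s)"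
    "sgn (opdet G) = (- 1) ^ dim (gker (T -\<^sub>I t))"
    "connected_component GL G (bpow (rank1_reflection g0 v0) (dim (gker (T -\<^sub>I t))))"
proof -
  define A where "A = T -\<^sub>I t"
  have t0: "t < 0" using t by (simp add: neg_points_def)
  have F: "Fred0 (T -\<^sub>I s)" if "s \<le> 0" for s using T that by (auto simp: neg_admissible_def)
  obtain r m c where rmc: "0 < r" "0 < c" "\<And>e x. 0 < \<bar>e\<bar> \<Longrightarrow> \<bar>e\<bar> < r \<Longrightarrow>
        c * \<bar>e\<bar> ^ m * norm x \<le> norm (((T -\<^sub>I t) -\<^sub>I e) x)"
    by (rule neg_admissible_isolated[OF T, of t]) (use t0 in auto)
  have m: "(blinfun_apply A ^^ m) x = 0" if "x \<in> gker A" for x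
    using ascent_le[OF rmc[folded A_def] that] .
  obtain P k w g where d: "dual_system k w g" and sp: "span (w ` {..<k}) = gker A"
    and P: "P = (\<Sum>i<k. rank1 (g i) (w i))" and PN: "\<And>x. P x \<in> gker A"
    and PonN: "\<And>x. x \<in> gker A \<Longrightarrow> P x = x" and AP: "\<And>x. A (P x) = P (A x)"
    by (rule riesz_projection[OF F[OF less_imp_le[OF t0], folded A_def] m]) blast+
  have dim: "dim (gker A) = k" using dual_system_dim[OF d] sp by simp
  have TP: "T (P x) = P (T x)" for x
    using AP[of x] by (simp add: A_def blinfun.diff_left blinfun.diff_right blinfun.scaleR_left blinfun.scaleR_right)
  have PP: "P (P x) = P x" for x by (rule PonN[OF PN])
  have PTP: "P (T (P x)) = T (P x)" for x by (simp add: TP PP)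
  have frP: "finite_rank P" unfolding P by (rule finite_rank_sum_rank1)
  define E where "E = T + (P o\<^sub>L (id_blinfun - T))"
  \<comment> \<open>On the range of \<open>P\<close> this is \<open>(1 - s) T - s\<close>, on its
    kernel the identity: a path from \<open>G\<close> to the identity minus
    \<open>2 P\<close>.\<close>
  define q where "q s = id_blinfun + (P o\<^sub>L ((1 - s) *\<^sub>R T -\<^sub>I (1 + s)))" for s :: real
  define G where "G = q 0"
  have Ex: "E x = T x + P x - P (T x)" for x
    by (simp add: E_def blinfun.add_left blinfun.diff_left blinfun.diff_right)
  have qx: "q s x = x + ((1 - s) *\<^sub>R P (T x) - (1 + s) *\<^sub>R P x)" for s x
    by (simp add: q_def blinfun.add_left blinfun.diff_left blinfun.scaleR_left blinfun.diff_right blinfun.scaleR_right)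
  have PE: "P (E x) = P x" for x by (simp add: Ex blinfun.add_right blinfun.diff_right PP)
  have PTE: "P (T (E x)) = P (T x)" for x by (simp only: TP[symmetric] PE)
  have GE: "T = G o\<^sub>L E"
    by (rule blinfun_eqI) (simp add: G_def qx PE PTE, simp add: Ex)
  have frE: "finite_rank (T - E)"
    unfolding E_def using finite_rank_uminus[OF finite_rank_compose_right[OF frP]] by simp
  have FE: "Fred0 (E -\<^sub>I s)" if "s \<le> 0" for s
    by (rule Fred0_finite_rank_diff[OF F[OF that]]) (use finite_rank_uminus[OF frE] in simp)
  \<comment> \<open>After applying \<open>P\<close>, the operator \<open>E - s\<close> acts as
    multiplication by \<open>1 - s\<close>, which is nonzero because
    \<open>s \<le> 0\<close>.\<close>
  have gE: "gker (E -\<^sub>I s) = {x \<in> gker (T -\<^sub>I s). P x = 0}" if s: "s \<le> 0" for s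
  proof -
    let ?Es = "blinfun_apply (E -\<^sub>I s)" and ?Ts = "blinfun_apply (T -\<^sub>I s)"
    have 1: "P ((?Es ^^ n) x) = (1 - s) ^ n *\<^sub>R P x" for n x
    proof (induction n)
      case (Suc n)
      then show ?case
        by (simp add: blinfun.diff_left blinfun.scaleR_left blinfun.diff_right blinfun.scaleR_right PE algebra_simps)
    qed simp
    have 2: "(?Es ^^ n) x = (?Ts ^^ n) x \<and> P ((?Ts ^^ n) x) = 0" if "P x = 0" for n x
    proof (induction n)
      case (Suc n)
      then show ?case
        by (simp add: blinfun.diff_left blinfun.scaleR_left blinfun.diff_right blinfun.scaleR_right Ex TP[symmetric])
    qed (use that in simp)
    show ?thesis
    proof (intro Set.set_eqI iffI)
      fix x assume "x \<in> gker (E -\<^sub>I s)"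
      then obtain n where n: "(?Es ^^ n) x = 0" by (auto simp: gker_def)
      then have "(1 - s) ^ n *\<^sub>R P x = 0" using 1[of n x] by simp
      then have "P x = 0" using s by simp
      then show "x \<in> {x \<in> gker (T -\<^sub>I s). P x = 0}" using 2[of x n] n by (auto simp: gker_def)
    next
      fix x assume "x \<in> {x \<in> gker (T -\<^sub>I s). P x = 0}"
      then show "x \<in> gker (E -\<^sub>I s)" using 2[of x] by (auto simp: gker_def)
    qed
  qed
  have gT: "gker (E -\<^sub>I s) = gker (T -\<^sub>I s)" if s: "s \<le> 0" "s \<noteq> t" for s
  proof -
    have "P x = 0" if x: "x \<in> gker (T -\<^sub>I s)" for x
    proof (rule gker_disjoint[OF s(2)])
      let ?Ts = "blinfun_apply (T -\<^sub>I s)"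
      have "(?Ts ^^ n) (P x) = P ((?Ts ^^ n) x)" for n
      proof (induction n)
        case (Suc n)
        then show ?case
          by (simp add: blinfun.diff_left blinfun.scaleR_left blinfun.diff_right blinfun.scaleR_right TP)
      qed simp
      moreover obtain n where "(?Ts ^^ n) x = 0" using x by (auto simp: gker_def)
      ultimately have "(?Ts ^^ n) (P x) = 0" by simp
      then show "P x \<in> gker (T -\<^sub>I s)" by (auto simp: gker_def)
      show "P x \<in> gker (T -\<^sub>I t)" using PN by (simp add: A_def)
    qed
    then show ?thesis using gE[OF s(1)] by auto
  qed
  have gt: "gker (E -\<^sub>I t) = {0}"
  proof -
    have "x = 0" if "x \<in> gker A" "P x = 0" for x using PonN[OF that(1)] that(2) by simp
    moreover have "0 \<in> gker A" by (rule subspace_0[OF subspace_gker])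
    ultimately show ?thesis using gE[of t] t0 unfolding A_def[symmetric] by auto
  qed
  have iff: "E -\<^sub>I s \<in> GL \<longleftrightarrow> s = t \<or> T -\<^sub>I s \<in> GL" if "s \<le> 0" for s
    using gker_trivial_iff[OF FE[OF that]] gker_trivial_iff[OF F[OF that]] gT[OF that] gt by metis
  have "E \<in> GL" using iff[of 0] T by (simp add: neg_admissible_def)
  then have E: "neg_admissible E" using FE by (auto simp: neg_admissible_def)
  have np: "neg_points E = neg_points T - {t}" using iff by (force simp: neg_points_def)
  have frq: "finite_rank (q s - id_blinfun)" for s
    unfolding q_def using finite_rank_compose_right[OF frP] by simp
  have qGL: "q s \<in> GL" if s: "s \<in> {0..1}" for s
  proof (rule opdet_inj_GL[OF frq])
    fix x assume "q s x = 0"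
    then have "x = P ((1 + s) *\<^sub>R x - (1 - s) *\<^sub>R T x)"
      by (simp add: qx blinfun.diff_right blinfun.add_right blinfun.scaleR_right algebra_simps eq_neg_iff_add_eq_0)
    then have x: "x \<in> gker A" using PN by metis
    then have "P (T x) = T x" using PTP[of x] PonN by simp
    then have Tx: "(1 - s) *\<^sub>R T x = s *\<^sub>R x"
      using \<open>q s x = 0\<close> PonN[OF x] by (simp add: qx algebra_simps)
    show "x = 0"
    proof (cases "s = 1")
      case True
      then show ?thesis using Tx by simp
    next
      case False
      \<comment> \<open>A nonzero kernel vector would be an eigenvector of \<open>T\<close> for
        \<open>\<mu> \<ge> 0\<close> inside the generalized eigenspace at
        \<open>t < 0\<close>.\<close>
      define \<mu> where "\<mu> = s / (1 - s)"
      have "\<mu> \<ge> 0" using s by (simp add: \<mu>_def)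
      have "T x = inverse (1 - s) *\<^sub>R ((1 - s) *\<^sub>R T x)" using False by simp
      then have "T x = \<mu> *\<^sub>R x" unfolding Tx using False by (simp add: \<mu>_def field_simps)
      then have "x \<in> gker (T -\<^sub>I \<mu>)"
        by (auto simp: gker_def blinfun.diff_left blinfun.scaleR_left intro!: exI[of _ 1])
      then show ?thesis using gker_disjoint[of \<mu> t x T] x \<open>\<mu> \<ge> 0\<close> t0 by (simp add: A_def)
    qed
  qed
  have q1: "q 1 = id_blinfun - 2 *\<^sub>R (\<Sum>i<k. rank1 (g i) (w i))"
    unfolding P[symmetric] by (rule blinfun_eqI) (simp add: qx blinfun.diff_left blinfun.scaleR_left)
  have "opdet (q 1) = (- 1) ^ k"
  proof -
    have "q 1 = id_blinfun + (\<Sum>i<k. rank1 (g i) (- 2 *\<^sub>R w i))"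
      unfolding q1 by (rule blinfun_eqI)
        (simp add: blinfun.diff_left blinfun.add_left blinfun.scaleR_left blinfun_sum_apply scaleR_sum_right sum_negf mult.commute)
    then have "opdet (q 1) = rep_det k g (\<lambda>i. - 2 *\<^sub>R w i)" by (rule opdet_eq)
    also have "\<dots> = ndet k (\<lambda>i j. if i = j then - 1 else 0)"
      unfolding rep_det_def by (intro ndet_cong) (use d in \<open>auto simp: dual_system_def blinfun.scaleR_right blinfun.minus_right\<close>)
    finally show ?thesis by (simp add: ndet_scalar)
  qed
  moreover have "sgn (opdet (q 0)) = sgn (opdet (q 1))"
  proof (rule sgn_eq_on_connected[of "{0..1}" "\<lambda>s. opdet (q s)" 0 1])
    show "continuous_on {0..1} (\<lambda>s. opdet (q s))"
      unfolding q_def by (intro continuous_on_opdet frP continuous_intros)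
    show "opdet (q s) \<noteq> 0" if "s \<in> {0..1}" for s using opdet_nonzero_iff[OF frq] qGL[OF that] by simp
  qed auto
  ultimately have sG: "sgn (opdet G) = (- 1) ^ k" by (cases "even k") (simp_all add: G_def)
  have "connected_component GL (q 0) (q 1)"
    by (rule connected_component_path) (use qGL in \<open>auto simp: q_def intro!: continuous_intros\<close>)
  moreover have "connected_component GL (q 1) (bpow (rank1_reflection g0 v0) k)"
    unfolding q1 by (rule projection_reflection_connected[OF d r0 order_refl])
  ultimately have cG: "connected_component GL G (bpow (rank1_reflection g0 v0) k)"
    unfolding G_def by (rule connected_component_trans)
  show thesis
    by (rule that[OF GE E frE _ np gT]) (use frq sG cG dim in \<open>auto simp: G_def A_def\<close>)
qed

text \<open>The operator \<open>(1 - s) E + s\<close> is \<open>1 - s\<close> times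
  \<open>E - t\<close> for \<open>t = - s / (1 - s)\<close>, which sweeps \<open>{..0}\<close> as
  \<open>s\<close> runs through \<open>{0..<1}\<close>. With \<open>neg_regularI\<close>, regularity
  amounts to the segment to the identity lying in \<open>GL\<close>.\<close>

lemma neg_regular_segment_GL:
  fixes E :: "'a::real_normed_vector \<Rightarrow>\<^sub>L 'a"
  assumes "neg_regular E" "s \<in> {0..1}"
  shows "(1 - s) *\<^sub>R E + s *\<^sub>R id_blinfun \<in> GL"
proof (cases "s = 1")
  case False
  then have s: "0 \<le> s" "s < 1" using assms(2) by auto
  have "- (s / (1 - s)) \<le> 0" using s by simp
  then have "E - (- (s / (1 - s))) *\<^sub>R id_blinfun \<in> GL" using assms(1) unfolding neg_regular_def by blast
  then have "(1 - s) *\<^sub>R (E - (- (s / (1 - s))) *\<^sub>R id_blinfun) \<in> GL" by (rule GL_scaleR) (use s in auto)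
  moreover have "(1 - s) *\<^sub>R (E - (- (s / (1 - s))) *\<^sub>R id_blinfun) = (1 - s) *\<^sub>R E + s *\<^sub>R id_blinfun"
    using s by (simp add: scaleR_add_right)
  ultimately show ?thesis by simp
qed simp

lemma neg_regularI:
  assumes "\<And>s. s \<in> {0..1} \<Longrightarrow> (1 - s) *\<^sub>R E + s *\<^sub>R id_blinfun \<in> GL"
  shows "neg_regular E"
  unfolding neg_regular_def
proof (intro allI impI)
  fix t :: real assume t: "t \<le> 0"
  define s where "s = - t / (1 - t)"
  have s: "s \<in> {0..1}" "(1 - t) * (1 - s) = 1" "(1 - t) * s = - t" using t by (auto simp: s_def field_simps)
  have "(1 - t) *\<^sub>R ((1 - s) *\<^sub>R E + s *\<^sub>R id_blinfun) \<in> GL" by (rule GL_scaleR[OF assms[OF s(1)]]) (use t in auto)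
  moreover have "(1 - t) *\<^sub>R ((1 - s) *\<^sub>R E + s *\<^sub>R id_blinfun) = E -\<^sub>I t"
    by (simp only: scaleR_add_right scaleR_scaleR s) simp
  ultimately show "E -\<^sub>I t \<in> GL" by simp
qed

lemma neg_regular_imp_GL: "neg_regular E \<Longrightarrow> E \<in> GL"
  unfolding neg_regular_def by (metis diff_zero order_refl scaleR_zero_left)

lemma neg_regular_id: "neg_regular (id_blinfun :: 'a::real_normed_vector \<Rightarrow>\<^sub>L 'a)"
  by (rule neg_regularI) (simp flip: scaleR_add_left)

text \<open>Induction on the number of negative points. Determinants multiply along
  \<open>T o\<^sub>L binv E = G o\<^sub>L (E1 o\<^sub>L binv E)\<close>, and the paths compose
  likewise; once no negative point is left, the segment to the identity finishes the path.\<close>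

lemma neg_split_all:
  fixes T :: "'a::banach \<Rightarrow>\<^sub>L 'a"
  assumes T: "neg_admissible T" and r0: "blinfun_apply g0 v0 = 1"
  obtains E where "neg_regular E" "finite_rank (T - E)" "sgn (opdet (T o\<^sub>L binv E)) = (- 1) ^ neg_mult T"
    "connected_component GL T (bpow (rank1_reflection g0 v0) (neg_mult T))"
proof -
  have "\<exists>E. neg_regular E \<and> finite_rank (T - E) \<and> sgn (opdet (T o\<^sub>L binv E)) = (- 1) ^ neg_mult T \<and>
    connected_component GL T (bpow (rank1_reflection g0 v0) (neg_mult T))"
    using T
  proof (induction "card (neg_points T)" arbitrary: T)
    case 0
    then have np: "neg_points T = {}" using finite_neg_points[OF 0(2)] 0(1) by simp
    have reg: "neg_regular T"
      unfolding neg_regular_def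
    proof (intro allI impI)
      fix t :: real assume "t \<le> 0"
      then show "T -\<^sub>I t \<in> GL"
        using np 0(2) by (cases "t = 0") (auto simp: neg_points_def neg_admissible_def)
    qed
    have m: "neg_mult T = 0" by (simp add: neg_mult_def np)
    have "connected_component GL T id_blinfun"
    proof -
      have "continuous_on {0..1} (\<lambda>s. (1 - s) *\<^sub>R T + s *\<^sub>R id_blinfun)" by (intro continuous_intros)
      from connected_component_path[OF this neg_regular_segment_GL[OF reg]] show ?thesis by simp
    qed
    then show ?case using reg by (intro exI[of _ T]) (simp add: m binv_compose neg_regular_imp_GL)
  next
    case (Suc n)
    then obtain t where t: "t \<in> neg_points T" by (metis card.empty equals0I nat.distinct(1))
    let ?k = "dim (gker (T -\<^sub>I t))"
    obtain G E1 where GE: "T = G o\<^sub>L E1" "neg_admissible E1" "finite_rank (T - E1)" "finite_rank (G - id_blinfun)"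
      "neg_points E1 = neg_points T - {t}"
      "\<And>s. s < 0 \<Longrightarrow> s \<noteq> t \<Longrightarrow> gker (E1 -\<^sub>I s) = gker (T -\<^sub>I s)"
      "sgn (opdet G) = (- 1) ^ ?k" "connected_component GL G (bpow (rank1_reflection g0 v0) ?k)"
      by (rule neg_split[OF Suc.prems t r0]) (rule that; (assumption | blast))
    have fin: "finite (neg_points T)" by (rule finite_neg_points[OF Suc.prems])
    have "n = card (neg_points E1)" using Suc(2) t fin by (simp add: GE(5))
    then obtain E where E: "neg_regular E" "finite_rank (E1 - E)" "sgn (opdet (E1 o\<^sub>L binv E)) = (- 1) ^ neg_mult E1"
      "connected_component GL E1 (bpow (rank1_reflection g0 v0) (neg_mult E1))"
      using Suc.hyps(1)[OF _ GE(2)] by blast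
    have "neg_mult E1 = (\<Sum>s\<in>neg_points T - {t}. dim (gker (T -\<^sub>I s)))"
      unfolding neg_mult_def GE(5) by (intro sum.cong) (auto simp: GE(6) neg_points_def)
    then have m: "neg_mult T = ?k + neg_mult E1"
      unfolding neg_mult_def[of T] using sum.remove[OF fin t] by metis
    have GLE: "E \<in> GL" by (rule neg_regular_imp_GL[OF E(1)])
    have "(E1 o\<^sub>L binv E) - id_blinfun = (E1 - E) o\<^sub>L binv E"
      by (rule blinfun_eqI) (simp add: blinfun.diff_left GLE)
    then have fr: "finite_rank ((E1 o\<^sub>L binv E) - id_blinfun)" using E(2) by (simp add: finite_rank_compose_right)
    have "T o\<^sub>L binv E = G o\<^sub>L (E1 o\<^sub>L binv E)" unfolding GE(1) by (rule blinfun_eqI) simp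
    then have "opdet (T o\<^sub>L binv E) = opdet G * opdet (E1 o\<^sub>L binv E)" using opdet_compose[OF GE(4) fr] by simp
    then have "sgn (opdet (T o\<^sub>L binv E)) = (- 1) ^ neg_mult T"
      using GE(7) E(3) by (simp add: sgn_mult m power_add)
    moreover have "finite_rank (T - E)" using finite_rank_add[OF GE(3) E(2)] by simp
    moreover have "connected_component GL T (bpow (rank1_reflection g0 v0) (neg_mult T))"
      unfolding m bpow_add using connected_component_GL_compose[OF GE(8) E(4)] GE(1) by simp
    ultimately show ?case using E(1) by blast
  qed
  then show thesis using that by blast
qed

text \<open>The sign does not depend on the choice of \<open>E\<close>. Two regular operators with
  finite-rank difference move to the identity along their segments simultaneously;
  \<open>p' s o\<^sub>L binv (p s)\<close> stays an invertible finite-rank perturbation of the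
  identity and ends at the identity, so its determinant is positive throughout.\<close>

lemma sgn_opdet_neg_mult:
  fixes T :: "'a::banach \<Rightarrow>\<^sub>L 'a" and g0 :: "'a \<Rightarrow>\<^sub>L real"
  assumes T: "neg_admissible T" and E: "neg_regular E" and fr: "finite_rank (T - E)"
    and r0: "blinfun_apply g0 v0 = 1"
  shows "sgn (opdet (T o\<^sub>L binv E)) = (- 1) ^ neg_mult T"
proof -
  obtain E' where E': "neg_regular E'" "finite_rank (T - E')" "sgn (opdet (T o\<^sub>L binv E')) = (- 1) ^ neg_mult T"
    by (rule neg_split_all[OF T r0])
  have G: "E \<in> GL" "E' \<in> GL" using E E' neg_regular_imp_GL by auto
  have frD: "finite_rank (E' - E)" using finite_rank_diff[OF fr E'(2)] by simp
  define p where "p s = (1 - s) *\<^sub>R E + s *\<^sub>R id_blinfun" for s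
  define p' where "p' s = (1 - s) *\<^sub>R E' + s *\<^sub>R id_blinfun" for s
  define q where "q s = id_blinfun + ((E' - E) o\<^sub>L ((1 - s) *\<^sub>R binv (p s)))" for s
  have pG: "p s \<in> GL" "p' s \<in> GL" if "s \<in> {0..1}" for s
    unfolding p_def p'_def using neg_regular_segment_GL that E E'(1) by auto
  have q: "q s = p' s o\<^sub>L binv (p s)" if "s \<in> {0..1}" for s
  proof (rule blinfun_eqI)
    fix x
    define y where "y = binv (p s) x"
    have "p s y = x" using pG[OF that] by (simp add: y_def)
    then have px: "x = (1 - s) *\<^sub>R E y + s *\<^sub>R y" by (simp add: p_def blinfun.add_left blinfun.scaleR_left)
    have qx: "q s x = x + (1 - s) *\<^sub>R (E' y - E y)"
      by (simp add: q_def y_def blinfun.add_left blinfun.diff_left blinfun.scaleR_left blinfun.scaleR_right)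
    have "(p' s o\<^sub>L binv (p s)) x = (1 - s) *\<^sub>R E' y + s *\<^sub>R y"
      by (simp add: p'_def y_def blinfun.add_left blinfun.scaleR_left)
    also have "\<dots> = x + (1 - s) *\<^sub>R (E' y - E y)" by (subst px) (simp add: algebra_simps)
    finally show "q s x = (p' s o\<^sub>L binv (p s)) x" unfolding qx ..
  qed
  have frq: "finite_rank (q s - id_blinfun)" for s
    unfolding q_def using finite_rank_compose_right[OF frD] by simp
  have "sgn (opdet (q 0)) = sgn (opdet (q 1))"
  proof (rule sgn_eq_on_connected[of "{0..1}" "\<lambda>s. opdet (q s)" 0 1])
    have "continuous_on {0..1} (\<lambda>s. binv (p s))"
      by (rule continuous_on_compose2[OF continuous_on_binv]) (use pG in \<open>auto simp: p_def intro!: continuous_intros\<close>)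
    then show "continuous_on {0..1} (\<lambda>s. opdet (q s))"
      unfolding q_def by (intro continuous_on_opdet frD continuous_intros)
    show "opdet (q s) \<noteq> 0" if "s \<in> {0..1}" for s
    proof -
      have "q s \<in> GL" unfolding q[OF that] using pG[OF that] by (intro GL_comp binv_GL)
      then show ?thesis using opdet_nonzero_iff[OF frq] by blast
    qed
  qed auto
  also have "q 1 = id_blinfun" by (simp add: q_def)
  finally have 1: "sgn (opdet (E' o\<^sub>L binv E)) = 1" using q[of 0] by (simp add: p_def p'_def)
  have fr1: "finite_rank ((T o\<^sub>L binv E') - id_blinfun)"
  proof -
    have "(T o\<^sub>L binv E') - id_blinfun = (T - E') o\<^sub>L binv E'"
      by (rule blinfun_eqI) (simp add: blinfun.diff_left G)
    then show ?thesis using E'(2) by (simp add: finite_rank_compose_right)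
  qed
  have fr2: "finite_rank ((E' o\<^sub>L binv E) - id_blinfun)"
    using frq[of 0] q[of 0] by (simp add: p_def p'_def)
  have "T o\<^sub>L binv E = (T o\<^sub>L binv E') o\<^sub>L (E' o\<^sub>L binv E)" by (rule blinfun_eqI) (simp add: G)
  then have "opdet (T o\<^sub>L binv E) = opdet (T o\<^sub>L binv E') * opdet (E' o\<^sub>L binv E)"
    using opdet_compose[OF fr1 fr2] by simp
  then show ?thesis using E'(3) 1 by (simp add: sgn_mult)
qed

lemma neg_regular_near:
  fixes E :: "'a::banach \<Rightarrow>\<^sub>L 'a"
  assumes "neg_regular E"
  obtains r where "0 < r" "\<And>A. norm (A - E) < r \<Longrightarrow> neg_regular A"
proof -
  let ?p = "\<lambda>s. (1 - s) *\<^sub>R E + s *\<^sub>R id_blinfun"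
  have "compact (?p ` {0..1})" by (intro compact_continuous_image continuous_intros) simp
  moreover have "?p ` {0..1} \<subseteq> GL" using neg_regular_segment_GL[OF assms] by auto
  ultimately obtain r where r: "0 < r" "(\<Union>x\<in>?p ` {0..1}. ball x r) \<subseteq> GL"
    by (rule compact_subset_open_imp_ball_epsilon_subset[OF _ open_GL])
  show thesis
  proof (rule that[OF r(1)])
    fix A assume A: "norm (A - E) < r"
    show "neg_regular A"
    proof (rule neg_regularI)
      fix s :: real assume s: "s \<in> {0..1}"
      have "?p s - ((1 - s) *\<^sub>R A + s *\<^sub>R id_blinfun) = (1 - s) *\<^sub>R (E - A)" by (simp add: algebra_simps)
      then have "dist (?p s) ((1 - s) *\<^sub>R A + s *\<^sub>R id_blinfun) = (1 - s) * norm (E - A)"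
        using s by (simp add: dist_norm)
      also have "\<dots> \<le> norm (E - A)" using s by (simp add: mult_left_le_one_le)
      finally have "(1 - s) *\<^sub>R A + s *\<^sub>R id_blinfun \<in> ball (?p s) r" using A by (simp add: norm_minus_commute)
      then show "(1 - s) *\<^sub>R A + s *\<^sub>R id_blinfun \<in> GL" using r(2) s by blast
    qed
  qed
qed

text \<open>The operator \<open>F = T0 - E0\<close> is kept while \<open>T\<close> varies. Since
  \<open>T - F\<close> stays regular near \<open>E0\<close>, the determinant of
  \<open>T o\<^sub>L binv (T - F)\<close> is continuous and nonzero on a whole ball, so its sign,
  which encodes the parity of \<open>neg_mult T\<close>, is constant there.\<close>

lemma neg_mult_locally_constant:
  fixes T0 :: "'a::banach \<Rightarrow>\<^sub>L 'a" and g0 :: "'a \<Rightarrow>\<^sub>L real"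
  assumes T0: "neg_admissible T0" and r0: "blinfun_apply g0 v0 = 1"
  obtains r where "0 < r" "\<And>T. norm (T - T0) < r \<Longrightarrow> neg_admissible T"
    "\<And>T. norm (T - T0) < r \<Longrightarrow> even (neg_mult T) \<longleftrightarrow> even (neg_mult T0)"
proof -
  obtain E0 where E0: "neg_regular E0" "finite_rank (T0 - E0)"
    by (rule neg_split_all[OF T0 r0])
  define F where "F = T0 - E0"
  have frF: "finite_rank F" using E0 by (simp add: F_def)
  obtain r1 where r1: "0 < r1" "\<And>A. norm (A - E0) < r1 \<Longrightarrow> neg_regular A" using neg_regular_near[OF E0(1)] by blast
  have GT0: "T0 \<in> GL" using T0 by (simp add: neg_admissible_def)
  obtain r2 where r2: "0 < r2" "\<And>A. norm (A - T0) < r2 \<Longrightarrow> A \<in> GL" using GL_near[OF GT0] by metis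
  define r where "r = min r1 r2"
  have reg: "neg_regular (T - F)" if "norm (T - T0) < r" for T
    by (rule r1(2)) (use that in \<open>simp add: F_def r_def algebra_simps\<close>)
  have adm: "neg_admissible T" if T: "norm (T - T0) < r" for T
  proof -
    have "Fred0 (T -\<^sub>I t)" if "t \<le> 0" for t
    proof -
      have "(T - F) -\<^sub>I t \<in> GL" using reg[OF T] that by (simp add: neg_regular_def)
      then have "Fred0 (((T - F) -\<^sub>I t) + F)" by (intro Fred0_add_finite_rank GL_imp_Fred0 frF)
      then show ?thesis by (simp add: algebra_simps)
    qed
    then show ?thesis using r2(2) T by (auto simp: neg_admissible_def r_def)
  qed
  define f where "f T = opdet (id_blinfun + (F o\<^sub>L binv (T - F)))" for T
  have feq: "f T = opdet (T o\<^sub>L binv (T - F))" if "norm (T - T0) < r" for T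
  proof -
    have G: "T - F \<in> GL" using reg[OF that] by (rule neg_regular_imp_GL)
    have "id_blinfun + (F o\<^sub>L binv (T - F)) = T o\<^sub>L binv (T - F)"
    proof (rule blinfun_eqI)
      fix x
      have "(T - F) (binv (T - F) x) = x" using G by simp
      then show "(id_blinfun + (F o\<^sub>L binv (T - F))) x = (T o\<^sub>L binv (T - F)) x"
        by (simp add: blinfun.add_left blinfun.diff_left algebra_simps)
    qed
    then show ?thesis by (simp add: f_def)
  qed
  have sgnf: "sgn (f T) = (- 1) ^ neg_mult T" if "norm (T - T0) < r" for T
    unfolding feq[OF that] by (rule sgn_opdet_neg_mult[OF adm[OF that] reg[OF that] _ r0]) (simp add: frF)
  show thesis
  proof (rule that[of r])
    show "0 < r" using r1 r2 by (simp add: r_def)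
    show "neg_admissible T" if "norm (T - T0) < r" for T by (rule adm[OF that])
    fix T assume T: "norm (T - T0) < r"
    have "sgn (f T) = sgn (f T0)"
    proof (rule sgn_eq_on_connected[of "ball T0 r"])
      have inb: "norm (x - T0) < r" if "x \<in> ball T0 r" for x using that by (simp add: dist_norm norm_minus_commute)
      have "continuous_on (ball T0 r) (\<lambda>T. binv (T - F))"
        by (rule continuous_on_compose2[OF continuous_on_binv])
          (use neg_regular_imp_GL[OF reg[OF inb]] in \<open>auto intro!: continuous_intros\<close>)
      then show "continuous_on (ball T0 r) f" unfolding f_def by (intro continuous_on_opdet frF)
      show "f x \<noteq> 0" if "x \<in> ball T0 r" for x using sgnf[OF inb[OF that]] by (metis neg_equal_0_iff_equal power_not_zero sgn_0 zero_neq_one)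
      show "T \<in> ball T0 r" "T0 \<in> ball T0 r" using T \<open>0 < r\<close> by (auto simp: dist_norm norm_minus_commute)
    qed simp
    then have "(- 1 :: real) ^ neg_mult T = (- 1) ^ neg_mult T0" using sgnf[OF T] sgnf[of T0] \<open>0 < r\<close> by simp
    then show "even (neg_mult T) \<longleftrightarrow> even (neg_mult T0)"
      by (metis neg_one_even_power neg_one_odd_power one_neq_neg_one)
  qed
qed

subsection \<open>Real spectral values of the complexification\<close>

lemma complexification_norm_bounds:
  fixes z :: "'a::real_normed_vector complexification"
  shows "norm (cos \<theta> *\<^sub>R re_part z + sin \<theta> *\<^sub>R im_part z) \<le> norm z"
    and "norm z \<le> norm (re_part z) + norm (im_part z)"
proof -
  let ?f = "\<lambda>\<theta>. norm (cos \<theta> *\<^sub>R re_part z + sin \<theta> *\<^sub>R im_part z)"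
  have b: "?f \<theta> \<le> norm (re_part z) + norm (im_part z)" for \<theta>
  proof -
    have "?f \<theta> \<le> \<bar>cos \<theta>\<bar> * norm (re_part z) + \<bar>sin \<theta>\<bar> * norm (im_part z)"
      by (metis norm_scaleR norm_triangle_ineq)
    also have "\<dots> \<le> 1 * norm (re_part z) + 1 * norm (im_part z)" by (intro add_mono mult_right_mono) auto
    finally show ?thesis by simp
  qed
  then show "norm z \<le> norm (re_part z) + norm (im_part z)"
    unfolding norm_complexification_def by (intro cSUP_least) auto
  have "bdd_above (range ?f)" using b by (intro bdd_aboveI) auto
  then show "?f \<theta> \<le> norm z" unfolding norm_complexification_def by (rule cSUP_upper[OF UNIV_I])
qed

lemma norm_Cx_0: "norm (Cx x 0) = norm x"
  using complexification_norm_bounds(1)[of 0 "Cx x 0"] complexification_norm_bounds(2)[of "Cx x 0"] by simp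

lemma complexification_eqI: "re_part z = re_part w \<Longrightarrow> im_part z = im_part w \<Longrightarrow> z = w"
  by (rule complexification.expand) simp

lemma complexification_parts [simp]:
  "re_part (z + w) = re_part z + re_part w" "im_part (z + w) = im_part z + im_part w"
  "re_part (z - w) = re_part z - re_part w" "im_part (z - w) = im_part z - im_part w"
  "re_part (a *\<^sub>R z) = a *\<^sub>R re_part z" "im_part (a *\<^sub>R z) = a *\<^sub>R im_part z"
  "re_part 0 = 0" "im_part 0 = 0"
  "re_part (scaleC c z) = Re c *\<^sub>R re_part z - Im c *\<^sub>R im_part z"
  "im_part (scaleC c z) = Re c *\<^sub>R im_part z + Im c *\<^sub>R re_part z"
  "re_part (complexify T z) = T (re_part z)" "im_part (complexify T z) = T (im_part z)"
  by (simp_all add: plus_complexification_def minus_complexification_def scaleR_complexification_def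
      zero_complexification_def scaleC_def complexify_def)

lemma complexification_sum_parts:
  "re_part (sum f I) = (\<Sum>i\<in>I. re_part (f i))" "im_part (sum f I) = (\<Sum>i\<in>I. im_part (f i))"
  by (induction I rule: infinite_finite_induct) auto

lemma complexify_shift:
  "complexify T z - scaleC (complex_of_real t) z = complexify (T -\<^sub>I t) z"
  by (rule complexification_eqI) (simp_all add: blinfun.diff_left blinfun.scaleR_left)

text \<open>A complex inverse yields a real one directly: real parts of its values provide
  preimages, and its bound gives the lower bound for \<open>A\<close>.\<close>

lemma op_spectrum_real_iff:
  fixes T :: "'a::real_normed_vector \<Rightarrow>\<^sub>L 'a"
  shows "complex_of_real t \<in> op_spectrum T \<longleftrightarrow> T -\<^sub>I t \<notin> GL"
proof -
  define A where "A = T -\<^sub>I t"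
  have "A \<in> GL \<longleftrightarrow> (\<exists>S. bounded_linear S \<and> (\<forall>a z. S (scaleC a z) = scaleC a (S z)) \<and>
               (\<forall>z. S (complexify A z) = z) \<and> (\<forall>z. complexify A (S z) = z))"
  proof
    assume A: "A \<in> GL"
    let ?S = "complexify (binv A)"
    have "bounded_linear ?S"
    proof (rule bounded_linear_intro)
      show "?S (x + y) = ?S x + ?S y" for x y by (rule complexification_eqI) (simp_all add: blinfun.add_right)
      show "?S (r *\<^sub>R x) = r *\<^sub>R ?S x" for r x by (rule complexification_eqI) (simp_all add: blinfun.scaleR_right)
      show "norm (?S z) \<le> norm z * norm (binv A)" for z
        unfolding norm_complexification_def[of "?S z"]
      proof (rule cSUP_least)
        fix \<theta>
        have "cos \<theta> *\<^sub>R re_part (?S z) + sin \<theta> *\<^sub>R im_part (?S z) = binv A (cos \<theta> *\<^sub>R re_part z + sin \<theta> *\<^sub>R im_part z)"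
          by (simp add: blinfun.add_right blinfun.scaleR_right)
        also have "norm \<dots> \<le> norm (binv A) * norm (cos \<theta> *\<^sub>R re_part z + sin \<theta> *\<^sub>R im_part z)" by (rule norm_blinfun)
        also have "\<dots> \<le> norm (binv A) * norm z" by (intro mult_left_mono complexification_norm_bounds) simp
        finally show "norm (cos \<theta> *\<^sub>R re_part (?S z) + sin \<theta> *\<^sub>R im_part (?S z)) \<le> norm z * norm (binv A)"
          by (simp add: mult.commute)
      qed simp
    qed
    moreover have "?S (scaleC a z) = scaleC a (?S z)" for a z
      by (rule complexification_eqI) (simp_all add: blinfun.add_right blinfun.diff_right blinfun.scaleR_right)
    moreover have "?S (complexify A z) = z" "complexify A (?S z) = z" for z
      using A by (auto intro!: complexification_eqI)
    ultimately show "\<exists>S. bounded_linear S \<and> (\<forall>a z. S (scaleC a z) = scaleC a (S z)) \<and>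
               (\<forall>z. S (complexify A z) = z) \<and> (\<forall>z. complexify A (S z) = z)" by blast
  next
    assume "\<exists>S. bounded_linear S \<and> (\<forall>a z. S (scaleC a z) = scaleC a (S z)) \<and>
               (\<forall>z. S (complexify A z) = z) \<and> (\<forall>z. complexify A (S z) = z)"
    then obtain S where S: "bounded_linear S" "\<And>z. S (complexify A z) = z" "\<And>z. complexify A (S z) = z" by blast
    obtain K where K: "0 < K" "\<And>z. norm (S z) \<le> norm z * K" using bounded_linear.pos_bounded[OF S(1)] by blast
    show "A \<in> GL"
    proof (rule GL_bijI)
      have "norm x \<le> K * norm (A x)" for x
      proof -
        have "complexify A (Cx x 0) = Cx (A x) 0" by (rule complexification_eqI) simp_all
        then have "S (Cx (A x) 0) = Cx x 0" using S(2) by metis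
        then show ?thesis using K(2)[of "Cx (A x) 0"] by (simp add: norm_Cx_0 mult.commute)
      qed
      then show "lower_bound_on UNIV (1 / K) A" using K(1) by (auto simp: lower_bound_on_def field_simps)
      fix y
      have "re_part (complexify A (S (Cx y 0))) = y" unfolding S(3) by simp
      then show "\<exists>x. A x = y" by auto
    qed
  qed
  then show ?thesis by (simp add: op_spectrum_def complexify_shift A_def)
qed

lemma op_eigenvalue_real_iff:
  "op_eigenvalue T (complex_of_real t) \<longleftrightarrow> (\<exists>x. x \<noteq> 0 \<and> (T -\<^sub>I t) x = 0)"
proof
  assume "op_eigenvalue T (complex_of_real t)"
  then obtain z where z: "z \<noteq> 0" "complexify T z - scaleC (complex_of_real t) z = 0" by (auto simp: op_eigenvalue_def)
  then have c: "complexify (T -\<^sub>I t) z = 0" by (simp only: complexify_shift)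
  have "(T -\<^sub>I t) (re_part z) = 0" "(T -\<^sub>I t) (im_part z) = 0"
    using arg_cong[OF c, of re_part] arg_cong[OF c, of im_part] by simp_all
  moreover have "re_part z \<noteq> 0 \<or> im_part z \<noteq> 0" using z(1) by (auto intro: complexification_eqI)
  ultimately show "\<exists>x. x \<noteq> 0 \<and> (T -\<^sub>I t) x = 0" by blast
next
  assume "\<exists>x. x \<noteq> 0 \<and> (T -\<^sub>I t) x = 0"
  then obtain x where x: "x \<noteq> 0" "T x = t *\<^sub>R x" by (auto simp: blinfun.diff_left blinfun.scaleR_left)
  have "complexify T (Cx x 0) = scaleC (complex_of_real t) (Cx x 0)"
    by (rule complexification_eqI) (simp_all add: x)
  moreover have "Cx x 0 \<noteq> 0" using x(1) by (metis complexification.sel(1) complexification_parts(7))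
  ultimately show "op_eigenvalue T (complex_of_real t)" unfolding op_eigenvalue_def by blast
qed

text \<open>A real basis of the real generalized kernel is a complex basis of its complexification.
  The dual system supplies the finite dimension that gives \<open>dim\<close> its meaning.\<close>

lemma alg_multiplicity_real:
  fixes T :: "'a::real_normed_vector \<Rightarrow>\<^sub>L 'a"
  assumes d: "dual_system k w h" and sp: "span (w ` {..<k}) = gker (T -\<^sub>I t)"
  shows "alg_multiplicity T (complex_of_real t) = dim (gker (T -\<^sub>I t))"
proof -
  interpret cv: vector_space "scaleC :: complex \<Rightarrow> 'a complexification \<Rightarrow> _" by (rule vector_space_scaleC)
  define A where "A = T -\<^sub>I t"
  define V where "V = {z. re_part z \<in> gker A \<and> im_part z \<in> gker A}"
  have pow: "(complexify A ^^ n) z = Cx ((blinfun_apply A ^^ n) (re_part z)) ((blinfun_apply A ^^ n) (im_part z))" for n z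
    by (induction n) (auto intro: complexification_eqI)
  have "{z. \<exists>n. ((\<lambda>w. complexify T w - scaleC (complex_of_real t) w) ^^ n) z = 0} = V"
    unfolding complexify_shift A_def[symmetric]
  proof (intro Set.set_eqI iffI)
    fix z assume "z \<in> {z. \<exists>n. (complexify A ^^ n) z = 0}"
    then show "z \<in> V" unfolding V_def gker_def pow zero_complexification_def by auto
  next
    fix z assume "z \<in> V"
    then obtain n m where nm: "(blinfun_apply A ^^ n) (re_part z) = 0" "(blinfun_apply A ^^ m) (im_part z) = 0"
      by (auto simp: V_def gker_def)
    have "(blinfun_apply A ^^ (n + m)) (re_part z) = 0" "(blinfun_apply A ^^ (n + m)) (im_part z) = 0"
      using nm by (auto intro: funpow_zero_mono)
    then have "(complexify A ^^ (n + m)) z = 0" unfolding pow zero_complexification_def by simp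
    then show "z \<in> {z. \<exists>n. (complexify A ^^ n) z = 0}" by blast
  qed
  then have am: "alg_multiplicity T (complex_of_real t) = cv.dim V" by (simp add: alg_multiplicity_def)
  define b where "b i = Cx (w i) 0" for i
  have wg: "w i \<in> gker A" if "i < k" for i unfolding A_def sp[symmetric] using that by (auto intro: span_base)
  have inj: "inj_on b {..<k}"
  proof (rule inj_onI)
    fix i j assume ij: "i \<in> {..<k}" "j \<in> {..<k}" "b i = b j"
    then have "h i (w i) = h i (w j)" by (simp add: b_def)
    then show "i = j" using d ij(1,2) by (auto simp: dual_system_def split: if_splits)
  qed
  have zero: "c i = 0" if s: "(\<Sum>j<k. scaleC (c j) (b j)) = 0" and i: "i < k" for c i
  proof -
    have "(\<Sum>j<k. Re (c j) *\<^sub>R w j) = 0" "(\<Sum>j<k. Im (c j) *\<^sub>R w j) = 0"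
      using arg_cong[OF s, of re_part] arg_cong[OF s, of im_part] by (simp_all add: complexification_sum_parts b_def)
    then have "Re (c i) = 0" "Im (c i) = 0"
      using dual_system_coord[OF d i, of "\<lambda>j. Re (c j)"] dual_system_coord[OF d i, of "\<lambda>j. Im (c j)"] by simp_all
    then show ?thesis by (simp add: complex_eq_iff)
  qed
  have "cv.dim V = k"
  proof (rule cv.dim_unique)
    show "b ` {..<k} \<subseteq> V" using wg subspace_0[OF subspace_gker] by (auto simp: V_def b_def)
    show "V \<subseteq> cv.span (b ` {..<k})"
    proof
      fix z assume "z \<in> V"
      then have "re_part z \<in> span (w ` {..<k})" "im_part z \<in> span (w ` {..<k})" by (auto simp: V_def sp A_def)
      then have e: "re_part z = (\<Sum>i<k. h i (re_part z) *\<^sub>R w i)" "im_part z = (\<Sum>i<k. h i (im_part z) *\<^sub>R w i)"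
        using dual_system_expand[OF d] by blast+
      have "z = (\<Sum>i<k. scaleC (Complex (h i (re_part z)) (h i (im_part z))) (b i))"
        by (rule complexification_eqI)
          (simp_all add: complexification_sum_parts b_def e[symmetric])
      also have "\<dots> \<in> cv.span (b ` {..<k})" by (intro cv.span_sum cv.span_scale cv.span_base) auto
      finally show "z \<in> cv.span (b ` {..<k})" .
    qed
    show "cv.independent (b ` {..<k})"
    proof (rule cv.independent_if_scalars_zero)
      fix f x assume s: "(\<Sum>x\<in>b ` {..<k}. scaleC (f x) x) = 0" and x: "x \<in> b ` {..<k}"
      then obtain i where i: "i < k" "x = b i" by auto
      have "(\<Sum>j<k. scaleC (f (b j)) (b j)) = 0" using s inj by (simp add: sum.reindex)
      then show "f x = 0" using zero[of "\<lambda>j. f (b j)" i] i by simp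
    qed simp
    show "card (b ` {..<k}) = k" by (simp add: card_image[OF inj])
  qed
  moreover have "dim (gker A) = k" using dual_system_dim[OF d] sp by (simp add: A_def)
  ultimately show ?thesis using am by (simp add: A_def)
qed

section \<open>Parities of the negative, positive and all real eigenvalues\<close>

lemma gker_uminus: "gker (- A) = gker A"
proof -
  have "(blinfun_apply (- A) ^^ n) x = (- 1) ^ n *\<^sub>R (blinfun_apply A ^^ n) x" for n x
  proof (induction n)
    case (Suc n)
    then show ?case by (simp add: blinfun.minus_left blinfun.scaleR_right)
  qed simp
  then show ?thesis by (auto simp: gker_def)
qed

lemma gker_dual_system:
  fixes T :: "'a::banach \<Rightarrow>\<^sub>L 'a"
  assumes T: "neg_admissible T" and t: "t \<le> 0"
  obtains k w h where "dual_system k w h" "span (w ` {..<k}) = gker (T -\<^sub>I t)"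
proof -
  obtain r m c where rmc: "0 < r" "0 < c" "\<And>e x. 0 < \<bar>e\<bar> \<Longrightarrow> \<bar>e\<bar> < r \<Longrightarrow>
        c * \<bar>e\<bar> ^ m * norm x \<le> norm (((T -\<^sub>I t) -\<^sub>I e) x)"
    by (rule neg_admissible_isolated[OF T t]) auto
  have "Fred0 (T -\<^sub>I t)" using T t by (auto simp: neg_admissible_def)
  moreover have "(blinfun_apply (T -\<^sub>I t) ^^ m) x = 0" if "x \<in> gker (T -\<^sub>I t)" for x
    by (rule ascent_le[OF rmc that])
  ultimately show thesis by (rule riesz_projection) (assumption, rule that)
qed

lemma Fred0_uminus_iff: "Fred0 (- A) \<longleftrightarrow> Fred0 A"
  using Fred0_scaleR[of A "-1"] Fred0_scaleR[of "- A" "-1"] by auto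

lemma uminus_shift: "- (- T -\<^sub>I t) = T -\<^sub>I (- t)"
  by simp

lemma gker_uminus_shift: "gker (- T -\<^sub>I t) = gker (T -\<^sub>I (- t))"
  using gker_uminus[of "- T -\<^sub>I t"] unfolding uminus_shift by simp

lemma GL_uminus_shift: "- T -\<^sub>I t \<in> GL \<longleftrightarrow> T -\<^sub>I (- t) \<in> GL"
  using GL_uminus_iff[of "- T -\<^sub>I t"] unfolding uminus_shift by simp

lemma Fred0_uminus_shift: "Fred0 (- T -\<^sub>I t) \<longleftrightarrow> Fred0 (T -\<^sub>I (- t))"
  using Fred0_uminus_iff[of "- T -\<^sub>I t"] unfolding uminus_shift by simp

lemma parity_on_eq:
  fixes T :: "'a::banach \<Rightarrow>\<^sub>L 'a"
  assumes F: "\<And>t. t \<in> I \<Longrightarrow> Fred0 (T -\<^sub>I t)"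
    and g: "\<And>t. t \<in> I \<Longrightarrow> \<exists>k w h. dual_system k w h \<and> span (w ` {..<k}) = gker (T -\<^sub>I t)"
  shows "parity_on I T = of_nat (\<Sum>t | t \<in> I \<and> T -\<^sub>I t \<notin> GL. dim (gker (T -\<^sub>I t)))"
proof -
  have "op_eigenvalue T (complex_of_real t) \<longleftrightarrow> T -\<^sub>I t \<notin> GL" if "t \<in> I" for t
    unfolding op_eigenvalue_real_iff using Fred0_inj_GL[OF F[OF that]] GL_injective by blast
  then have "{t. t \<in> I \<and> op_eigenvalue T (complex_of_real t)} = {t. t \<in> I \<and> T -\<^sub>I t \<notin> GL}" by blast
  moreover have "alg_multiplicity T (complex_of_real t) = dim (gker (T -\<^sub>I t))" if "t \<in> I" for t
    using g[OF that] alg_multiplicity_real by blast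
  ultimately show ?thesis unfolding parity_on_def by (intro arg_cong[of _ _ of_nat] sum.cong) auto
qed

lemma parity_on_negative:
  fixes T :: "'a::banach \<Rightarrow>\<^sub>L 'a"
  assumes T: "neg_admissible T"
  shows "parity_on {..<0} T = of_nat (neg_mult T)"
proof -
  have "parity_on {..<0} T = of_nat (\<Sum>t | t \<in> {..<0} \<and> T -\<^sub>I t \<notin> GL. dim (gker (T -\<^sub>I t)))"
  proof (rule parity_on_eq)
    fix t :: real assume t: "t \<in> {..<0}"
    show "Fred0 (T -\<^sub>I t)" using T t by (auto simp: neg_admissible_def)
    show "\<exists>k w h. dual_system k w h \<and> span (w ` {..<k}) = gker (T -\<^sub>I t)"
      by (rule gker_dual_system[OF T, of t]) (use t in auto)
  qed
  then show ?thesis by (simp add: neg_mult_def neg_points_def)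
qed

lemma parity_on_positive:
  fixes T :: "'a::banach \<Rightarrow>\<^sub>L 'a"
  assumes T: "neg_admissible (- T)"
  shows "parity_on {0<..} T = of_nat (neg_mult (- T))"
proof -
  have "parity_on {0<..} T = of_nat (\<Sum>t | t \<in> {0<..} \<and> T -\<^sub>I t \<notin> GL. dim (gker (T -\<^sub>I t)))"
  proof (rule parity_on_eq)
    fix t :: real assume t: "t \<in> {0<..}"
    have "Fred0 (- T -\<^sub>I s)" if "s \<le> 0" for s using T that by (auto simp: neg_admissible_def)
    from this[of "- t"] show "Fred0 (T -\<^sub>I t)" using t unfolding Fred0_uminus_shift by simp
    show "\<exists>k w h. dual_system k w h \<and> span (w ` {..<k}) = gker (T -\<^sub>I t)"
      by (rule gker_dual_system[OF T, of "- t"]) (use t gker_uminus_shift[of T "- t"] in auto)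
  qed
  also have "(\<Sum>t | t \<in> {0<..} \<and> T -\<^sub>I t \<notin> GL. dim (gker (T -\<^sub>I t))) = neg_mult (- T)"
    unfolding neg_mult_def neg_points_def gker_uminus_shift GL_uminus_shift
    by (rule sum.reindex_bij_witness[of _ uminus uminus]) auto
  finally show ?thesis .
qed

text \<open>Shifting by \<open>c > norm T\<close> moves all real spectral values to the negative half-line.\<close>

lemma neg_admissible_shift:
  fixes T :: "'a::banach \<Rightarrow>\<^sub>L 'a"
  assumes F: "\<And>t. Fred0 (T -\<^sub>I t)" and c: "norm T < c"
  shows "neg_admissible (T -\<^sub>I c)"
proof -
  have "norm T < \<bar>c\<bar>" using c by simp
  from GL_shift[OF this] show ?thesis unfolding neg_admissible_def shift_shift using F by auto
qed

lemma real_mult_eq_shift: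
  fixes T :: "'a::banach \<Rightarrow>\<^sub>L 'a"
  assumes c: "norm T < c"
  shows "(\<Sum>t | T -\<^sub>I t \<notin> GL. dim (gker (T -\<^sub>I t))) = neg_mult (T -\<^sub>I c)"
proof -
  have "t < c" if "T -\<^sub>I t \<notin> GL" for t
  proof -
    have "\<not> norm T < \<bar>t\<bar>" using GL_shift[of T t] that by blast
    then show ?thesis using c by linarith
  qed
  then show ?thesis
    unfolding neg_mult_def neg_points_def shift_shift
    by (intro sum.reindex_bij_witness[of _ "\<lambda>t. c + t" "\<lambda>t. t - c"]) auto
qed

lemma parity_on_UNIV:
  fixes T :: "'a::banach \<Rightarrow>\<^sub>L 'a"
  assumes F: "\<And>t. Fred0 (T -\<^sub>I t)" and c: "norm T < c"
  shows "parity_on UNIV T = of_nat (neg_mult (T -\<^sub>I c))"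
proof -
  have "parity_on UNIV T = of_nat (\<Sum>t | t \<in> UNIV \<and> T -\<^sub>I t \<notin> GL. dim (gker (T -\<^sub>I t)))"
  proof (rule parity_on_eq)
    fix t :: real
    \<comment> \<open>As \<open>c'\<close> dominates both \<open>c\<close> and \<open>t\<close>, the
      point \<open>t - c'\<close> lies in the half-line where the shifted operator has
      finite-dimensional generalized kernels.\<close>
    define c' where "c' = max c t"
    have "norm T < c'" "t - c' \<le> 0" using c by (auto simp: c'_def)
    moreover have "(T -\<^sub>I c') -\<^sub>I (t - c') = T -\<^sub>I t"
      unfolding shift_shift by simp
    ultimately show "\<exists>k w h. dual_system k w h \<and> span (w ` {..<k}) = gker (T -\<^sub>I t)"
      using gker_dual_system[OF neg_admissible_shift[OF F], of c' "t - c'"] by metis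
  qed (rule F)
  then show ?thesis using real_mult_eq_shift[OF c] by simp
qed

lemma real_mult_eq_sum:
  fixes T :: "'a::banach \<Rightarrow>\<^sub>L 'a"
  assumes T: "neg_admissible T" "neg_admissible (- T)"
  shows "(\<Sum>t | T -\<^sub>I t \<notin> GL. dim (gker (T -\<^sub>I t))) = neg_mult T + neg_mult (- T)"
proof -
  have "neg_points (- T) = uminus ` {t. 0 < t \<and> T -\<^sub>I t \<notin> GL}"
    unfolding neg_points_def GL_uminus_shift by (force intro: image_eqI[of _ _ "- _"])
  then have f2: "finite {t. 0 < t \<and> T -\<^sub>I t \<notin> GL}"
    using finite_neg_points[OF T(2)] by (auto dest!: finite_imageD)
  have "T \<in> GL" using T(1) by (simp add: neg_admissible_def)
  then have split: "{t. T -\<^sub>I t \<notin> GL} = neg_points T \<union> {t. 0 < t \<and> T -\<^sub>I t \<notin> GL}"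
  proof (intro Set.set_eqI)
    fix t show "t \<in> {t. T -\<^sub>I t \<notin> GL} \<longleftrightarrow> t \<in> neg_points T \<union> {t. 0 < t \<and> T -\<^sub>I t \<notin> GL}"
      using \<open>T \<in> GL\<close> by (cases t "0::real" rule: linorder_cases) (auto simp: neg_points_def)
  qed
  have "(\<Sum>t | T -\<^sub>I t \<notin> GL. dim (gker (T -\<^sub>I t))) =
    neg_mult T + (\<Sum>t | 0 < t \<and> T -\<^sub>I t \<notin> GL. dim (gker (T -\<^sub>I t)))"
    unfolding split neg_mult_def
    by (rule sum.union_disjoint) (use finite_neg_points[OF T(1)] f2 in \<open>auto simp: neg_points_def\<close>)
  also have "(\<Sum>t | 0 < t \<and> T -\<^sub>I t \<notin> GL. dim (gker (T -\<^sub>I t))) = neg_mult (- T)"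
    unfolding neg_mult_def neg_points_def gker_uminus_shift GL_uminus_shift
    by (rule sum.reindex_bij_witness[of _ uminus uminus]) auto
  finally show ?thesis .
qed

subsection \<open>Parity on even spaces\<close>

lemma of_nat_bit: "(of_nat n :: bit) = (if even n then 0 else 1)"
  by (induction n) auto

locale complex_hi_banach = hi_banach X for X :: "'a::banach itself" +
  fixes J :: "'a \<Rightarrow>\<^sub>L 'a"
  assumes J: "\<And>x. J (J x) = - x"
begin

text \<open>Division in the copy of the complex numbers generated by \<open>J\<close>: the conjugate
  \<open>b - a J\<close> gives the product \<open>a * a + b * b\<close>.\<close>

lemma complex_combination_GL:
  assumes "a \<noteq> 0 \<or> b \<noteq> 0"
  shows "a *\<^sub>R J + b *\<^sub>R id_blinfun \<in> GL"
proof -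
  define d where "d = a * a + b * b"
  have d: "d \<noteq> 0" using assms by (auto simp: d_def add_nonneg_eq_0_iff)
  define S where "S = inverse d *\<^sub>R (b *\<^sub>R id_blinfun - a *\<^sub>R J)"
  have "b *\<^sub>R b *\<^sub>R x + a *\<^sub>R a *\<^sub>R x = d *\<^sub>R x" for x :: 'a by (simp add: d_def scaleR_add_left)
  then have e: "inverse d *\<^sub>R (b *\<^sub>R b *\<^sub>R x) + inverse d *\<^sub>R (a *\<^sub>R a *\<^sub>R x) = x" for x :: 'a
    using d by (metis scaleR_add_right left_inverse scaleR_one scaleR_scaleR)
  have "(a *\<^sub>R J + b *\<^sub>R id_blinfun) o\<^sub>L S = id_blinfun"
  proof (rule blinfun_eqI)
    fix x
    show "((a *\<^sub>R J + b *\<^sub>R id_blinfun) o\<^sub>L S) x = id_blinfun x"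
      using e[of x] by (simp add: S_def blinfun.add_left blinfun.diff_left blinfun.scaleR_left blinfun.diff_right
          blinfun.scaleR_right J algebra_simps)
  qed
  moreover have "S o\<^sub>L (a *\<^sub>R J + b *\<^sub>R id_blinfun) = id_blinfun"
  proof (rule blinfun_eqI)
    fix x
    show "(S o\<^sub>L (a *\<^sub>R J + b *\<^sub>R id_blinfun)) x = id_blinfun x"
      using e[of x] by (simp add: S_def blinfun.add_left blinfun.diff_left blinfun.scaleR_left blinfun.add_right
          blinfun.scaleR_right J algebra_simps)
  qed
  ultimately show ?thesis by (auto simp: GL_def)
qed

lemma strictly_singular_shift_segment:
  fixes T :: "'a \<Rightarrow>\<^sub>L 'a"
  assumes T: "\<And>t. Fred0 (T -\<^sub>I t)" and s: "s \<in> {0..1}"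
    and ss: "strictly_singular (((1 - s) *\<^sub>R T + s *\<^sub>R J) -\<^sub>I t)"
  shows "0 < s \<and> s < 1"
proof -
  have "s \<noteq> 0" using ss T[of t] by (auto simp: Fred0_iff_not_strictly_singular)
  moreover have "s \<noteq> 1"
  proof
    assume "s = 1"
    then have "strictly_singular (1 *\<^sub>R J + (- t) *\<^sub>R id_blinfun)" using ss by simp
    then show False
      using Fred0_imp_not_strictly_singular[OF GL_imp_Fred0[OF complex_combination_GL[of 1 "- t"]]] by simp
  qed
  ultimately show ?thesis using s by auto
qed

text \<open>If the segment from \<open>T\<close> to \<open>J\<close> meets the real multiples of the identity modulo strictly singular
  operators, then \<open>T\<close> is \<open>a J + b\<close> modulo these with \<open>a < 0\<close>, so the segment to \<open>- J\<close> does not.\<close>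

lemma segment_avoids_reals:
  fixes T :: "'a \<Rightarrow>\<^sub>L 'a"
  assumes T: "\<And>t. Fred0 (T -\<^sub>I t)"
  obtains u where "u = 1 \<or> u = -1"
    "\<And>s t. s \<in> {0..1} \<Longrightarrow> Fred0 (((1 - s) *\<^sub>R T + s *\<^sub>R (u *\<^sub>R J)) -\<^sub>I t)"
proof (cases "\<forall>s\<in>{0..1}. \<forall>t. Fred0 (((1 - s) *\<^sub>R T + s *\<^sub>R (1 *\<^sub>R J)) -\<^sub>I t)")
  case True
  then show thesis by (intro that[of 1]) auto
next
  case False
  then obtain s t where s: "s \<in> {0..1}" and ss: "strictly_singular (((1 - s) *\<^sub>R T + s *\<^sub>R J) -\<^sub>I t)"
    by (auto simp: Fred0_iff_not_strictly_singular)
  have s01: "0 < s" "s < 1" using strictly_singular_shift_segment[OF T s ss] by auto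
  show thesis
  proof (rule that[of "-1"])
    fix r q :: real assume r: "r \<in> {0..1}"
    show "Fred0 (((1 - r) *\<^sub>R T + r *\<^sub>R (- 1 *\<^sub>R J)) -\<^sub>I q)"
    proof (rule ccontr)
      assume "\<not> ?thesis"
      then have "strictly_singular (((1 - r) *\<^sub>R T + r *\<^sub>R (- 1 *\<^sub>R J)) -\<^sub>I q)"
        by (simp only: Fred0_iff_not_strictly_singular not_not)
      \<comment> \<open>The weights eliminate \<open>T\<close>; what remains is a positive multiple
        of \<open>J\<close> plus a multiple of the identity, hence invertible.\<close>
      then have "strictly_singular ((1 - r) *\<^sub>R (((1 - s) *\<^sub>R T + s *\<^sub>R J) -\<^sub>I t) -
          (1 - s) *\<^sub>R (((1 - r) *\<^sub>R T + r *\<^sub>R (- 1 *\<^sub>R J)) -\<^sub>I q))"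
        by (rule strictly_singular_diff[OF strictly_singular_scaleR[OF ss] strictly_singular_scaleR])
      also have "(1 - r) *\<^sub>R (((1 - s) *\<^sub>R T + s *\<^sub>R J) -\<^sub>I t) -
          (1 - s) *\<^sub>R (((1 - r) *\<^sub>R T + r *\<^sub>R (- 1 *\<^sub>R J)) -\<^sub>I q) =
        ((1 - r) * s + (1 - s) * r) *\<^sub>R J + ((1 - s) * q - (1 - r) * t) *\<^sub>R id_blinfun"
        by (rule blinfun_eqI, simp add: blinfun.add_left blinfun.diff_left blinfun.scaleR_left blinfun.minus_left
            algebra_simps, simp flip: scaleR_add_left)
      finally have "strictly_singular (((1 - r) * s + (1 - s) * r) *\<^sub>R J + ((1 - s) * q - (1 - r) * t) *\<^sub>R id_blinfun)" .
      moreover have "0 < (1 - r) * s + (1 - s) * r"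
      proof (cases "r = 0")
        case False
        then show ?thesis using r s01 by (intro add_nonneg_pos mult_nonneg_nonneg mult_pos_pos) auto
      qed (use s01 in auto)
      ultimately show False
        using complex_combination_GL GL_imp_Fred0 Fred0_iff_not_strictly_singular by (metis less_irrefl)
    qed
  qed simp
qed

lemma exists_unit_pair:
  obtains g0 :: "'a \<Rightarrow>\<^sub>L real" and v0 where "g0 v0 = 1"
proof -
  have "\<exists>v::'a. v \<noteq> 0"
  proof (rule ccontr)
    assume "\<not> ?thesis"
    then have "(UNIV :: 'a set) \<subseteq> span {}" by auto
    then show False using inf_dim unfolding infinite_dimensional_def by blast
  qed
  then obtain v :: 'a where v: "v \<notin> {0}" by auto
  obtain g0 :: "'a \<Rightarrow>\<^sub>L real" where "g0 v = 1"
    by (rule separating_functional[OF subspace_single_0 _ v]) auto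
  then show thesis by (rule that)
qed

lemma even_real_mult:
  fixes T :: "'a \<Rightarrow>\<^sub>L 'a"
  assumes T: "\<And>t. Fred0 (T -\<^sub>I t)"
  shows "even (\<Sum>t | T -\<^sub>I t \<notin> GL. dim (gker (T -\<^sub>I t)))"
proof -
  obtain u where u: "u = 1 \<or> u = -1"
    "\<And>s t. s \<in> {0..1} \<Longrightarrow> Fred0 (((1 - s) *\<^sub>R T + s *\<^sub>R (u *\<^sub>R J)) -\<^sub>I t)"
    using segment_avoids_reals[OF T] by blast
  \<comment> \<open>This exceeds the norm along the whole segment, so after a single shift
    \<open>neg_mult\<close> counts all real eigenvalues of each operator on it.\<close>
  define c where "c = norm T + norm J + 1"
  have c: "norm T < c" "norm J < c" using norm_ge_zero[of T] norm_ge_zero[of J] unfolding c_def by linarith+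
  define p where "p s = ((1 - s) *\<^sub>R T + s *\<^sub>R (u *\<^sub>R J)) -\<^sub>I c" for s
  have adm: "neg_admissible (p s)" if s: "s \<in> {0..1}" for s
    unfolding p_def
  proof (rule neg_admissible_shift[OF u(2)[OF s]])
    have "norm ((1 - s) *\<^sub>R T + s *\<^sub>R (u *\<^sub>R J)) \<le> (1 - s) * norm T + s * norm J"
      using norm_triangle_ineq[of "(1 - s) *\<^sub>R T" "s *\<^sub>R (u *\<^sub>R J)"] s u(1) by auto
    also have "\<dots> \<le> 1 * norm T + 1 * norm J" using s by (intro add_mono mult_right_mono) auto
    finally show "norm ((1 - s) *\<^sub>R T + s *\<^sub>R (u *\<^sub>R J)) < c" by (simp add: c_def)
  qed
  obtain g0 :: "'a \<Rightarrow>\<^sub>L real" and v0 where g0: "g0 v0 = 1" by (rule exists_unit_pair)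
  have "connected (p ` {0..1})"
    unfolding p_def by (intro connected_continuous_image continuous_intros) simp
  moreover have "\<forall>A\<in>p ` {0..1}. eventually (\<lambda>B. even (neg_mult A) = even (neg_mult B)) (at A within p ` {0..1})"
  proof
    fix A assume "A \<in> p ` {0..1}"
    then have "neg_admissible A" using adm by auto
    then obtain r where r: "0 < r" "\<And>B. norm (B - A) < r \<Longrightarrow> even (neg_mult B) \<longleftrightarrow> even (neg_mult A)"
      using neg_mult_locally_constant[OF _ g0] by metis
    then show "eventually (\<lambda>B. even (neg_mult A) = even (neg_mult B)) (at A within p ` {0..1})"
      unfolding eventually_at dist_norm using r by blast
  qed
  ultimately have "even (neg_mult (p 0)) = even (neg_mult (p 1))"
    by (intro connected_local_const[of "p ` {0..1}" "p 0" "p 1" "\<lambda>A. even (neg_mult A)"]) auto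
  moreover have "neg_points (p 1) = {}"
  proof -
    have "p 1 -\<^sub>I t \<in> GL" for t
    proof -
      have "u \<noteq> 0" using u(1) by auto
      then show ?thesis using complex_combination_GL[of u "- (c + t)"] by (simp add: p_def algebra_simps)
    qed
    then show ?thesis by (auto simp: neg_points_def)
  qed
  then have "neg_mult (p 1) = 0" by (simp add: neg_mult_def)
  ultimately have "even (neg_mult (p 0))" by simp
  then show ?thesis using real_mult_eq_shift[OF c(1)] by (simp add: p_def)
qed

section \<open>Evaluation of the parity invariant\<close>

lemma ss_proj_eq_iff:
  fixes A B :: "'a \<Rightarrow>\<^sub>L 'a"
  shows "ss_proj A = ss_proj B \<longleftrightarrow> strictly_singular (A - B)"
proof
  assume "ss_proj A = ss_proj B"
  moreover have "A + 0 \<in> ss_proj A" using strictly_singular_zero unfolding ss_proj_def by blast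
  ultimately obtain S where "A + 0 = B + S" "strictly_singular S" unfolding ss_proj_def by blast
  then show "strictly_singular (A - B)" by simp
next
  assume AB: "strictly_singular (A - B)"
  have sub: "ss_proj A \<subseteq> ss_proj B" if AB: "strictly_singular (A - B)" for A B :: "'a \<Rightarrow>\<^sub>L 'a"
  proof
    fix C assume "C \<in> ss_proj A"
    then obtain S where S: "C = A + S" "strictly_singular S" by (auto simp: ss_proj_def)
    then have "C = B + ((A - B) + S)" "strictly_singular ((A - B) + S)"
      using strictly_singular_add[OF AB S(2)] by simp_all
    then show "C \<in> ss_proj B" unfolding ss_proj_def by blast
  qed
  show "ss_proj A = ss_proj B"
    using sub[OF AB] sub[of B A] strictly_singular_uminus[OF AB] by auto
qed

lemma ss_proj_notin_reals_iff:
  fixes T :: "'a \<Rightarrow>\<^sub>L 'a"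
  shows "ss_proj T \<notin> (\<lambda>t. ss_proj (t *\<^sub>R id_blinfun)) ` I \<longleftrightarrow> (\<forall>t\<in>I. Fred0 (T -\<^sub>I t))"
  by (auto simp: ss_proj_eq_iff Fred0_iff_not_strictly_singular)

text \<open>The frontier of the half-line is the single point \<open>0\<close>, so the spectral
  condition says that \<open>T\<close> is invertible.\<close>

lemma NS_negative_iff:
  fixes T :: "'a \<Rightarrow>\<^sub>L 'a"
  shows "T \<in> NS {..<0} \<longleftrightarrow> neg_admissible T"
proof -
  have "op_spectrum T \<inter> complex_of_real ` frontier {..<0} = {} \<longleftrightarrow> T \<in> GL"
    using op_spectrum_real_iff[of 0 T] by simp
  then show ?thesis
    unfolding NS_def neg_admissible_def using ss_proj_notin_reals_iff[of T "{..<0}"] GL_imp_Fred0[of T]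
    by (auto simp: le_less)
qed

lemma NS_positive_iff:
  fixes T :: "'a \<Rightarrow>\<^sub>L 'a"
  shows "T \<in> NS {0<..} \<longleftrightarrow> neg_admissible (- T)"
proof -
  have 1: "op_spectrum T \<inter> complex_of_real ` frontier {0<..} = {} \<longleftrightarrow> T \<in> GL"
    using op_spectrum_real_iff[of 0 T] by simp
  have "(\<forall>t\<le>0. Fred0 (- T -\<^sub>I t)) \<longleftrightarrow> (\<forall>t\<ge>0. Fred0 (T -\<^sub>I t))"
    unfolding Fred0_uminus_shift by (metis add.inverse_inverse neg_0_le_iff_le neg_le_0_iff_le)
  then show ?thesis
    unfolding NS_def neg_admissible_def using 1 ss_proj_notin_reals_iff[of T "{0<..}"] GL_imp_Fred0[of T]
    by (auto simp: le_less)
qed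

lemma NS_UNIV_iff:
  fixes T :: "'a \<Rightarrow>\<^sub>L 'a"
  shows "T \<in> NS UNIV \<longleftrightarrow> (\<forall>t. Fred0 (T -\<^sub>I t))"
  unfolding NS_def using ss_proj_notin_reals_iff[of T UNIV] by simp

text \<open>\<open>J\<close> has no real spectrum, so it witnesses that \<open>NS UNIV\<close> is
  nonempty; this is what determines the definite description.\<close>

lemma space_Par_eq_0: "space_Par TYPE('a) = 0"
  unfolding space_Par_def
proof (rule the_equality)
  have z: "parity_on UNIV T = 0" if "T \<in> NS UNIV" for T :: "'a \<Rightarrow>\<^sub>L 'a"
  proof -
    have F: "Fred0 (T -\<^sub>I t)" for t using that by (simp add: NS_UNIV_iff)
    have c: "norm T < norm T + 1" by simp
    show ?thesis
      unfolding parity_on_UNIV[OF F c] using even_real_mult[OF F] unfolding real_mult_eq_shift[OF c]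
      by (simp add: of_nat_bit)
  qed
  then show "\<forall>T\<in>(NS UNIV :: ('a \<Rightarrow>\<^sub>L 'a) set). parity_on UNIV T = 0" by blast
  have "J -\<^sub>I t \<in> GL" for t using complex_combination_GL[of 1 "- t"] by simp
  then have "J \<in> NS UNIV" by (simp add: NS_UNIV_iff GL_imp_Fred0)
  then show "p = 0" if "\<forall>T\<in>(NS UNIV :: ('a \<Rightarrow>\<^sub>L 'a) set). parity_on UNIV T = p" for p
    using that z by metis
qed

text \<open>With \<open>0\<close> outside the spectrum, the two multiplicities add up to that of all
  real eigenvalues, which is even. This is the compatibility of the two clauses of
  \<open>Par\<close>.\<close>

lemma neg_mult_parity_agrees:
  fixes T :: "'a \<Rightarrow>\<^sub>L 'a"
  assumes T: "neg_admissible T" "neg_admissible (- T)"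
  shows "even (neg_mult T) \<longleftrightarrow> even (neg_mult (- T))"
proof -
  have "Fred0 (T -\<^sub>I t)" for t
  proof (cases "t \<le> 0")
    case True
    then show ?thesis using T(1) by (auto simp: neg_admissible_def)
  next
    case False
    then have "T \<in> NS {0<..}" "t \<in> {0<..}" using T(2) by (auto simp: NS_positive_iff)
    then show ?thesis using ss_proj_notin_reals_iff[of T "{0<..}"] by (auto simp: NS_def)
  qed
  then show ?thesis using even_real_mult[of T] real_mult_eq_sum[OF T] by simp
qed

lemma Par_negative:
  fixes T :: "'a \<Rightarrow>\<^sub>L 'a"
  assumes "neg_admissible T"
  shows "Par T = of_nat (neg_mult T)"
  unfolding Par_def
proof (rule the_equality)
  show "(T \<in> NS {..<0} \<longrightarrow> of_nat (neg_mult T) = parity_on {..<0} T) \<and>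
        (T \<in> NS {0<..} \<longrightarrow> of_nat (neg_mult T) = space_Par TYPE('a) - parity_on {0<..} T)"
    using neg_mult_parity_agrees[OF assms]
    by (auto simp: NS_positive_iff parity_on_negative[OF assms] parity_on_positive space_Par_eq_0 of_nat_bit)
qed (use assms in \<open>auto simp: NS_negative_iff parity_on_negative\<close>)

lemma Par_positive:
  fixes T :: "'a \<Rightarrow>\<^sub>L 'a"
  assumes "neg_admissible (- T)"
  shows "Par T = of_nat (neg_mult (- T))"
  unfolding Par_def
proof (rule the_equality)
  show "(T \<in> NS {..<0} \<longrightarrow> of_nat (neg_mult (- T)) = parity_on {..<0} T) \<and>
        (T \<in> NS {0<..} \<longrightarrow> of_nat (neg_mult (- T)) = space_Par TYPE('a) - parity_on {0<..} T)"
    using neg_mult_parity_agrees[OF _ assms]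
    by (auto simp: NS_negative_iff parity_on_negative parity_on_positive[OF assms] space_Par_eq_0 of_nat_bit)
qed (use assms in \<open>auto simp: NS_positive_iff parity_on_positive space_Par_eq_0\<close>)

text \<open>If both failed, \<open>T\<close> would be \<open>s\<close> and \<open>- T\<close> would
  be \<open>t\<close> modulo strictly singular operators, with \<open>s < 0\<close> and
  \<open>t \<le> 0\<close>; adding the two makes a nonzero multiple of the identity strictly
  singular.\<close>

lemma GL_cases:
  fixes T :: "'a \<Rightarrow>\<^sub>L 'a"
  assumes "T \<in> GL"
  shows "neg_admissible T \<or> neg_admissible (- T)"
proof (rule ccontr)
  assume "\<not> ?thesis"
  then obtain s t where s: "s \<le> 0" "strictly_singular (T -\<^sub>I s)"
    and t: "t \<le> 0" "strictly_singular (- T -\<^sub>I t)"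
    using assms by (auto simp: neg_admissible_def Fred0_iff_not_strictly_singular)
  have ns: "\<not> strictly_singular A" if "A \<in> GL" for A :: "'a \<Rightarrow>\<^sub>L 'a"
    using that GL_imp_Fred0 Fred0_iff_not_strictly_singular by blast
  have "s \<noteq> 0" using s(2) ns[OF assms] by auto
  then have "- (s + t) \<noteq> 0" using s(1) t(1) by linarith
  then have "- (s + t) *\<^sub>R id_blinfun \<in> (GL :: ('a \<Rightarrow>\<^sub>L 'a) set)" by (intro GL_scaleR GL_id)
  moreover have "strictly_singular ((T -\<^sub>I s) + (- T -\<^sub>I t))"
    by (rule strictly_singular_add[OF s(2) t(2)])
  moreover have "(T -\<^sub>I s) + (- T -\<^sub>I t) = - (s + t) *\<^sub>R id_blinfun"
    by (simp add: scaleR_diff_left)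
  ultimately show False using ns by metis
qed

lemma Par_locally_constant:
  fixes T0 :: "'a \<Rightarrow>\<^sub>L 'a"
  assumes "T0 \<in> GL"
  obtains r where "0 < r" "\<And>T. norm (T - T0) < r \<Longrightarrow> Par T = Par T0"
proof -
  obtain g0 :: "'a \<Rightarrow>\<^sub>L real" and v0 where g0: "g0 v0 = 1" by (rule exists_unit_pair)
  consider "neg_admissible T0" | "neg_admissible (- T0)" using GL_cases[OF assms] by blast
  then show thesis
  proof cases
    case 1
    obtain r where r: "0 < r" "\<And>T. norm (T - T0) < r \<Longrightarrow> neg_admissible T"
      "\<And>T. norm (T - T0) < r \<Longrightarrow> even (neg_mult T) \<longleftrightarrow> even (neg_mult T0)"
      using neg_mult_locally_constant[OF 1 g0] by metis
    show thesis
    proof (rule that[OF r(1)])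
      fix T assume "norm (T - T0) < r"
      then show "Par T = Par T0" using r(2,3)[of T] by (simp add: Par_negative 1 of_nat_bit)
    qed
  next
    case 2
    obtain r where r: "0 < r" "\<And>T. norm (T - - T0) < r \<Longrightarrow> neg_admissible T"
      "\<And>T. norm (T - - T0) < r \<Longrightarrow> even (neg_mult T) \<longleftrightarrow> even (neg_mult (- T0))"
      using neg_mult_locally_constant[OF 2 g0] by metis
    show thesis
    proof (rule that[OF r(1)])
      fix T assume "norm (T - T0) < r"
      then have "norm (- T - - T0) < r" by (simp add: norm_minus_commute)
      then show "Par T = Par T0" using r(2,3)[of "- T"] by (simp add: Par_positive 2 of_nat_bit)
    qed
  qed
qed

lemma Par_connected:
  fixes A B :: "'a \<Rightarrow>\<^sub>L 'a"
  assumes "connected_component GL A B"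
  shows "Par A = Par B"
proof -
  obtain C where C: "connected C" "C \<subseteq> GL" "A \<in> C" "B \<in> C" using assms by (auto simp: connected_component_def)
  have "\<forall>T\<in>C. eventually (\<lambda>T'. Par T = Par T') (at T within C)"
  proof
    fix T assume "T \<in> C"
    then obtain r where r: "0 < r" "\<And>T'. norm (T' - T) < r \<Longrightarrow> Par T' = Par T"
      using Par_locally_constant[of T] C(2) by blast
    then show "eventually (\<lambda>T'. Par T = Par T') (at T within C)"
      unfolding eventually_at dist_norm using r by metis
  qed
  then show ?thesis by (rule connected_local_const[OF C(1,3,4)])
qed

section \<open>Representatives of the two components\<close>

lemma connected_uminus:
  fixes A :: "'a \<Rightarrow>\<^sub>L 'a"
  assumes "A \<in> GL"
  shows "connected_component GL A (- A)"
proof -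
  define p where "p s = (sin (pi * s) *\<^sub>R J + cos (pi * s) *\<^sub>R id_blinfun) o\<^sub>L A" for s
  have "connected_component GL (p 0) (p 1)"
  proof (rule connected_component_path)
    show "continuous_on {0..1} p" unfolding p_def by (intro continuous_intros)
    show "p s \<in> GL" for s
      unfolding p_def
      by (intro GL_comp assms complex_combination_GL) (metis sin_cos_squared_add zero_power2 add.right_neutral zero_neq_one)
  qed
  moreover have "p 0 = A" "p 1 = - A"
    by (auto intro!: blinfun_eqI simp: p_def blinfun.add_left blinfun.scaleR_left blinfun.minus_left)
  ultimately show ?thesis by simp
qed

lemma Par_id: "Par (id_blinfun :: 'a \<Rightarrow>\<^sub>L 'a) = 0"
proof -
  have g: "id_blinfun -\<^sub>I t \<in> (GL :: ('a \<Rightarrow>\<^sub>L 'a) set)" if "t \<le> 0" for t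
    using neg_regular_id that by (auto simp: neg_regular_def)
  then have "neg_admissible (id_blinfun :: 'a \<Rightarrow>\<^sub>L 'a)"
    by (auto simp: neg_admissible_def GL_imp_Fred0)
  moreover have "neg_points (id_blinfun :: 'a \<Rightarrow>\<^sub>L 'a) = {}" using g by (auto simp: neg_points_def)
  then have "neg_mult (id_blinfun :: 'a \<Rightarrow>\<^sub>L 'a) = 0" by (simp add: neg_mult_def)
  ultimately show ?thesis by (simp add: Par_negative)
qed

text \<open>The parity is read off from a determinant: the reflection differs from the regular
  operator \<open>id_blinfun\<close> by finite rank, and its determinant is
  \<open>- 1\<close>.\<close>

lemma Par_rank1_reflection:
  fixes g :: "'a \<Rightarrow>\<^sub>L real"
  assumes "g v = 1"
  shows "Par (rank1_reflection g v) = 1"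
proof -
  let ?R = "rank1_reflection g v"
  note reg = neg_regular_id[where 'a = 'a]
  have fr: "finite_rank (?R - id_blinfun)"
    unfolding rank1_reflection_def by (simp add: finite_rank_uminus finite_rank_scaleR)
  have adm: "neg_admissible ?R"
    unfolding neg_admissible_def
  proof (intro conjI allI impI)
    show "?R \<in> GL" using assms by (rule rank1_reflection_GL)
    fix t :: real assume "t \<le> 0"
    then have "Fred0 (id_blinfun -\<^sub>I t :: 'a \<Rightarrow>\<^sub>L 'a)" using reg by (simp add: neg_regular_def GL_imp_Fred0)
    then show "Fred0 (?R -\<^sub>I t)"
      by (rule Fred0_finite_rank_diff) (use fr in simp)
  qed
  have "?R = id_blinfun + (\<Sum>i<(1::nat). rank1 g (- 2 *\<^sub>R v))"
    by (rule blinfun_eqI) (simp add: blinfun.add_left lessThan_Suc)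
  then have "opdet ?R = rep_det 1 (\<lambda>_. g) (\<lambda>_. - 2 *\<^sub>R v)" by (rule opdet_eq)
  also have "\<dots> = ndet 1 (\<lambda>i j. if i = j then - 1 else 0)"
    unfolding rep_det_def by (intro ndet_cong) (simp add: blinfun.scaleR_right blinfun.minus_right assms)
  also have "\<dots> = - 1" by (simp only: ndet_scalar) simp
  finally have det: "opdet ?R = - 1" .
  have "?R o\<^sub>L binv id_blinfun = ?R"
  proof (rule blinfun_eqI)
    fix x :: 'a
    have "binv id_blinfun (id_blinfun x) = x" by (rule binv_apply) simp
    then show "(?R o\<^sub>L binv id_blinfun) x = ?R x" by simp
  qed
  then have "(- 1 :: real) ^ neg_mult ?R = - 1"
    using sgn_opdet_neg_mult[OF adm reg fr assms] det by simp
  then have "odd (neg_mult ?R)" by (metis neg_one_even_power one_neq_neg_one)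
  then show ?thesis by (simp add: Par_negative[OF adm] of_nat_bit)
qed

text \<open>As \<open>R\<close> fixes \<open>H\<close> and negates \<open>x0\<close>, the vector
  \<open>x0\<close> lies outside \<open>H\<close>. Since \<open>H\<close> has codimension one, the
  functional vanishing on \<open>H\<close> with value \<open>1\<close> at \<open>x0\<close> reads
  off the component along \<open>x0\<close>.\<close>

lemma reflection_eq_rank1_reflection:
  fixes R :: "'a \<Rightarrow>\<^sub>L 'a"
  assumes "reflection R"
  obtains g v where "blinfun_apply g v = 1" "R = rank1_reflection g v"
proof -
  obtain H x0 where H: "hyperplane H" and x0: "x0 \<noteq> 0" "\<And>x. x \<in> H \<Longrightarrow> R x = x" "R x0 = - x0"
    using assms by (auto simp: reflection_def)
  obtain v where sub: "subspace H" "closed H" and v: "span (insert v H) = UNIV" using H by (auto simp: hyperplane_def)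
  have n: "x0 \<notin> H"
  proof
    assume "x0 \<in> H"
    then have "x0 = - x0" using x0 by metis
    then show False using x0(1) by (simp add: eq_neg_iff_add_eq_0 flip: scaleR_2)
  qed
  obtain g :: "'a \<Rightarrow>\<^sub>L real" where g: "g x0 = 1" "\<And>x. x \<in> H \<Longrightarrow> g x = 0"
    using separating_functional[OF sub n] by blast
  have ex: "\<exists>k. x - k *\<^sub>R v \<in> H" for x
  proof -
    have "x \<in> span (insert v H)" using v by simp
    then show ?thesis using sub(1) by (auto simp: span_insert span_eq_iff[THEN iffD2])
  qed
  obtain a where a: "x0 - a *\<^sub>R v \<in> H" using ex by blast
  have "a \<noteq> 0" using a n by auto
  have "R = rank1_reflection g x0"
  proof (rule blinfun_eqI)
    fix x
    obtain k where k: "x - k *\<^sub>R v \<in> H" using ex by blast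
    \<comment> \<open>Modulo \<open>H\<close>, \<open>x\<close> is \<open>k\<close> times
      \<open>v\<close> and \<open>x0\<close> is \<open>a\<close> times \<open>v\<close>, so the
      ratio expresses \<open>x\<close> through \<open>x0\<close>.\<close>
    define b where "b = k / a"
    have "(x - k *\<^sub>R v) - b *\<^sub>R (x0 - a *\<^sub>R v) \<in> H" by (rule subspace_diff[OF sub(1) k subspace_scale[OF sub(1) a]])
    moreover have "(x - k *\<^sub>R v) - b *\<^sub>R (x0 - a *\<^sub>R v) = x - b *\<^sub>R x0"
      using \<open>a \<noteq> 0\<close> by (simp add: b_def scaleR_diff_right)
    ultimately have h: "x - b *\<^sub>R x0 \<in> H" by simp
    have "g x = b" using g(2)[OF h] g(1) by (simp add: blinfun.diff_right blinfun.scaleR_right)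
    moreover have "R x = x - b *\<^sub>R x0 - b *\<^sub>R x0"
      using x0(2)[OF h] x0(3) by (simp add: blinfun.diff_right blinfun.scaleR_right algebra_simps)
    ultimately show "R x = rank1_reflection g x0 x" by (simp flip: scaleR_2 add: diff_diff_eq)
  qed
  then show thesis using g(1) by (intro that[of g x0])
qed

text \<open>Powers of an involution depend only on the parity of the exponent; when only
  \<open>- T\<close> is admissible, the path from \<open>T\<close> to \<open>- T\<close> comes
  first.\<close>

lemma connected_to_id_or_reflection:
  fixes T :: "'a \<Rightarrow>\<^sub>L 'a" and g0 :: "'a \<Rightarrow>\<^sub>L real"
  assumes T: "T \<in> GL" and g0: "g0 v0 = 1"
  shows "connected_component GL T id_blinfun \<or> connected_component GL T (rank1_reflection g0 v0)"
proof -
  have *: "connected_component GL A id_blinfun \<or> connected_component GL A (rank1_reflection g0 v0)"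
    if "neg_admissible A" for A
    using neg_split_all[OF that g0] bpow_involution[OF rank1_reflection_involution[OF g0]] by metis
  show ?thesis
    using GL_cases[OF T] *[of T] *[of "- T"] connected_uminus[OF T] connected_component_trans by metis
qed

text \<open>The two representatives have different parities and parity is constant on components, so
  the parity of an operator decides which representative it is joined to.\<close>

lemma GL_component_eq:
  fixes A :: "'a \<Rightarrow>\<^sub>L 'a"
  assumes A: "A \<in> GL"
  shows "connected_component_set GL A = {T \<in> GL. Par T = Par A}"
proof -
  obtain g0 :: "'a \<Rightarrow>\<^sub>L real" and v0 where g0: "g0 v0 = 1" by (rule exists_unit_pair)
  let ?R = "rank1_reflection g0 v0"
  have sep: "Par ?R = 1" "Par (id_blinfun :: 'a \<Rightarrow>\<^sub>L 'a) = 0" using Par_rank1_reflection[OF g0] Par_id by auto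
  have cls: "connected_component GL T (if Par T = 0 then id_blinfun else ?R)" if "T \<in> GL" for T
    using connected_to_id_or_reflection[OF that g0] Par_connected[of T] sep by (metis zero_neq_one)
  show ?thesis
  proof (intro Set.set_eqI iffI)
    fix T :: "'a \<Rightarrow>\<^sub>L 'a" assume "T \<in> connected_component_set GL A"
    then show "T \<in> {T \<in> GL. Par T = Par A}"
      using Par_connected[of A T] connected_component_in[of GL A T] by auto
  next
    fix T :: "'a \<Rightarrow>\<^sub>L 'a" assume T: "T \<in> {T \<in> GL. Par T = Par A}"
    then have "T \<in> GL" "Par T = Par A" by auto
    then have "connected_component GL T (if Par A = 0 then id_blinfun else ?R)" using cls[of T] by simp
    then have "connected_component GL A T"
      by (rule connected_component_trans[OF cls[OF A] connected_component_sym])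
    then show "T \<in> connected_component_set GL A" by simp
  qed
qed

end

theorem theorem4p5:
  assumes "infinite_dimensional (UNIV :: 'a::banach set)"
    and "hereditarily_indecomposable TYPE('a)"
    and "even_space TYPE('a)"
  shows "components (GL :: ('a \<Rightarrow>\<^sub>L 'a) set) = {GL0, GL1} \<and>
         (GL0 :: ('a \<Rightarrow>\<^sub>L 'a) set) \<noteq> GL1 \<and>
         (id_blinfun :: 'a \<Rightarrow>\<^sub>L 'a) \<in> GL0 \<and>
         - (id_blinfun :: 'a \<Rightarrow>\<^sub>L 'a) \<in> GL0 \<and>
         (\<forall>R :: 'a \<Rightarrow>\<^sub>L 'a. reflection R \<longrightarrow> R \<in> GL1) \<and>
         (\<forall>R :: 'a \<Rightarrow>\<^sub>L 'a. antireflection R \<longrightarrow> R \<in> GL1)"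
proof -
  obtain J0 :: "'a \<Rightarrow> 'a" where J0: "bounded_operator_on UNIV J0" "\<And>x. J0 (J0 x) = - x"
    using assms(3) by (auto simp: even_space_def complex_structure_on_def)
  obtain K where K: "\<And>x. norm (J0 x) \<le> K * norm x" using J0(1) by (auto simp: bounded_operator_on_def)
  have bl: "bounded_linear J0"
    by (rule bounded_linear_intro[where K = K]) (use J0(1) K in \<open>auto simp: bounded_operator_on_def mult.commute\<close>)
  interpret complex_hi_banach "TYPE('a)" "Blinfun J0"
    by unfold_locales (use assms J0 in \<open>auto simp: bounded_linear_Blinfun_apply[OF bl]\<close>)
  obtain g0 :: "'a \<Rightarrow>\<^sub>L real" and v0 where g0: "g0 v0 = 1" by (rule exists_unit_pair)
  let ?R = "rank1_reflection g0 v0"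
  have R: "?R \<in> GL" "Par ?R = 1" using rank1_reflection_GL[OF g0] Par_rank1_reflection[OF g0] by auto
  have GL0: "GL0 = connected_component_set GL (id_blinfun :: 'a \<Rightarrow>\<^sub>L 'a)"
    unfolding GL0_def GL_component_eq[OF GL_id] Par_id ..
  have GL1: "GL1 = connected_component_set GL ?R"
    unfolding GL1_def GL_component_eq[OF R(1)] R(2) ..
  have id0: "(id_blinfun :: 'a \<Rightarrow>\<^sub>L 'a) \<in> GL0" by (simp add: GL0_def Par_id)
  have "components (GL :: ('a \<Rightarrow>\<^sub>L 'a) set) = {GL0, GL1}"
  proof (intro Set.set_eqI iffI)
    fix C :: "('a \<Rightarrow>\<^sub>L 'a) set" assume "C \<in> components GL"
    then obtain A where A: "A \<in> GL" "C = connected_component_set GL A" by (auto simp: components_def)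
    then have "C = {T \<in> GL. Par T = Par A}" using GL_component_eq by simp
    then show "C \<in> {GL0, GL1}" by (cases "Par A") (auto simp: GL0_def GL1_def)
  next
    fix C :: "('a \<Rightarrow>\<^sub>L 'a) set" assume "C \<in> {GL0, GL1}"
    then show "C \<in> components GL" using R(1) by (auto simp: GL0 GL1 components_def)
  qed
  moreover have "(GL0 :: ('a \<Rightarrow>\<^sub>L 'a) set) \<noteq> GL1"
  proof
    assume "(GL0 :: ('a \<Rightarrow>\<^sub>L 'a) set) = GL1"
    with id0 have "(id_blinfun :: 'a \<Rightarrow>\<^sub>L 'a) \<in> GL1" by simp
    then show False by (simp add: GL1_def Par_id)
  qed
  moreover have "- (id_blinfun :: 'a \<Rightarrow>\<^sub>L 'a) \<in> GL0" using connected_uminus[OF GL_id] by (simp add: GL0)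
  moreover have refl: "S \<in> GL1" if "reflection S" for S :: "'a \<Rightarrow>\<^sub>L 'a"
    by (rule reflection_eq_rank1_reflection[OF that])
      (simp add: GL1_def rank1_reflection_GL Par_rank1_reflection)
  moreover have "S \<in> GL1" if S: "antireflection S" for S :: "'a \<Rightarrow>\<^sub>L 'a"
  proof -
    obtain S' where S': "reflection S'" "S = - S'" using S by (auto simp: antireflection_def)
    have S1: "S' \<in> GL" "Par S' = 1" using refl[OF S'(1)] by (auto simp: GL1_def)
    then show ?thesis using Par_connected[OF connected_uminus[OF S1(1)]] by (simp add: GL1_def S'(2))
  qed
  ultimately show ?thesis using id0 by blast
qed

end
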